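(* Let $n\ge 3$ and let $M$ be an $n$-dimensional $C$-totally real submanifold of a $(2m+1)$-dimensional generalized $(\kappa,\mu)$-contact space form with divided $R_5$, $\tilde M(f_1,f_2,f_3,f_4,f_{5,1},f_{5,2},f_6)$, satisfying $f_3=f_1-1$. Then for any $k$-tuple $(n_1,\ldots,n_k)\in\mathcal S(n)$, at each point of $M$, $$\delta(n_1,\ldots,n_k)\le c(n_1,\ldots,n_k)\|H\|^2+b(n_1,\ldots,n_k)f_1.$$ Equality holds at a point $p\in M$ if and only if there exists an orthonormal basis $\{e_1,\ldots,e_{2m+1}\}$ of $T_p\tilde M$ (with $e_1,\dots,e_n$ tangent to $M$ and $e_{n+1},\dots,e_{2m+1}$ normal to $M$) such that the shape operators $A_r=A_{e_r}$ of $M$ in $\tilde M$ at $p$ take the form $$A_r=\begin{pmatrix}A^r_1&\cdots&0&\\\vdots&\ddots&\vdots&0\\0&\cdots&A^r_k&\\&0&&a_rI\end{pmatrix},\qquad r=n+1,\ldots,2m+1,$$ where $I$ is an identity matrix and $A^r_i$ are symmetric $n_i\times n_i$ submatrices such that $$\operatorname{trace}(A^r_1)=\cdots=\operatorname{trace}(A^r_k)=a_r.$$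
   Context: An almost contact metric manifold $(\tilde M,\phi,\xi,\eta,\langle,\rangle)$ is a manifold with a $(1,1)$-tensor field $\phi$, a vector field $\xi$, a 1-form $\eta$ and a Riemannian metric $\langle,\rangle$ satisfying $\phi^2=-I+\eta\otimes\xi$, $\eta(\xi)=1$, $\eta\circ\phi=0$, $\phi\xi=0$, $\langle X,Y\rangle=\langle\phi X,\phi Y\rangle+\eta(X)\eta(Y)$, $\langle X,\xi\rangle=\eta(X)$, $\langle X,\phi Y\rangle=-\langle\phi X,Y\rangle$. It is a contact metric manifold if $d\eta(X,Y)=\langle X,\phi Y\rangle$. Put $2h=\mathcal L_\xi\phi$ (Lie derivative). On a contact metric manifold $h$ is symmetric, $h\xi=0$, $h\phi+\phi h=0$, $\operatorname{trace}h=\operatorname{trace}(\phi h)=0$, and $\tilde\nabla_X\xi=-\phi X-\phi hX$ (this fixes the normalization of $d\eta$). A generalized $(\kappa,\mu)$-space form with divided $R_5$, denoted $\tilde M(f_1,f_2,f_3,f_4,f_{5,1},f_{5,2},f_6)$, is an almost contact metric manifold with differentiable functions $f_1,f_2,f_3,f_4,f_{5,1},f_{5,2},f_6$ on $\tilde M$ such that its curvature tensor is $\tilde R=f_1R_1+f_2R_2+f_3R_3+f_4R_4+f_{5,1}R_{5,1}+f_{5,2}R_{5,2}+f_6R_6$, where $R_1(X,Y)Z=\langle Y,Z\rangle X-\langle X,Z\rangle Y$; $R_2(X,Y)Z=\langle X,\phi Z\rangle\phi Y-\langle Y,\phi Z\rangle\phi X+2\langle X,\phi Y\rangle\phi Z$;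 $R_3(X,Y)Z=\eta(X)\eta(Z)Y-\eta(Y)\eta(Z)X+\langle X,Z\rangle\eta(Y)\xi-\langle Y,Z\rangle\eta(X)\xi$; $R_4(X,Y)Z=\langle Y,Z\rangle hX-\langle X,Z\rangle hY+\langle hY,Z\rangle X-\langle hX,Z\rangle Y$; $R_{5,1}(X,Y)Z=\langle hY,Z\rangle hX-\langle hX,Z\rangle hY$; $R_{5,2}(X,Y)Z=\langle\phi hY,Z\rangle\phi hX-\langle\phi hX,Z\rangle\phi hY$; $R_6(X,Y)Z=\eta(X)\eta(Z)hY-\eta(Y)\eta(Z)hX+\langle hX,Z\rangle\eta(Y)\xi-\langle hY,Z\rangle\eta(X)\xi$. It is called a generalized $(\kappa,\mu)$-contact space form with divided $R_5$ when the structure is contact metric. Curvature convention: $\tilde R(X,Y,Z,W)=\langle\tilde R(X,Y)Z,W\rangle$, and the sectional curvature of the plane spanned by orthonormal $X,Y$ is $\tilde R(X,Y,Y,X)$ (similarly for $M$). A submanifold $M$ of a contact metric manifold $\tilde M$ is $C$-totally real if $\xi$ is normal to $M$ (every tangent vector lies in the contact distribution $\ker\eta$). $M$ carries the induced metric; $\sigma$ is its second fundamental form, $A_N$ the shape operator, $\langle A_NX,Y\rangle=\langle\sigma(X,Y),N\rangle$, and $H=\frac1n\operatorname{trace}(\sigma)$ is the mean curvature vector. Matrices of $A_r$ are taken with respect to $\{e_1,\dots,e_n\}$. For a subspace $L\subset T_pM$ of dimension $\ell$ with orthonormal basis $\{e_1,\dots,e_\ell\}$, $\tau(L)=\sum_{1\le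 i<j\le \ell}K(e_i\wedge e_j)$ with $K$ the sectional curvature of $M$; $\tau(p)=\tau(T_pM)$ is the scalar curvature. For an integer $k\ge0$, $\mathcal S(n,k)$ is the set of unordered $k$-tuples $(n_1,\dots,n_k)$ of integers $\ge2$ with $n_1<n$ and $n_1+\cdots+n_k\le n$, and $\mathcal S(n)$ is the set of all such unordered $k$-tuples with $k\ge0$, for fixed $n$. For $(n_1,\dots,n_k)\in\mathcal S(n)$, $$\delta(n_1,\dots,n_k)(p)=\tau(p)-\inf\{\tau(L_1)+\cdots+\tau(L_k)\},$$ where $L_1,\dots,L_k$ run over all $k$ mutually orthogonal subspaces of $T_pM$ with $\dim L_j=n_j$ (so $\delta(\emptyset)=\tau$ for $k=0$), and $$c(n_1,\dots,n_k)=\frac{n^2\big(n+k-1-\sum_{j=1}^kn_j\big)}{2\big(n+k-\sum_{j=1}^kn_j\big)},\qquad b(n_1,\dots,n_k)=\tfrac12n(n-1)-\tfrac12\sum_{j=1}^kn_j(n_j-1).$$ *)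

theory Defs
  imports "HOL-Analysis.Analysis"
begin

section \<open>Smooth functions on open subsets of Euclidean spaces\<close>

primrec Ck_on :: "nat \<Rightarrow> 'e::euclidean_space set \<Rightarrow> ('e \<Rightarrow> 'f::real_normed_vector) \<Rightarrow> bool" where
  "Ck_on 0 S f \<longleftrightarrow> continuous_on S f"
| "Ck_on (Suc k) S f \<longleftrightarrow> (\<forall>x\<in>S. f differentiable (at x)) \<and>
     (\<forall>v. Ck_on k S (\<lambda>x. frechet_derivative f (at x) v))"

definition smooth_on :: "'e::euclidean_space set \<Rightarrow> ('e \<Rightarrow> 'f::real_normed_vector) \<Rightarrow> bool" where
  "smooth_on S f \<longleftrightarrow> (\<forall>k. Ck_on k S f)"

section \<open>Smooth manifolds\<close>

text \<open>
  A manifold is a Hausdorff, second countable type with a smooth atlas; its dimension is the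
  dimension of the model space. A chart is a pair of its domain and its coordinate map.
\<close>

type_synonym ('a, 'e) chart = "'a set \<times> ('a \<Rightarrow> 'e)"

abbreviation coords :: "('a, 'e) chart \<Rightarrow> 'a \<Rightarrow> 'e" where
  "coords c \<equiv> snd c"

definition inv_coords :: "('a, 'e) chart \<Rightarrow> 'e \<Rightarrow> 'a" where
  "inv_coords c = inv_into (fst c) (coords c)"

definition chart_image :: "('a, 'e) chart \<Rightarrow> 'e set" where
  "chart_image c = coords c ` fst c"

definition is_chart :: "('a::topological_space, 'e::euclidean_space) chart \<Rightarrow> bool" where
  "is_chart c \<longleftrightarrow> open (fst c) \<and> open (chart_image c) \<and>
     homeomorphism (fst c) (chart_image c) (coords c) (inv_coords c)"

definition smooth_atlas ::
    "('a::{t2_space, second_countable_topology}, 'e::euclidean_space) chart set \<Rightarrow> bool" where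
  "smooth_atlas A \<longleftrightarrow> (\<forall>c\<in>A. is_chart c) \<and> (\<Union>c\<in>A. fst c) = UNIV \<and>
     (\<forall>c\<in>A. \<forall>d\<in>A. smooth_on (coords c ` (fst c \<inter> fst d)) (coords d \<circ> inv_coords c))"

text \<open>
  The tangent space at a point \<open>p\<close> is the model space, a tangent vector being represented by its
  components in one fixed chart \<open>chart_at A p\<close> of the atlas around \<open>p\<close>. Thus a tensor field
  assigns to every point a tensor on the model space; components in another chart are obtained
  from the derivative of the change of coordinates, \<open>tangent_change\<close>.
\<close>

definition chart_at :: "('a, 'e) chart set \<Rightarrow> 'a \<Rightarrow> ('a, 'e) chart" where
  "chart_at A p = (SOME c. c \<in> A \<and> p \<in> fst c)"

definition tangent_change ::
    "('a, 'e::euclidean_space) chart \<Rightarrow> ('a, 'e) chart \<Rightarrow> 'a \<Rightarrow> 'e \<Rightarrow> 'e" where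
  "tangent_change c d p = frechet_derivative (coords d \<circ> inv_coords c) (at (coords c p))"

text \<open>Components of functions and tensor fields in a chart \<open>c\<close>, at the point with coordinates \<open>x\<close>.\<close>

definition fun_rep :: "('a, 'e) chart \<Rightarrow> ('a \<Rightarrow> real) \<Rightarrow> 'e \<Rightarrow> real" where
  "fun_rep c f x = f (inv_coords c x)"

definition vec_rep ::
    "('a, 'e::euclidean_space) chart set \<Rightarrow> ('a, 'e) chart \<Rightarrow> ('a \<Rightarrow> 'e) \<Rightarrow> 'e \<Rightarrow> 'e" where
  "vec_rep A c X x = (let p = inv_coords c x in tangent_change (chart_at A p) c p (X p))"

definition form_rep ::
    "('a, 'e::euclidean_space) chart set \<Rightarrow> ('a, 'e) chart \<Rightarrow> ('a \<Rightarrow> 'e \<Rightarrow> real) \<Rightarrow> 'e \<Rightarrow> 'e \<Rightarrow> real" where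
  "form_rep A c \<omega> x u = (let p = inv_coords c x in \<omega> p (tangent_change c (chart_at A p) p u))"

definition endo_rep ::
    "('a, 'e::euclidean_space) chart set \<Rightarrow> ('a, 'e) chart \<Rightarrow> ('a \<Rightarrow> 'e \<Rightarrow> 'e) \<Rightarrow> 'e \<Rightarrow> 'e \<Rightarrow> 'e" where
  "endo_rep A c \<Phi> x u = (let p = inv_coords c x in
     tangent_change (chart_at A p) c p (\<Phi> p (tangent_change c (chart_at A p) p u)))"

definition metric_rep ::
    "('a, 'e::euclidean_space) chart set \<Rightarrow> ('a, 'e) chart \<Rightarrow> ('a \<Rightarrow> 'e \<Rightarrow> 'e \<Rightarrow> real)
      \<Rightarrow> 'e \<Rightarrow> 'e \<Rightarrow> 'e \<Rightarrow> real" where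
  "metric_rep A c g x u v = (let p = inv_coords c x in
     g p (tangent_change c (chart_at A p) p u) (tangent_change c (chart_at A p) p v))"

definition smooth_function :: "('a, 'e::euclidean_space) chart set \<Rightarrow> ('a \<Rightarrow> real) \<Rightarrow> bool" where
  "smooth_function A f \<longleftrightarrow> (\<forall>c\<in>A. smooth_on (chart_image c) (fun_rep c f))"

definition smooth_vector_field :: "('a, 'e::euclidean_space) chart set \<Rightarrow> ('a \<Rightarrow> 'e) \<Rightarrow> bool" where
  "smooth_vector_field A X \<longleftrightarrow> (\<forall>c\<in>A. smooth_on (chart_image c) (vec_rep A c X))"

definition smooth_one_form ::
    "('a, 'e::euclidean_space) chart set \<Rightarrow> ('a \<Rightarrow> 'e \<Rightarrow> real) \<Rightarrow> bool" where
  "smooth_one_form A \<omega> \<longleftrightarrow> (\<forall>p. linear (\<omega> p)) \<and>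
     (\<forall>c\<in>A. \<forall>u. smooth_on (chart_image c) (\<lambda>x. form_rep A c \<omega> x u))"

definition smooth_endo_field ::
    "('a, 'e::euclidean_space) chart set \<Rightarrow> ('a \<Rightarrow> 'e \<Rightarrow> 'e) \<Rightarrow> bool" where
  "smooth_endo_field A \<Phi> \<longleftrightarrow> (\<forall>p. linear (\<Phi> p)) \<and>
     (\<forall>c\<in>A. \<forall>u. smooth_on (chart_image c) (\<lambda>x. endo_rep A c \<Phi> x u))"

definition riemannian_metric ::
    "('a, 'e::euclidean_space) chart set \<Rightarrow> ('a \<Rightarrow> 'e \<Rightarrow> 'e \<Rightarrow> real) \<Rightarrow> bool" where
  "riemannian_metric A g \<longleftrightarrow>
     (\<forall>p. bilinear (g p) \<and> (\<forall>X Y. g p X Y = g p Y X) \<and> (\<forall>X. X \<noteq> 0 \<longrightarrow> 0 < g p X X)) \<and>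
     (\<forall>c\<in>A. \<forall>u v. smooth_on (chart_image c) (\<lambda>x. metric_rep A c g x u v))"

section \<open>Calculus in a coordinate domain\<close>

text \<open>
  Vector fields on a coordinate domain are functions from the model space to itself. The map
  \<open>christoffel G x\<close> is the bilinear map whose components are the Christoffel symbols of the
  metric \<open>G\<close>, and \<open>nabla G\<close> is the Levi-Civita connection.
\<close>

definition bracket :: "('e::euclidean_space \<Rightarrow> 'e) \<Rightarrow> ('e \<Rightarrow> 'e) \<Rightarrow> 'e \<Rightarrow> 'e" where
  "bracket X Y x = frechet_derivative Y (at x) (X x) - frechet_derivative X (at x) (Y x)"

definition christoffel ::
    "('e::euclidean_space \<Rightarrow> 'e \<Rightarrow> 'e \<Rightarrow> real) \<Rightarrow> 'e \<Rightarrow> 'e \<Rightarrow> 'e \<Rightarrow> 'e" where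
  "christoffel G x u v = (THE w. \<forall>z. G x w z =
     (frechet_derivative (\<lambda>y. G y v z) (at x) u + frechet_derivative (\<lambda>y. G y u z) (at x) v
       - frechet_derivative (\<lambda>y. G y u v) (at x) z) / 2)"

definition nabla ::
    "('e::euclidean_space \<Rightarrow> 'e \<Rightarrow> 'e \<Rightarrow> real) \<Rightarrow> ('e \<Rightarrow> 'e) \<Rightarrow> ('e \<Rightarrow> 'e) \<Rightarrow> 'e \<Rightarrow> 'e" where
  "nabla G X Y x = frechet_derivative Y (at x) (X x) + christoffel G x (X x) (Y x)"

definition curvature_op ::
    "('e::euclidean_space \<Rightarrow> 'e \<Rightarrow> 'e \<Rightarrow> real) \<Rightarrow> ('e \<Rightarrow> 'e) \<Rightarrow> ('e \<Rightarrow> 'e) \<Rightarrow> ('e \<Rightarrow> 'e) \<Rightarrow> 'e \<Rightarrow> 'e" where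
  "curvature_op G X Y Z x =
     nabla G X (nabla G Y Z) x - nabla G Y (nabla G X Z) x - nabla G (bracket X Y) Z x"

section \<open>Tensors on a manifold obtained by differentiation\<close>

text \<open>
  The following are tensorial, so their value at \<open>p\<close> may be computed in the chart \<open>chart_at A p\<close>,
  whose components are the ones used for the tangent space at \<open>p\<close>, with the vectors extended to
  fields that are constant in this chart.
\<close>

definition riemann ::
    "('a, 'e::euclidean_space) chart set \<Rightarrow> ('a \<Rightarrow> 'e \<Rightarrow> 'e \<Rightarrow> real) \<Rightarrow> 'a \<Rightarrow> 'e \<Rightarrow> 'e \<Rightarrow> 'e \<Rightarrow> 'e" where
  "riemann A g p X Y Z =
     curvature_op (metric_rep A (chart_at A p) g) (\<lambda>_. X) (\<lambda>_. Y) (\<lambda>_. Z) (coords (chart_at A p) p)"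

text \<open>
  The normalization is \<open>2 d\<eta>(X,Y) = X \<eta>(Y) - Y \<eta>(X) - \<eta>([X,Y])\<close>; it is the one for which
  \<open>\<nabla>\<^sub>X \<xi> = - \<phi> X - \<phi> h X\<close> on a contact metric manifold.
\<close>

definition ext_deriv ::
    "('a, 'e::euclidean_space) chart set \<Rightarrow> ('a \<Rightarrow> 'e \<Rightarrow> real) \<Rightarrow> 'a \<Rightarrow> 'e \<Rightarrow> 'e \<Rightarrow> real" where
  "ext_deriv A \<eta> p X Y = (let c = chart_at A p; x = coords c p in
     (frechet_derivative (\<lambda>y. form_rep A c \<eta> y Y) (at x) X
       - frechet_derivative (\<lambda>y. form_rep A c \<eta> y X) (at x) Y) / 2)"

definition lie_deriv_endo ::
    "('a, 'e::euclidean_space) chart set \<Rightarrow> ('a \<Rightarrow> 'e) \<Rightarrow> ('a \<Rightarrow> 'e \<Rightarrow> 'e) \<Rightarrow> 'a \<Rightarrow> 'e \<Rightarrow> 'e" where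
  "lie_deriv_endo A V \<Phi> p X = (let c = chart_at A p; x = coords c p in
     bracket (vec_rep A c V) (\<lambda>y. endo_rep A c \<Phi> y X) x
       - endo_rep A c \<Phi> x (bracket (vec_rep A c V) (\<lambda>_. X) x))"

section \<open>Contact metric manifolds and generalized space forms\<close>

definition almost_contact_metric ::
    "('a::{t2_space, second_countable_topology}, 'e::euclidean_space) chart set \<Rightarrow>
      ('a \<Rightarrow> 'e \<Rightarrow> 'e) \<Rightarrow> ('a \<Rightarrow> 'e) \<Rightarrow> ('a \<Rightarrow> 'e \<Rightarrow> real) \<Rightarrow> ('a \<Rightarrow> 'e \<Rightarrow> 'e \<Rightarrow> real) \<Rightarrow> bool" where
  "almost_contact_metric A \<phi> \<xi> \<eta> g \<longleftrightarrow>
     smooth_atlas A \<and> smooth_endo_field A \<phi> \<and> smooth_vector_field A \<xi> \<and>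
     smooth_one_form A \<eta> \<and> riemannian_metric A g \<and>
     (\<forall>p. (\<forall>X. \<phi> p (\<phi> p X) = - X + \<eta> p X *\<^sub>R \<xi> p) \<and>
          \<eta> p (\<xi> p) = 1 \<and>
          (\<forall>X. \<eta> p (\<phi> p X) = 0) \<and>
          \<phi> p (\<xi> p) = 0 \<and>
          (\<forall>X Y. g p X Y = g p (\<phi> p X) (\<phi> p Y) + \<eta> p X * \<eta> p Y) \<and>
          (\<forall>X. g p X (\<xi> p) = \<eta> p X) \<and>
          (\<forall>X Y. g p X (\<phi> p Y) = - g p (\<phi> p X) Y))"

definition contact_metric ::
    "('a::{t2_space, second_countable_topology}, 'e::euclidean_space) chart set \<Rightarrow>
      ('a \<Rightarrow> 'e \<Rightarrow> 'e) \<Rightarrow> ('a \<Rightarrow> 'e) \<Rightarrow> ('a \<Rightarrow> 'e \<Rightarrow> real) \<Rightarrow> ('a \<Rightarrow> 'e \<Rightarrow> 'e \<Rightarrow> real) \<Rightarrow> bool" where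
  "contact_metric A \<phi> \<xi> \<eta> g \<longleftrightarrow> almost_contact_metric A \<phi> \<xi> \<eta> g \<and>
     (\<forall>p X Y. ext_deriv A \<eta> p X Y = g p X (\<phi> p Y))"

definition h_tensor ::
    "('a, 'e::euclidean_space) chart set \<Rightarrow> ('a \<Rightarrow> 'e \<Rightarrow> 'e) \<Rightarrow> ('a \<Rightarrow> 'e) \<Rightarrow> 'a \<Rightarrow> 'e \<Rightarrow> 'e" where
  "h_tensor A \<phi> \<xi> p X = (1/2) *\<^sub>R lie_deriv_endo A \<xi> \<phi> p X"

text \<open>Here \<open>g\<close>, \<open>\<phi>\<close>, \<open>\<xi>\<close>, \<open>\<eta>\<close> and \<open>h\<close> are the values of the structure tensors at one point.\<close>

definition R1 :: "('e::real_vector \<Rightarrow> 'e \<Rightarrow> real) \<Rightarrow> 'e \<Rightarrow> 'e \<Rightarrow> 'e \<Rightarrow> 'e" where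
  "R1 g X Y Z = g Y Z *\<^sub>R X - g X Z *\<^sub>R Y"

definition R2 :: "('e::real_vector \<Rightarrow> 'e \<Rightarrow> real) \<Rightarrow> ('e \<Rightarrow> 'e) \<Rightarrow> 'e \<Rightarrow> 'e \<Rightarrow> 'e \<Rightarrow> 'e" where
  "R2 g \<phi> X Y Z = g X (\<phi> Z) *\<^sub>R \<phi> Y - g Y (\<phi> Z) *\<^sub>R \<phi> X + (2 * g X (\<phi> Y)) *\<^sub>R \<phi> Z"

definition R3 ::
    "('e::real_vector \<Rightarrow> 'e \<Rightarrow> real) \<Rightarrow> 'e \<Rightarrow> ('e \<Rightarrow> real) \<Rightarrow> 'e \<Rightarrow> 'e \<Rightarrow> 'e \<Rightarrow> 'e" where
  "R3 g \<xi> \<eta> X Y Z = (\<eta> X * \<eta> Z) *\<^sub>R Y - (\<eta> Y * \<eta> Z) *\<^sub>R X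
     + (g X Z * \<eta> Y) *\<^sub>R \<xi> - (g Y Z * \<eta> X) *\<^sub>R \<xi>"

definition R4 :: "('e::real_vector \<Rightarrow> 'e \<Rightarrow> real) \<Rightarrow> ('e \<Rightarrow> 'e) \<Rightarrow> 'e \<Rightarrow> 'e \<Rightarrow> 'e \<Rightarrow> 'e" where
  "R4 g h X Y Z = g Y Z *\<^sub>R h X - g X Z *\<^sub>R h Y + g (h Y) Z *\<^sub>R X - g (h X) Z *\<^sub>R Y"

definition R51 :: "('e::real_vector \<Rightarrow> 'e \<Rightarrow> real) \<Rightarrow> ('e \<Rightarrow> 'e) \<Rightarrow> 'e \<Rightarrow> 'e \<Rightarrow> 'e \<Rightarrow> 'e" where
  "R51 g h X Y Z = g (h Y) Z *\<^sub>R h X - g (h X) Z *\<^sub>R h Y"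

definition R52 ::
    "('e::real_vector \<Rightarrow> 'e \<Rightarrow> real) \<Rightarrow> ('e \<Rightarrow> 'e) \<Rightarrow> ('e \<Rightarrow> 'e) \<Rightarrow> 'e \<Rightarrow> 'e \<Rightarrow> 'e \<Rightarrow> 'e" where
  "R52 g \<phi> h X Y Z = g (\<phi> (h Y)) Z *\<^sub>R \<phi> (h X) - g (\<phi> (h X)) Z *\<^sub>R \<phi> (h Y)"

definition R6 ::
    "('e::real_vector \<Rightarrow> 'e \<Rightarrow> real) \<Rightarrow> 'e \<Rightarrow> ('e \<Rightarrow> real) \<Rightarrow> ('e \<Rightarrow> 'e) \<Rightarrow> 'e \<Rightarrow> 'e \<Rightarrow> 'e \<Rightarrow> 'e" where
  "R6 g \<xi> \<eta> h X Y Z = (\<eta> X * \<eta> Z) *\<^sub>R h Y - (\<eta> Y * \<eta> Z) *\<^sub>R h X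
     + (g (h X) Z * \<eta> Y) *\<^sub>R \<xi> - (g (h Y) Z * \<eta> X) *\<^sub>R \<xi>"

definition gen_space_form_divided_R5 ::
    "('a::{t2_space, second_countable_topology}, 'e::euclidean_space) chart set \<Rightarrow>
      ('a \<Rightarrow> 'e \<Rightarrow> 'e) \<Rightarrow> ('a \<Rightarrow> 'e) \<Rightarrow> ('a \<Rightarrow> 'e \<Rightarrow> real) \<Rightarrow> ('a \<Rightarrow> 'e \<Rightarrow> 'e \<Rightarrow> real) \<Rightarrow>
      ('a \<Rightarrow> real) \<Rightarrow> ('a \<Rightarrow> real) \<Rightarrow> ('a \<Rightarrow> real) \<Rightarrow> ('a \<Rightarrow> real) \<Rightarrow>
      ('a \<Rightarrow> real) \<Rightarrow> ('a \<Rightarrow> real) \<Rightarrow> ('a \<Rightarrow> real) \<Rightarrow> bool" where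
  "gen_space_form_divided_R5 A \<phi> \<xi> \<eta> g f1 f2 f3 f4 f51 f52 f6 \<longleftrightarrow>
     almost_contact_metric A \<phi> \<xi> \<eta> g \<and>
     (\<forall>f\<in>{f1, f2, f3, f4, f51, f52, f6}. smooth_function A f) \<and>
     (\<forall>p X Y Z. riemann A g p X Y Z =
        f1 p *\<^sub>R R1 (g p) X Y Z
        + f2 p *\<^sub>R R2 (g p) (\<phi> p) X Y Z
        + f3 p *\<^sub>R R3 (g p) (\<xi> p) (\<eta> p) X Y Z
        + f4 p *\<^sub>R R4 (g p) (h_tensor A \<phi> \<xi> p) X Y Z
        + f51 p *\<^sub>R R51 (g p) (h_tensor A \<phi> \<xi> p) X Y Z
        + f52 p *\<^sub>R R52 (g p) (\<phi> p) (h_tensor A \<phi> \<xi> p) X Y Z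
        + f6 p *\<^sub>R R6 (g p) (\<xi> p) (\<eta> p) (h_tensor A \<phi> \<xi> p) X Y Z)"

definition gen_contact_space_form_divided_R5 ::
    "('a::{t2_space, second_countable_topology}, 'e::euclidean_space) chart set \<Rightarrow>
      ('a \<Rightarrow> 'e \<Rightarrow> 'e) \<Rightarrow> ('a \<Rightarrow> 'e) \<Rightarrow> ('a \<Rightarrow> 'e \<Rightarrow> real) \<Rightarrow> ('a \<Rightarrow> 'e \<Rightarrow> 'e \<Rightarrow> real) \<Rightarrow>
      ('a \<Rightarrow> real) \<Rightarrow> ('a \<Rightarrow> real) \<Rightarrow> ('a \<Rightarrow> real) \<Rightarrow> ('a \<Rightarrow> real) \<Rightarrow>
      ('a \<Rightarrow> real) \<Rightarrow> ('a \<Rightarrow> real) \<Rightarrow> ('a \<Rightarrow> real) \<Rightarrow> bool" where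
  "gen_contact_space_form_divided_R5 A \<phi> \<xi> \<eta> g f1 f2 f3 f4 f51 f52 f6 \<longleftrightarrow>
     contact_metric A \<phi> \<xi> \<eta> g \<and>
     gen_space_form_divided_R5 A \<phi> \<xi> \<eta> g f1 f2 f3 f4 f51 f52 f6"

section \<open>Submanifolds\<close>

text \<open>
  A submanifold is given by a smooth immersion \<open>\<iota>\<close> of a manifold with atlas \<open>B\<close> into the ambient
  manifold with atlas \<open>A\<close>; an embedded submanifold is the case of an inclusion map.
\<close>

definition map_rep ::
    "('b, 'd) chart \<Rightarrow> ('a, 'e) chart \<Rightarrow> ('b \<Rightarrow> 'a) \<Rightarrow> 'd \<Rightarrow> 'e" where
  "map_rep c d \<iota> = coords d \<circ> \<iota> \<circ> inv_coords c"

definition differential ::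
    "('b, 'd::euclidean_space) chart set \<Rightarrow> ('a, 'e::euclidean_space) chart set \<Rightarrow> ('b \<Rightarrow> 'a) \<Rightarrow>
      'b \<Rightarrow> 'd \<Rightarrow> 'e" where
  "differential B A \<iota> p = frechet_derivative
     (map_rep (chart_at B p) (chart_at A (\<iota> p)) \<iota>) (at (coords (chart_at B p) p))"

definition smooth_immersion ::
    "('b::topological_space, 'd::euclidean_space) chart set \<Rightarrow>
      ('a::topological_space, 'e::euclidean_space) chart set \<Rightarrow> ('b \<Rightarrow> 'a) \<Rightarrow> bool" where
  "smooth_immersion B A \<iota> \<longleftrightarrow> continuous_on UNIV \<iota> \<and>
     (\<forall>c\<in>B. \<forall>d\<in>A. smooth_on (coords c ` (fst c \<inter> \<iota> -` fst d)) (map_rep c d \<iota>)) \<and>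
     (\<forall>p. inj (differential B A \<iota> p))"

definition induced_metric ::
    "('b, 'd::euclidean_space) chart set \<Rightarrow> ('a, 'e::euclidean_space) chart set \<Rightarrow>
      ('a \<Rightarrow> 'e \<Rightarrow> 'e \<Rightarrow> real) \<Rightarrow> ('b \<Rightarrow> 'a) \<Rightarrow> 'b \<Rightarrow> 'd \<Rightarrow> 'd \<Rightarrow> real" where
  "induced_metric B A g \<iota> p u v =
     g (\<iota> p) (differential B A \<iota> p u) (differential B A \<iota> p v)"

definition normal_vectors ::
    "('b, 'd::euclidean_space) chart set \<Rightarrow> ('a, 'e::euclidean_space) chart set \<Rightarrow>
      ('a \<Rightarrow> 'e \<Rightarrow> 'e \<Rightarrow> real) \<Rightarrow> ('b \<Rightarrow> 'a) \<Rightarrow> 'b \<Rightarrow> 'e set" where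
  "normal_vectors B A g \<iota> p = {N. \<forall>u. g (\<iota> p) (differential B A \<iota> p u) N = 0}"

definition normal_part ::
    "('b, 'd::euclidean_space) chart set \<Rightarrow> ('a, 'e::euclidean_space) chart set \<Rightarrow>
      ('a \<Rightarrow> 'e \<Rightarrow> 'e \<Rightarrow> real) \<Rightarrow> ('b \<Rightarrow> 'a) \<Rightarrow> 'b \<Rightarrow> 'e \<Rightarrow> 'e" where
  "normal_part B A g \<iota> p w =
     (THE N. N \<in> normal_vectors B A g \<iota> p \<and> w - N \<in> range (differential B A \<iota> p))"

definition C_totally_real ::
    "('b, 'd::euclidean_space) chart set \<Rightarrow> ('a, 'e::euclidean_space) chart set \<Rightarrow>
      ('a \<Rightarrow> 'e) \<Rightarrow> ('a \<Rightarrow> 'e \<Rightarrow> 'e \<Rightarrow> real) \<Rightarrow> ('b \<Rightarrow> 'a) \<Rightarrow> bool" where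
  "C_totally_real B A \<xi> g \<iota> \<longleftrightarrow> (\<forall>p. \<xi> (\<iota> p) \<in> normal_vectors B A g \<iota> p)"

text \<open>
  The second fundamental form is the normal part of the ambient covariant derivative, in the
  direction \<open>u\<close>, of the vector field along \<open>\<iota>\<close> that is the image under \<open>d\<iota>\<close> of the
  coordinate-constant field \<open>v\<close>.
\<close>

definition second_fundamental_form ::
    "('b, 'd::euclidean_space) chart set \<Rightarrow> ('a, 'e::euclidean_space) chart set \<Rightarrow>
      ('a \<Rightarrow> 'e \<Rightarrow> 'e \<Rightarrow> real) \<Rightarrow> ('b \<Rightarrow> 'a) \<Rightarrow> 'b \<Rightarrow> 'd \<Rightarrow> 'd \<Rightarrow> 'e" where
  "second_fundamental_form B A g \<iota> p u v =
     (let c = chart_at B p; d = chart_at A (\<iota> p); F = map_rep c d \<iota>; x = coords c p in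
      normal_part B A g \<iota> p
        (frechet_derivative (\<lambda>y. frechet_derivative F (at y) v) (at x) u
          + christoffel (metric_rep A d g) (F x)
              (frechet_derivative F (at x) u) (frechet_derivative F (at x) v)))"

definition shape_operator ::
    "('b, 'd::euclidean_space) chart set \<Rightarrow> ('a, 'e::euclidean_space) chart set \<Rightarrow>
      ('a \<Rightarrow> 'e \<Rightarrow> 'e \<Rightarrow> real) \<Rightarrow> ('b \<Rightarrow> 'a) \<Rightarrow> 'b \<Rightarrow> 'e \<Rightarrow> 'd \<Rightarrow> 'd" where
  "shape_operator B A g \<iota> p N u = (THE w. \<forall>v.
     induced_metric B A g \<iota> p w v = g (\<iota> p) (second_fundamental_form B A g \<iota> p u v) N)"

text \<open>\<open>E 0, \<dots>, E (dim L - 1)\<close> is an orthonormal basis of \<open>L\<close> for the inner product \<open>G\<close>.\<close>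

definition orthonormal_basis ::
    "('e::euclidean_space \<Rightarrow> 'e \<Rightarrow> real) \<Rightarrow> 'e set \<Rightarrow> (nat \<Rightarrow> 'e) \<Rightarrow> bool" where
  "orthonormal_basis G L E \<longleftrightarrow>
     (\<forall>i<dim L. \<forall>j<dim L. G (E i) (E j) = (if i = j then 1 else 0)) \<and> span (E ` {..<dim L}) = L"

text \<open>The trace and \<open>\<tau>(L)\<close> below do not depend on the orthonormal basis that is chosen.\<close>

definition mean_curvature ::
    "('b, 'd::euclidean_space) chart set \<Rightarrow> ('a, 'e::euclidean_space) chart set \<Rightarrow>
      ('a \<Rightarrow> 'e \<Rightarrow> 'e \<Rightarrow> real) \<Rightarrow> ('b \<Rightarrow> 'a) \<Rightarrow> 'b \<Rightarrow> 'e" where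
  "mean_curvature B A g \<iota> p =
     (let E = (SOME E. orthonormal_basis (induced_metric B A g \<iota> p) UNIV E) in
      (1 / real DIM('d)) *\<^sub>R (\<Sum>i<DIM('d). second_fundamental_form B A g \<iota> p (E i) (E i)))"

definition sectional_curvature ::
    "('b, 'd::euclidean_space) chart set \<Rightarrow> ('b \<Rightarrow> 'd \<Rightarrow> 'd \<Rightarrow> real) \<Rightarrow> 'b \<Rightarrow> 'd \<Rightarrow> 'd \<Rightarrow> real" where
  "sectional_curvature B g p X Y =
     g p (riemann B g p X Y Y) X / (g p X X * g p Y Y - (g p X Y)\<^sup>2)"

definition tau ::
    "('b, 'd::euclidean_space) chart set \<Rightarrow> ('b \<Rightarrow> 'd \<Rightarrow> 'd \<Rightarrow> real) \<Rightarrow> 'b \<Rightarrow> 'd set \<Rightarrow> real" where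
  "tau B g p L = (let E = (SOME E. orthonormal_basis (g p) L E) in
     (\<Sum>j<dim L. \<Sum>i<j. sectional_curvature B g p (E i) (E j)))"

section \<open>Chen's invariants\<close>

text \<open>
  An unordered tuple is represented by any list of its entries. Since the order is immaterial,
  \<open>n\<^sub>1 < n\<close> is required of every entry (for two or more entries it follows from the other
  conditions).
\<close>

definition chen_tuples :: "nat \<Rightarrow> nat list set" where
  "chen_tuples n = {ns. (\<forall>x\<in>set ns. 2 \<le> x \<and> x < n) \<and> sum_list ns \<le> n}"

definition orthogonal_subspaces ::
    "('d::euclidean_space \<Rightarrow> 'd \<Rightarrow> real) \<Rightarrow> nat list \<Rightarrow> 'd set list \<Rightarrow> bool" where
  "orthogonal_subspaces G ns Ls \<longleftrightarrow> length Ls = length ns \<and>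
     (\<forall>j<length ns. subspace (Ls ! j) \<and> dim (Ls ! j) = ns ! j) \<and>
     (\<forall>i<length ns. \<forall>j<length ns. i \<noteq> j \<longrightarrow> (\<forall>u\<in>Ls ! i. \<forall>v\<in>Ls ! j. G u v = 0))"

definition chen_delta ::
    "('b, 'd::euclidean_space) chart set \<Rightarrow> ('b \<Rightarrow> 'd \<Rightarrow> 'd \<Rightarrow> real) \<Rightarrow> nat list \<Rightarrow> 'b \<Rightarrow> real" where
  "chen_delta B g ns p = tau B g p UNIV
     - Inf {(\<Sum>L\<leftarrow>Ls. tau B g p L) | Ls. orthogonal_subspaces (g p) ns Ls}"

definition chen_c :: "nat \<Rightarrow> nat list \<Rightarrow> real" where
  "chen_c n ns = (real n)\<^sup>2 * (real n + real (length ns) - 1 - real (sum_list ns))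
     / (2 * (real n + real (length ns) - real (sum_list ns)))"

definition chen_b :: "nat \<Rightarrow> nat list \<Rightarrow> real" where
  "chen_b n ns = real n * (real n - 1) / 2 - (\<Sum>x\<leftarrow>ns. real x * (real x - 1)) / 2"

text \<open>
  \<open>adapted_block_form n ns a M\<close> says that the \<open>n \<times> n\<close> matrix \<open>M\<close> (indices from 0) is block
  diagonal with symmetric diagonal blocks of sizes \<open>ns\<close>, each of trace \<open>a\<close>, followed by \<open>a\<close>
  times an identity matrix.
\<close>

definition block :: "nat list \<Rightarrow> nat \<Rightarrow> nat set" where
  "block ns l = {sum_list (take l ns)..<sum_list (take (Suc l) ns)}"

definition adapted_block_form :: "nat \<Rightarrow> nat list \<Rightarrow> real \<Rightarrow> (nat \<Rightarrow> nat \<Rightarrow> real) \<Rightarrow> bool" where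
  "adapted_block_form n ns a M \<longleftrightarrow>
     (\<forall>l<length ns. \<forall>i\<in>block ns l. \<forall>j\<in>block ns l. M i j = M j i) \<and>
     (\<forall>l<length ns. (\<Sum>i\<in>block ns l. M i i) = a) \<and>
     (\<forall>i<n. \<forall>j<n. (\<nexists>l. l < length ns \<and> i \<in> block ns l \<and> j \<in> block ns l) \<longrightarrow>
        M i j = (if i = j then a else 0))"

end

theory Submission
  imports Defs
begin

text \<open>
  On a contact metric manifold write \<open>\<nabla>\<xi> = S - \<phi>\<close> with \<open>S\<close> symmetric. Since \<open>\<L>\<^sub>\<xi> d\<eta> = 0\<close>, one has
  \<open>\<nabla>\<^sub>\<xi>\<phi> = 0\<close>, \<open>\<phi>S\<phi> = S\<close> and \<open>h = \<phi>S\<close>, so that \<open>R(X,\<xi>)\<xi> = -(\<nabla>\<^sub>\<xi>S)X - S\<^sup>2X - \<phi>\<^sup>2X\<close>. When \<open>f\<^sub>3 = f\<^sub>1 - 1\<close>,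
  the prescribed curvature gives \<open>R(X,\<xi>)\<xi> = -\<phi>\<^sup>2X + (f\<^sub>4 - f\<^sub>6)\<phi>SX\<close>; comparing with the conjugate of this
  equation by \<open>\<phi>\<close> yields \<open>S\<^sup>2 = 0\<close>, hence \<open>h = 0\<close>. As \<open>d\<eta>\<close> vanishes on a \<open>C\<close>-totally real submanifold,
  only the \<open>f\<^sub>1\<close> term of the ambient curvature survives in the Gauss equation, and the inequality
  becomes, for each normal direction, a statement about one symmetric matrix: its defect is a sum of
  squares that vanishes exactly on the stated block matrices. The infimum in the definition of
  \<open>\<delta>\<close> is attained because the orthonormal frames form a compact set.
\<close>


section \<open>Calculus\<close>

text \<open>Why the conjugation works: once the covariant derivative of \<phi> along \<xi> vanishes,
  the map sending K to \<open>\<phi>K\<phi>\<close> commutes with that derivative. It fixes the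
  derivative of S and the term \<open>\<phi>S\<close>, but reverses the sign of the square of S,
  since S anticommutes with \<phi>. Symmetry of S then turns a vanishing square into S = 0. The
  relation between \<open>f3\<close> and \<open>f1\<close> enters because the curvature equation
  contains f1 - f3 as the coefficient of X - \<eta>(X)\<xi>; the value 1 is what the skew part
  -\<phi> of the derivative of \<xi> produces.

  Origin of the constants: the k blocks and the single remaining indices form N = n + k - (n_1 + ...
  + n_k) groups. The variance of the N group traces gives the factor (N - 1)/N in c, and b counts
  the unordered index pairs from different groups.

  Obstacle: vectors at each point refer to the chart chosen at that point, so a condition imposed at
  every point refers to varying charts. It has to be moved to one coordinate domain before it can be
  differentiated; for the contact condition this is the naturality of the exterior
  derivative.\<close>

abbreviation dd :: "('x::real_normed_vector \<Rightarrow> 'f::real_normed_vector) \<Rightarrow> 'x \<Rightarrow> 'x \<Rightarrow> 'f" where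
  "dd f x \<equiv> frechet_derivative f (at x)"

lemma dd_eqI: "(f has_derivative f') (at x) \<Longrightarrow> dd f x = f'"
  by (metis frechet_derivative_at)

lemma has_derivative_dd: "f differentiable (at x) \<Longrightarrow> (f has_derivative dd f x) (at x)"
  by (simp add: frechet_derivative_works)

lemma smooth_on_differentiable:
  assumes "smooth_on S f" "x \<in> S"
  shows "f differentiable (at x)"
  using assms unfolding smooth_on_def by (metis Ck_on.simps(2))

lemma smooth_on_dd:
  assumes "smooth_on S f"
  shows "smooth_on S (\<lambda>x. dd f x v)"
  using assms unfolding smooth_on_def by (metis Ck_on.simps(2))

lemma dd_cong_open:
  assumes "open U" "x \<in> U" "\<And>y. y \<in> U \<Longrightarrow> f y = g y"
  shows "dd f x = dd g x"
proof -
  have "(f has_derivative f') (at x) \<longleftrightarrow> (g has_derivative f') (at x)" for f'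
    using assms by (metis has_derivative_transform_within_open)
  then show ?thesis unfolding frechet_derivative_def by presburger
qed

lemma differentiable_cong_open:
  assumes "open U" "x \<in> U" "\<And>y. y \<in> U \<Longrightarrow> f y = g y"
  shows "f differentiable (at x) \<longleftrightarrow> g differentiable (at x)"
proof -
  have "(f has_derivative f') (at x) \<longleftrightarrow> (g has_derivative f') (at x)" for f'
    using assms by (metis has_derivative_transform_within_open)
  then show ?thesis unfolding differentiable_def by presburger
qed

text \<open>Differentiability is available for each \<open>K y u\<close> with \<open>u\<close>
  fixed, not for \<open>K\<close> as a map into operators. Expanding the moving argument in the
  finite \<open>Basis\<close> reduces the product rule to finitely many scalar multiples.\<close>

lemma has_derivative_linear_family:
  fixes K :: "'x::real_normed_vector \<Rightarrow> 'e::euclidean_space \<Rightarrow> 'f::real_normed_vector"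
  assumes "open U" "x \<in> U" "\<And>y. y \<in> U \<Longrightarrow> linear (K y)"
    and "\<And>u. (\<lambda>y. K y u) differentiable (at x)" "V differentiable (at x)"
  shows "((\<lambda>y. K y (V y)) has_derivative
      (\<lambda>h. dd (\<lambda>y. K y (V x)) x h + K x (dd V x h))) (at x)"
proof -
  have expand: "K y v = (\<Sum>b\<in>Basis. (v \<bullet> b) *\<^sub>R K y b)" if "y \<in> U" for y v
  proof -
    have "K y v = K y (\<Sum>b\<in>Basis. (v \<bullet> b) *\<^sub>R b)" by (simp add: euclidean_representation)
    also have "\<dots> = (\<Sum>b\<in>Basis. (v \<bullet> b) *\<^sub>R K y b)"
      using assms(3)[OF that] by (simp add: linear_sum linear_cmul)
    finally show ?thesis .
  qed
  have gen: "((\<lambda>y. K y (W y)) has_derivative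
      (\<lambda>h. \<Sum>b\<in>Basis. (W x \<bullet> b) *\<^sub>R dd (\<lambda>y. K y b) x h + (W' h \<bullet> b) *\<^sub>R K x b)) (at x)"
    if W: "(W has_derivative W') (at x)" for W W'
  proof -
    have "((\<lambda>y. \<Sum>b\<in>Basis. (W y \<bullet> b) *\<^sub>R K y b) has_derivative
      (\<lambda>h. \<Sum>b\<in>Basis. (W x \<bullet> b) *\<^sub>R dd (\<lambda>y. K y b) x h + (W' h \<bullet> b) *\<^sub>R K x b)) (at x)"
      by (auto intro!: derivative_intros W has_derivative_dd assms(4) has_derivative_inner_left)
    then show ?thesis
      by (rule has_derivative_transform_within_open[OF _ assms(1,2)]) (rule expand[symmetric])
  qed
  have c: "dd (\<lambda>y. K y (V x)) x = (\<lambda>h. \<Sum>b\<in>Basis. (V x \<bullet> b) *\<^sub>R dd (\<lambda>y. K y b) x h)"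
    using dd_eqI[OF gen[of "\<lambda>_. V x" "\<lambda>_. 0"]] by simp
  show ?thesis
    using gen[OF has_derivative_dd[OF assms(5)]]
    by (simp add: c expand[OF assms(2), of "dd V x _"] sum.distrib)
qed

lemmas differentiable_linear_family = differentiableI[OF has_derivative_linear_family]
lemmas dd_linear_family = fun_cong[OF dd_eqI[OF has_derivative_linear_family]]

lemma linear_dd: "f differentiable (at x) \<Longrightarrow> linear (dd f x)"
  by (rule linear_frechet_derivative)

lemma linear_dd_family:
  fixes K :: "'x::real_normed_vector \<Rightarrow> 'e::euclidean_space \<Rightarrow> 'f::real_normed_vector"
  assumes "open U" "x \<in> U" "\<And>y. y \<in> U \<Longrightarrow> linear (K y)"
    and "\<And>u. (\<lambda>y. K y u) differentiable (at x)"
  shows "linear (\<lambda>u. dd (\<lambda>y. K y u) x h)"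
proof (rule linearI)
  fix a b :: 'e and c :: real
  have "dd (\<lambda>y. K y (a + b)) x = dd (\<lambda>y. K y a + K y b) x"
    by (rule dd_cong_open[OF assms(1,2)]) (simp add: assms(3) linear_add)
  also have "\<dots> = (\<lambda>h. dd (\<lambda>y. K y a) x h + dd (\<lambda>y. K y b) x h)"
    by (rule dd_eqI) (auto intro!: derivative_intros has_derivative_dd assms)
  finally show "dd (\<lambda>y. K y (a + b)) x h = dd (\<lambda>y. K y a) x h + dd (\<lambda>y. K y b) x h" by simp
  have "dd (\<lambda>y. K y (c *\<^sub>R a)) x = dd (\<lambda>y. c *\<^sub>R K y a) x"
    by (rule dd_cong_open[OF assms(1,2)]) (simp add: assms(3) linear_cmul)
  also have "\<dots> = (\<lambda>h. c *\<^sub>R dd (\<lambda>y. K y a) x h)"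
    by (rule dd_eqI) (auto intro!: derivative_intros has_derivative_dd assms)
  finally show "dd (\<lambda>y. K y (c *\<^sub>R a)) x h = c *\<^sub>R dd (\<lambda>y. K y a) x h" by simp
qed

lemma has_derivative_bilinear_family:
  fixes G :: "'x::real_normed_vector \<Rightarrow> 'e::euclidean_space \<Rightarrow> 'c::euclidean_space \<Rightarrow> 'f::real_normed_vector"
  assumes "open U" "x \<in> U" "\<And>y. y \<in> U \<Longrightarrow> bilinear (G y)"
    and "\<And>u v. (\<lambda>y. G y u v) differentiable (at x)"
    and "V differentiable (at x)" "W differentiable (at x)"
  shows "((\<lambda>y. G y (V y) (W y)) has_derivative
      (\<lambda>h. dd (\<lambda>y. G y (V x) (W x)) x h + G x (dd V x h) (W x) + G x (V x) (dd W x h))) (at x)"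
proof -
  have l1: "linear (\<lambda>u. G y u w)" and l2: "linear (G y v)" if "y \<in> U" for y v w
    using assms(3)[OF that] by (auto simp: bilinear_def)
  have d: "((\<lambda>y. G y u (W y)) has_derivative (\<lambda>h. dd (\<lambda>y. G y u (W x)) x h + G x u (dd W x h))) (at x)" for u
    by (rule has_derivative_linear_family[OF assms(1,2)]) (auto simp: l2 assms)
  have "((\<lambda>y. G y (V y) (W y)) has_derivative
      (\<lambda>h. dd (\<lambda>y. G y (V x) (W y)) x h + G x (dd V x h) (W x))) (at x)"
    by (rule has_derivative_linear_family[OF assms(1,2), where K="\<lambda>y u. G y u (W y)"])
       (auto simp: l1 assms intro: differentiableI[OF d])
  then show ?thesis by (simp add: dd_eqI[OF d] algebra_simps)
qed

lemmas differentiable_bilinear_family = differentiableI[OF has_derivative_bilinear_family]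
lemmas dd_bilinear_family = fun_cong[OF dd_eqI[OF has_derivative_bilinear_family]]

section \<open>Chain rule and symmetry of second derivatives\<close>

lemma dd_compose:
  assumes "f differentiable (at (g x))" "g differentiable (at x)"
  shows "dd (\<lambda>y. f (g y)) x h = dd f (g x) (dd g x h)"
  using frechet_derivative_compose[OF assms(2,1)] by (simp add: o_def fun_eq_iff)

lemma differentiable_compose':
  assumes "f differentiable (at (g x))" "g differentiable (at x)"
  shows "(\<lambda>y. f (g y)) differentiable (at x)"
  using differentiable_chain_at[OF assms(2,1)] by (simp add: o_def)

text \<open>The mixed second difference is symmetric in \<open>u\<close> and \<open>v\<close>, so
  comparing it with both iterated derivatives proves that they agree. The mean value theorem is
  applied in direction \<open>u\<close>; direction \<open>v\<close> enters through the
  differentiability of the first derivative at the single point \<open>x\<close>.\<close>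

lemma second_difference_bound:
  fixes f :: "'x::real_normed_vector \<Rightarrow> real"
  assumes "open U" "x \<in> U" "\<And>y. y \<in> U \<Longrightarrow> f differentiable (at y)"
    and "(\<lambda>y. dd f y u) differentiable (at x)" and "e > 0"
  shows "eventually (\<lambda>t. \<bar>f (x + t *\<^sub>R u + t *\<^sub>R v) - f (x + t *\<^sub>R u) - f (x + t *\<^sub>R v) + f x
            - t\<^sup>2 * dd (\<lambda>y. dd f y u) x v\<bar> \<le> e * t\<^sup>2) (at_right 0)"
proof -
  let ?w = "\<lambda>y. dd f y u"
  let ?w' = "dd ?w x"
  have lw: "linear ?w'" using assms(4) by (rule linear_dd)
  \<comment> \<open>All displacements below have norm at most \<open>t * N\<close>; the summand 1
    keeps \<open>N\<close> positive when \<open>u\<close> and \<open>v\<close> vanish.\<close>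
  define N where "N = norm u + norm v + 1"
  have N: "N > 0" unfolding N_def by (smt (verit) norm_ge_zero)
  obtain r where r: "r > 0" "ball x r \<subseteq> U" using assms(1,2) open_contains_ball by blast
  \<comment> \<open>Tolerance \<open>e / (2*N)\<close>: the two end points compared after the mean
    value theorem each cost at most \<open>(e / (2*N)) * (t * N)\<close>, together
    \<open>e * t\<close>.\<close>
  obtain d where d: "d > 0"
    "\<And>y. norm (y - x) < d \<Longrightarrow> norm (?w y - ?w x - ?w' (y - x)) \<le> (e / (2*N)) * norm (y - x)"
  proof -
    have "e / (2*N) > 0" using N assms(5) by simp
    then show ?thesis
      using has_derivative_dd[OF assms(4)] that unfolding has_derivative_at_alt by blast
  qed
  define T where "T = min r d / N"
  have T: "T > 0" using r d N by (simp add: T_def)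
  have "\<bar>f (x + t *\<^sub>R u + t *\<^sub>R v) - f (x + t *\<^sub>R u) - f (x + t *\<^sub>R v) + f x - t\<^sup>2 * ?w' v\<bar> \<le> e * t\<^sup>2"
    if t: "0 < t" "t < T" for t
  proof -
    have tN: "t * N < r" "t * N < d" using t N by (auto simp: T_def field_simps min_def split: if_splits)
    have nb: "norm (s *\<^sub>R u + c *\<^sub>R v) \<le> t * N" if "0 \<le> s" "s \<le> t" "0 \<le> c" "c \<le> t" for s c
    proof -
      have "norm (s *\<^sub>R u + c *\<^sub>R v) \<le> s * norm u + c * norm v"
        using norm_triangle_ineq[of "s *\<^sub>R u" "c *\<^sub>R v"] that by simp
      also have "\<dots> \<le> t * norm u + t * norm v"
        using that by (intro add_mono mult_right_mono) auto
      also have "\<dots> \<le> t * N" using t by (simp add: N_def algebra_simps)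
      finally show ?thesis .
    qed
    have inU: "x + s *\<^sub>R u + c *\<^sub>R v \<in> U" if "0 \<le> s" "s \<le> t" "0 \<le> c" "c \<le> t" for s c
    proof -
      have "x + s *\<^sub>R u + c *\<^sub>R v \<in> ball x r"
        using le_less_trans[OF nb[OF that] tN(1)]
        unfolding mem_ball dist_norm norm_minus_commute[of x] by (simp add: add.assoc)
      then show ?thesis using r by auto
    qed
    \<comment> \<open>The second difference is \<open>p t - p 0\<close>, the increment in direction
      \<open>u\<close> of a first difference in direction \<open>v\<close>.\<close>
    define p where "p s = f (x + s *\<^sub>R u + t *\<^sub>R v) - f (x + s *\<^sub>R u)" for s
    have p': "(p has_real_derivative (?w (x + s *\<^sub>R u + t *\<^sub>R v) - ?w (x + s *\<^sub>R u))) (at s)"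
      if s: "0 \<le> s" "s \<le> t" for s
    proof -
      have a: "((\<lambda>s. f (x + s *\<^sub>R u + c *\<^sub>R v)) has_derivative (\<lambda>h. dd f (x + s *\<^sub>R u + c *\<^sub>R v) (h *\<^sub>R u))) (at s)"
        if "0 \<le> c" "c \<le> t" for c
        by (rule has_derivative_compose[where f="\<lambda>s. x + s *\<^sub>R u + c *\<^sub>R v" and s=UNIV])
          (auto intro!: derivative_eq_intros has_derivative_dd assms(3) inU s that)
      have "dd f (x + s *\<^sub>R u + c *\<^sub>R v) (h *\<^sub>R u) = h * dd f (x + s *\<^sub>R u + c *\<^sub>R v) u"
        if "0 \<le> c" "c \<le> t" for c h
        using linear_dd[OF assms(3)[OF inU[OF s that]]] by (simp add: linear_cmul)
      then have b: "((\<lambda>s. f (x + s *\<^sub>R u + c *\<^sub>R v)) has_real_derivative ?w (x + s *\<^sub>R u + c *\<^sub>R v)) (at s)"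
        if "0 \<le> c" "c \<le> t" for c
        using a[OF that] that by (simp add: has_field_derivative_def mult_commute_abs)
      show ?thesis unfolding p_def
        using DERIV_diff[OF b[of t] b[of 0]] t by simp
    qed
    obtain s where s: "0 < s" "s < t" "p t - p 0 = t * (?w (x + s *\<^sub>R u + t *\<^sub>R v) - ?w (x + s *\<^sub>R u))"
      using MVT2[OF t(1) p'] by (metis diff_zero)
    let ?a = "x + s *\<^sub>R u + t *\<^sub>R v" and ?b = "x + s *\<^sub>R u"
    have na: "norm (?a - x) \<le> t * N" using nb[of s t] s t by (simp add: add.assoc)
    have nb': "norm (?b - x) \<le> t * N" using nb[of s 0] s t by simp
    have e0: "e / (2*N) \<ge> 0" using assms(5) N by simp
    have da: "norm (?w ?a - ?w x - ?w' (?a - x)) \<le> (e / (2*N)) * (t * N)"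
      using d(2)[of ?a] na tN mult_left_mono[OF na e0] by linarith
    have db: "norm (?w ?b - ?w x - ?w' (?b - x)) \<le> (e / (2*N)) * (t * N)"
      using d(2)[of ?b] nb' tN mult_left_mono[OF nb' e0] by linarith
    have l: "?w' (?a - x) - ?w' (?b - x) = t * ?w' v"
    proof -
      have "?w' (?a - x) - ?w' (?b - x) = ?w' ((?a - x) - (?b - x))"
        by (rule linear_diff[OF lw, symmetric])
      also have "(?a - x) - (?b - x) = t *\<^sub>R v" by simp
      finally show ?thesis using lw by (simp add: linear_cmul)
    qed
    have "\<bar>?w ?a - ?w ?b - t * ?w' v\<bar> \<le> 2 * ((e / (2*N)) * (t * N))"
      using da db l unfolding real_norm_def by linarith
    also have "\<dots> = e * t" using N by simp
    finally have q: "\<bar>?w ?a - ?w ?b - t * ?w' v\<bar> \<le> e * t" .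
    have "f (x + t *\<^sub>R u + t *\<^sub>R v) - f (x + t *\<^sub>R u) - f (x + t *\<^sub>R v) + f x = p t - p 0"
      by (simp add: p_def)
    then have "f (x + t *\<^sub>R u + t *\<^sub>R v) - f (x + t *\<^sub>R u) - f (x + t *\<^sub>R v) + f x - t\<^sup>2 * ?w' v
      = t * (?w ?a - ?w ?b) - t * (t * ?w' v)"
      unfolding s(3) by (simp only: power2_eq_square mult.assoc)
    also have "\<dots> = t * (?w ?a - ?w ?b - t * ?w' v)" by (rule right_diff_distrib[symmetric])
    also have "\<bar>\<dots>\<bar> \<le> t * (e * t)" unfolding abs_mult using q t(1) by (intro mult_mono) auto
    also have "t * (e * t) = e * t\<^sup>2" by (simp add: power2_eq_square)
    finally show ?thesis .
  qed
  then show ?thesis unfolding eventually_at_right_field using T by (intro exI[of _ T]) simp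
qed

lemma second_derivative_symmetric_real:
  fixes f :: "'x::real_normed_vector \<Rightarrow> real"
  assumes "open U" "x \<in> U" "\<And>y. y \<in> U \<Longrightarrow> f differentiable (at y)"
    and "\<And>u. (\<lambda>y. dd f y u) differentiable (at x)"
  shows "dd (\<lambda>y. dd f y u) x v = dd (\<lambda>y. dd f y v) x u"
proof (rule ccontr)
  let ?a = "dd (\<lambda>y. dd f y u) x v" and ?b = "dd (\<lambda>y. dd f y v) x u"
  assume ne: "?a \<noteq> ?b"
  \<comment> \<open>With a quarter of the gap as tolerance, two estimates of the same second
    difference bound the gap by half of itself.\<close>
  define e where "e = \<bar>?a - ?b\<bar> / 4"
  have e: "e > 0" using ne by (simp add: e_def)
  have "eventually (\<lambda>t::real. t > 0) (at_right 0)" by (simp add: eventually_at_right_less)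
  from eventually_happens'[OF trivial_limit_at_right_real eventually_conj[OF this
    eventually_conj[OF second_difference_bound[OF assms e, of u v] second_difference_bound[OF assms e, of v u]]]]
  obtain t where t: "t > 0"
    "\<bar>f (x + t *\<^sub>R u + t *\<^sub>R v) - f (x + t *\<^sub>R u) - f (x + t *\<^sub>R v) + f x - t\<^sup>2 * ?a\<bar> \<le> e * t\<^sup>2"
    "\<bar>f (x + t *\<^sub>R v + t *\<^sub>R u) - f (x + t *\<^sub>R v) - f (x + t *\<^sub>R u) + f x - t\<^sup>2 * ?b\<bar> \<le> e * t\<^sup>2"
    by blast
  have "x + t *\<^sub>R v + t *\<^sub>R u = x + t *\<^sub>R u + t *\<^sub>R v" by (simp add: algebra_simps)
  from t(2) t(3)[unfolded this] have "\<bar>t\<^sup>2 * ?a - t\<^sup>2 * ?b\<bar> \<le> 2 * (e * t\<^sup>2)" by linarith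
  moreover have "\<bar>t\<^sup>2 * ?a - t\<^sup>2 * ?b\<bar> = t\<^sup>2 * \<bar>?a - ?b\<bar>"
    by (simp add: abs_mult flip: right_diff_distrib)
  moreover have "\<bar>?a - ?b\<bar> = 4 * e" by (simp add: e_def)
  ultimately have "t\<^sup>2 * (4 * e) \<le> 2 * (e * t\<^sup>2)" by (simp only:)
  moreover have "e * t\<^sup>2 > 0" using e t(1) by simp
  ultimately show False by (simp add: mult.commute mult.left_commute)
qed

lemma second_derivative_symmetric:
  fixes f :: "'x::real_normed_vector \<Rightarrow> 'f::euclidean_space"
  assumes "open U" "x \<in> U" "\<And>y. y \<in> U \<Longrightarrow> f differentiable (at y)"
    and "\<And>u. (\<lambda>y. dd f y u) differentiable (at x)"
  shows "dd (\<lambda>y. dd f y u) x v = dd (\<lambda>y. dd f y v) x u"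
proof (rule euclidean_eqI)
  fix b :: 'f assume "b \<in> Basis"
  have d1: "dd (\<lambda>y. f y \<bullet> b) y = (\<lambda>h. dd f y h \<bullet> b)" if "y \<in> U" for y
    by (rule dd_eqI, rule has_derivative_inner_left, rule has_derivative_dd, rule assms(3)[OF that])
  have d2: "((\<lambda>y. dd f y w \<bullet> b) has_derivative (\<lambda>h. dd (\<lambda>y. dd f y w) x h \<bullet> b)) (at x)" for w
    by (rule has_derivative_inner_left, rule has_derivative_dd, rule assms(4))
  have d3: "((\<lambda>y. dd (\<lambda>y. f y \<bullet> b) y w) has_derivative (\<lambda>h. dd (\<lambda>y. dd f y w) x h \<bullet> b)) (at x)" for w
    by (rule has_derivative_transform_within_open[OF d2 assms(1,2)]) (rule fun_cong[OF d1, symmetric])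
  have "dd (\<lambda>y. dd (\<lambda>y. f y \<bullet> b) y u) x v = dd (\<lambda>y. dd (\<lambda>y. f y \<bullet> b) y v) x u"
  proof (rule second_derivative_symmetric_real[OF assms(1,2)])
    show "(\<lambda>y. f y \<bullet> b) differentiable at y" if "y \<in> U" for y
      by (rule differentiableI, rule has_derivative_inner_left, rule has_derivative_dd, rule assms(3)[OF that])
    show "(\<lambda>y. dd (\<lambda>y. f y \<bullet> b) y u) differentiable at x" for u
      by (rule differentiableI[OF d3])
  qed
  then show "dd (\<lambda>y. dd f y u) x v \<bullet> b = dd (\<lambda>y. dd f y v) x u \<bullet> b"
    using fun_cong[OF dd_eqI[OF d3[of u]], of v] fun_cong[OF dd_eqI[OF d3[of v]], of u] by (rule box_equals)
qed

section \<open>Positive definite forms\<close>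

definition orthonormal_family :: "('e::euclidean_space \<Rightarrow> 'e \<Rightarrow> real) \<Rightarrow> (nat \<Rightarrow> 'e) \<Rightarrow> nat \<Rightarrow> bool" where
  "orthonormal_family g E s \<longleftrightarrow> (\<forall>i<s. \<forall>j<s. g (E i) (E j) = (if i = j then 1 else 0))"

lemma orthonormal_basis_iff:
  "orthonormal_basis g L E \<longleftrightarrow> orthonormal_family g E (dim L) \<and> span (E ` {..<dim L}) = L"
  unfolding orthonormal_basis_def orthonormal_family_def by simp

locale pd_form =
  fixes g :: "'e::euclidean_space \<Rightarrow> 'e \<Rightarrow> real"
  assumes bil: "bilinear g" and sym: "g u v = g v u" and pos: "u \<noteq> 0 \<Longrightarrow> 0 < g u u"
begin

lemma linear_right: "linear (g u)" and linear_left: "linear (\<lambda>u. g u v)"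
  using bil by (auto simp: bilinear_def)

lemma add_left: "g (a + b) c = g a c + g b c" and add_right: "g a (b + c) = g a b + g a c"
  and diff_left: "g (a - b) c = g a c - g b c" and diff_right: "g a (b - c) = g a b - g a c"
  and scale_left: "g (r *\<^sub>R a) c = r * g a c" and scale_right: "g a (r *\<^sub>R c) = r * g a c"
  and minus_left: "g (- a) c = - g a c" and minus_right: "g a (- c) = - g a c"
  and zero_left: "g 0 c = 0" and zero_right: "g a 0 = 0"
  and sum_left: "g (sum f I) c = (\<Sum>i\<in>I. g (f i) c)" and sum_right: "g a (sum f I) = (\<Sum>i\<in>I. g a (f i))"
  using linear_add[OF linear_left] linear_add[OF linear_right]
    linear_diff[OF linear_left] linear_diff[OF linear_right]
    linear_cmul[OF linear_left] linear_cmul[OF linear_right]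
    linear_neg[OF linear_left] linear_neg[OF linear_right]
    linear_0[OF linear_left] linear_0[OF linear_right]
    linear_sum[OF linear_left] linear_sum[OF linear_right] by auto

lemmas lin = add_left add_right diff_left diff_right scale_left scale_right minus_left minus_right
  zero_left zero_right sum_left sum_right

lemma self_eq_0_iff: "g u u = 0 \<longleftrightarrow> u = 0"
  using pos[of u] zero_left by force

lemma nondegenerate: "(\<And>z. g u z = g v z) \<Longrightarrow> u = v"
  using self_eq_0_iff[of "u - v"] by (simp add: diff_left)

lemma orthonormal_extend_one:
  assumes "subspace L" "orthonormal_family g E s" "\<And>i. i < s \<Longrightarrow> E i \<in> L" "s < dim L"
  obtains v where "v \<in> L" "g v v = 1" "\<And>i. i < s \<Longrightarrow> g v (E i) = 0"
proof -
  have "dim (E ` {..<s}) \<le> card (E ` {..<s})" by (rule dim_le_card') simp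
  also have "\<dots> \<le> s" using card_image_le[of "{..<s}" E] by simp
  finally have "dim (span (E ` {..<s})) < dim L" using assms(4) by (simp only: dim_span)
  then obtain u where u: "u \<in> L" "u \<notin> span (E ` {..<s})"
    using dim_subset[of L "span (E ` {..<s})"] by auto
  define w where "w = u - (\<Sum>i<s. g u (E i) *\<^sub>R E i)"
  have "(\<Sum>i<s. g u (E i) *\<^sub>R E i) \<in> span (E ` {..<s})"
    by (intro span_sum span_scale span_base) auto
  then have w0: "w \<noteq> 0" using u(2) by (auto simp: w_def)
  have "(\<Sum>i<s. g u (E i) *\<^sub>R E i) \<in> L"
    using assms(1,3) by (intro subspace_sum subspace_scale) auto
  then have wL: "w \<in> L" unfolding w_def using assms(1) u(1) by (rule_tac subspace_diff)
  have orth: "g w (E i) = 0" if "i < s" for i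
  proof -
    have "(\<Sum>j<s. g u (E j) * g (E j) (E i)) = (\<Sum>j<s. if j = i then g u (E i) else 0)"
      using assms(2) that by (intro sum.cong) (auto simp: orthonormal_family_def)
    then show ?thesis using that by (simp add: w_def lin)
  qed
  show thesis
  proof (rule that[of "(1 / sqrt (g w w)) *\<^sub>R w"])
    show "(1 / sqrt (g w w)) *\<^sub>R w \<in> L" using assms(1) wL by (rule subspace_scale)
    show "g ((1 / sqrt (g w w)) *\<^sub>R w) ((1 / sqrt (g w w)) *\<^sub>R w) = 1"
      using pos[OF w0] by (simp add: lin)
  qed (simp add: lin orth)
qed

text \<open>Gram-Schmidt, climbing from \<open>s\<close> to \<open>dim L\<close>. The given vectors
  are kept, so that a tangent frame can later be completed to an ambient one.\<close>

lemma orthonormal_extend: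
  assumes "subspace L" "orthonormal_family g E s" "\<And>i. i < s \<Longrightarrow> E i \<in> L" "s \<le> dim L"
  shows "\<exists>E'. (\<forall>i<s. E' i = E i) \<and> orthonormal_family g E' (dim L) \<and> (\<forall>i<dim L. E' i \<in> L)"
  using assms(4,2,3)
proof (induction s arbitrary: E rule: inc_induct)
  case base
  then show ?case by auto
next
  case (step s)
  obtain v where v: "v \<in> L" "g v v = 1" "\<And>i. i < s \<Longrightarrow> g v (E i) = 0"
    using orthonormal_extend_one[OF assms(1) step.prems(1,2)] step.hyps by blast
  have "orthonormal_family g (E(s := v)) (Suc s)"
    using step.prems(1) v sym by (auto simp: orthonormal_family_def less_Suc_eq)
  moreover have "(E(s := v)) i \<in> L" if "i < Suc s" for i
    using step.prems(2) v(1) that by (auto simp: less_Suc_eq)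
  ultimately obtain E' where E': "\<forall>i<Suc s. E' i = (E(s := v)) i" "orthonormal_family g E' (dim L)"
    "\<forall>i<dim L. E' i \<in> L" using step.IH[of "E(s := v)"] by blast
  then have "\<forall>i<s. E' i = E i" by auto
  with E' show ?case by blast
qed

lemma orthonormal_family_independent:
  assumes "orthonormal_family g E s"
  shows "inj_on E {..<s}" "independent (E ` {..<s})"
proof -
  let ?n = s
  have gE: "g (E i) (E j) = (if i = j then 1 else 0)" if "i < ?n" "j < ?n" for i j
    using assms that by (auto simp: orthonormal_family_def)
  show inj: "inj_on E {..<?n}"
    by (rule inj_onI) (metis gE lessThan_iff zero_neq_one)
  show "independent (E ` {..<?n})"
    unfolding dependent_finite[OF finite_imageI[OF finite_lessThan]]
  proof clarify
    fix u i assume i: "i < ?n" and ne: "u (E i) \<noteq> 0"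
      and z: "(\<Sum>v\<in>E ` {..<?n}. u v *\<^sub>R v) = 0"
    have "0 = g (\<Sum>j<?n. u (E j) *\<^sub>R E j) (E i)"
      using z by (simp add: sum.reindex[OF inj] zero_left)
    also have "\<dots> = (\<Sum>j<?n. if j = i then u (E i) else 0)"
      unfolding lin using gE i by (intro sum.cong) auto
    also have "\<dots> = u (E i)" using i by simp
    finally show False using ne by simp
  qed
qed

lemma orthonormal_basis_span:
  assumes "orthonormal_family g E s"
  shows "dim (span (E ` {..<s})) = s" "orthonormal_basis g (span (E ` {..<s})) E"
proof -
  show "dim (span (E ` {..<s})) = s"
    unfolding dim_span_eq_card_independent[OF orthonormal_family_independent(2)[OF assms]]
      card_image[OF orthonormal_family_independent(1)[OF assms]] by simp
  then show "orthonormal_basis g (span (E ` {..<s})) E"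
    using assms by (simp add: orthonormal_basis_iff)
qed

lemma orthonormal_family_basis:
  assumes "subspace L" "orthonormal_family g E (dim L)" "\<And>i. i < dim L \<Longrightarrow> E i \<in> L"
  shows "orthonormal_basis g L E"
proof -
  let ?n = "dim L"
  note ind = orthonormal_family_independent[OF assms(2)]
  have "L \<subseteq> span (E ` {..<?n})"
    using card_ge_dim_independent[of "E ` {..<?n}" L] assms(3) card_image[OF ind(1)] ind(2) by auto
  moreover have "span (E ` {..<?n}) \<subseteq> L"
    using assms(1,3) by (intro span_minimal) auto
  ultimately show ?thesis using assms(2) by (auto simp: orthonormal_basis_iff)
qed

lemma orthonormal_basis_exists:
  assumes "subspace L"
  shows "\<exists>E. orthonormal_basis g L E"
  using orthonormal_extend[OF assms, of undefined 0] orthonormal_family_basis[OF assms]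
  by (auto simp: orthonormal_family_def)

lemma orthonormal_basis_mem:
  assumes "orthonormal_basis g L E" "i < dim L"
  shows "E i \<in> L"
  using assms span_base[of "E i" "E ` {..<dim L}"] by (auto simp: orthonormal_basis_iff)

lemma orthonormal_expansion:
  assumes "orthonormal_basis g L E" "v \<in> L"
  shows "v = (\<Sum>i<dim L. g v (E i) *\<^sub>R E i)"
proof -
  let ?n = "dim L"
  have gE: "g (E i) (E j) = (if i = j then 1 else 0)" if "i < ?n" "j < ?n" for i j
    using assms(1) that by (auto simp: orthonormal_basis_def)
  have L: "span (E ` {..<?n}) = L" using assms(1) by (simp add: orthonormal_basis_def)
  then have sub: "subspace L" by (metis subspace_span)
  define w where "w = v - (\<Sum>i<?n. g v (E i) *\<^sub>R E i)"
  have wL: "w \<in> L" unfolding w_def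
    using assms sub by (intro subspace_diff subspace_sum subspace_scale) (auto intro: orthonormal_basis_mem)
  have orth: "g w (E i) = 0" if "i < ?n" for i
  proof -
    have "(\<Sum>j<?n. g v (E j) * g (E j) (E i)) = (\<Sum>j<?n. if j = i then g v (E i) else 0)"
      using gE that by (intro sum.cong) auto
    then show ?thesis using that by (simp add: w_def lin)
  qed
  have "g w u = 0" if "u \<in> span (E ` {..<?n})" for u
    using that by (induction rule: span_induct_alt) (auto simp: lin orth)
  then have "w = 0" using wL L self_eq_0_iff by auto
  then show ?thesis by (simp add: w_def)
qed

lemma parseval:
  assumes "orthonormal_basis g L E" "u \<in> L"
  shows "g u v = (\<Sum>i<dim L. g u (E i) * g v (E i))"
proof -
  have "g u v = g (\<Sum>i<dim L. g u (E i) *\<^sub>R E i) v"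
    using orthonormal_expansion[OF assms] by simp
  then show ?thesis by (simp add: lin sym)
qed

text \<open>Values in a vector space are allowed because the trace is taken of scalar forms built
  from the curvature and also of the second fundamental form. The coefficients of one basis in the
  other form an orthogonal matrix, which collapses the triple sum.\<close>

lemma trace_independent:
  fixes B :: "'e \<Rightarrow> 'e \<Rightarrow> 'f::real_vector"
  assumes "orthonormal_basis g L E" "orthonormal_basis g L E'"
    and "\<And>u. linear (B u)" "\<And>v. linear (\<lambda>u. B u v)"
  shows "(\<Sum>i<dim L. B (E i) (E i)) = (\<Sum>i<dim L. B (E' i) (E' i))"
proof -
  let ?n = "dim L"
  have "(\<Sum>i<?n. B (E' i) (E' i)) =
      (\<Sum>i<?n. \<Sum>j<?n. \<Sum>k<?n. (g (E' i) (E j) * g (E' i) (E k)) *\<^sub>R B (E j) (E k))"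
  proof (rule sum.cong)
    fix i assume "i \<in> {..<?n}"
    then have e: "E' i = (\<Sum>j<?n. g (E' i) (E j) *\<^sub>R E j)"
      using orthonormal_expansion[OF assms(1)] orthonormal_basis_mem[OF assms(2)] by auto
    have "B (E' i) (E' i) = B (\<Sum>j<?n. g (E' i) (E j) *\<^sub>R E j) (\<Sum>j<?n. g (E' i) (E j) *\<^sub>R E j)"
      using e by simp
    also have "\<dots> = (\<Sum>j<?n. \<Sum>k<?n. (g (E' i) (E j) * g (E' i) (E k)) *\<^sub>R B (E j) (E k))"
      by (simp add: linear_sum[OF assms(3)] linear_sum[OF assms(4)] linear_cmul[OF assms(3)]
        linear_cmul[OF assms(4)] scaleR_right.sum) (subst sum.swap, rule sum.cong, simp_all add: mult.commute)
    finally show "B (E' i) (E' i) = \<dots>" .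
  qed simp
  also have "\<dots> = (\<Sum>j<?n. \<Sum>i<?n. \<Sum>k<?n. (g (E' i) (E j) * g (E' i) (E k)) *\<^sub>R B (E j) (E k))"
    by (rule sum.swap)
  also have "\<dots> = (\<Sum>j<?n. \<Sum>k<?n. \<Sum>i<?n. (g (E' i) (E j) * g (E' i) (E k)) *\<^sub>R B (E j) (E k))"
    by (rule sum.cong, simp, rule sum.swap)
  also have "\<dots> = (\<Sum>j<?n. \<Sum>k<?n. (if j = k then 1 else 0) *\<^sub>R B (E j) (E k))"
  proof (intro sum.cong refl)
    fix j k assume jk: "j \<in> {..<?n}" "k \<in> {..<?n}"
    have "(\<Sum>i<?n. g (E' i) (E j) * g (E' i) (E k)) = g (E j) (E k)"
      using parseval[OF assms(2) orthonormal_basis_mem[OF assms(1)], of j "E k"] jk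
      by (simp add: sym[of "E' _"])
    also have "\<dots> = (if j = k then 1 else 0)"
      using assms(1) jk by (simp add: orthonormal_basis_def)
    finally show "(\<Sum>i<?n. (g (E' i) (E j) * g (E' i) (E k)) *\<^sub>R B (E j) (E k)) = (if j = k then 1 else 0) *\<^sub>R B (E j) (E k)"
      by (simp only: flip: scaleR_left.sum)
  qed
  also have "\<dots> = (\<Sum>j<?n. \<Sum>k<?n. if j = k then B (E j) (E k) else 0)"
    by (intro sum.cong) auto
  also have "\<dots> = (\<Sum>j<?n. B (E j) (E j))" by simp
  finally show ?thesis by simp
qed

text \<open>Gives meaning to the \<open>THE\<close> in the Christoffel map and in the shape
  operator.\<close>

lemma riesz:
  assumes "linear \<omega>"
  shows "\<exists>!w. \<forall>z. g w z = \<omega> z"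
proof -
  obtain E where E: "orthonormal_basis g UNIV E" using orthonormal_basis_exists[OF subspace_UNIV] by blast
  define w where "w = (\<Sum>i<DIM('e). \<omega> (E i) *\<^sub>R E i)"
  have "g w z = \<omega> z" for z
  proof -
    have "\<omega> z = \<omega> (\<Sum>i<DIM('e). g z (E i) *\<^sub>R E i)"
      using orthonormal_expansion[OF E, of z] by (simp add: dim_UNIV)
    then show ?thesis
      by (simp add: w_def lin linear_sum[OF assms] linear_cmul[OF assms] sym[of z] mult.commute)
  qed
  then show ?thesis by (metis nondegenerate)
qed

end

text \<open>A product rule that does not presuppose a derivative of \<open>a\<close>:
  \<open>m\<close> is of order \<open>norm (y - x)\<close> and \<open>a\<close> tends to 0, so the
  product is of smaller order. In \<open>differentiable_riesz\<close> the factors \<open>a\<close>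
  are coefficients whose differentiability is still to be shown.\<close>

lemma has_derivative_zero_times:
  fixes a m :: "'x::real_normed_vector \<Rightarrow> real"
  assumes "a \<midarrow>x\<rightarrow> 0" "m differentiable (at x)" "m x = 0"
  shows "((\<lambda>y. a y * m y) has_derivative (\<lambda>_. 0)) (at x)"
proof -
  obtain d K where d: "d > 0" "\<And>y. norm (y - x) < d \<Longrightarrow> \<bar>m y\<bar> \<le> K * norm (y - x)"
  proof -
    have b: "bounded_linear (dd m x)" and
      "\<exists>d>0. \<forall>y. norm (y - x) < d \<longrightarrow> norm (m y - m x - dd m x (y - x)) \<le> 1 * norm (y - x)"
      using has_derivative_dd[OF assms(2)] zero_less_one unfolding has_derivative_at_alt by blast+
    then obtain d where d: "d > 0"
      "\<And>y. norm (y - x) < d \<Longrightarrow> \<bar>m y - dd m x (y - x)\<bar> \<le> norm (y - x)"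
      using assms(3) by auto
    obtain K where "\<And>h. \<bar>dd m x h\<bar> \<le> norm h * K"
      using bounded_linear.bounded[OF b] by auto
    then have "\<bar>m y\<bar> \<le> (K + 1) * norm (y - x)" if "norm (y - x) < d" for y
    proof -
      have "\<bar>m y\<bar> \<le> \<bar>m y - dd m x (y - x)\<bar> + \<bar>dd m x (y - x)\<bar>" by linarith
      also have "\<dots> \<le> norm (y - x) + norm (y - x) * K"
        using d(2)[OF that] \<open>\<And>h. \<bar>dd m x h\<bar> \<le> norm h * K\<close>[of "y - x"] by linarith
      finally show ?thesis by (simp add: algebra_simps)
    qed
    then show ?thesis using that d(1) by blast
  qed
  have "((\<lambda>y. (a y * m y) / norm (y - x)) \<longlongrightarrow> 0) (at x)"
  proof (rule Lim_null_comparison)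
    show "\<forall>\<^sub>F y in at x. norm ((a y * m y) / norm (y - x)) \<le> \<bar>a y\<bar> * K"
      unfolding eventually_at
    proof (intro exI conjI ballI impI)
      fix y assume y: "y \<noteq> x \<and> dist y x < d"
      then have n: "norm (y - x) > 0" "norm (y - x) < d" by (auto simp: dist_norm)
      have "norm ((a y * m y) / norm (y - x)) = \<bar>a y\<bar> * (\<bar>m y\<bar> / norm (y - x))"
        by (simp add: abs_mult)
      also have "\<dots> \<le> \<bar>a y\<bar> * K"
        using d(2)[OF n(2)] n(1) by (intro mult_left_mono) (auto simp: field_simps)
      finally show "norm ((a y * m y) / norm (y - x)) \<le> \<bar>a y\<bar> * K" .
    qed (rule d(1))
    show "((\<lambda>y. \<bar>a y\<bar> * K) \<longlongrightarrow> 0) (at x)"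
      using tendsto_mult_left_zero[OF tendsto_rabs_zero[OF assms(1)], of K] by simp
  qed
  then have "((\<lambda>y. norm (a y * m y) / norm (y - x)) \<longlongrightarrow> 0) (at x)"
    by (rule tendsto_norm_zero[THEN tendsto_cong[THEN iffD1, rotated]]) simp
  then show ?thesis unfolding has_derivative_iff_norm using assms(3) by simp
qed

text \<open>Stands in for the differentiability of matrix inversion: the coefficients \<open>c\<close> of \<open>w y - w x\<close> in
  an orthonormal basis of \<open>G x\<close> solve a perturbed identity system whose perturbation vanishes at \<open>x\<close>.\<close>

lemma differentiable_riesz:
  fixes G :: "'x::real_normed_vector \<Rightarrow> 'e::euclidean_space \<Rightarrow> 'e \<Rightarrow> real"
  assumes U: "open U" "x \<in> U" and pd: "\<And>y. y \<in> U \<Longrightarrow> pd_form (G y)"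
    and dG: "\<And>u v. (\<lambda>y. G y u v) differentiable (at x)"
    and d\<gamma>: "\<And>z. (\<lambda>y. \<gamma> y z) differentiable (at x)"
    and w: "\<And>y z. y \<in> U \<Longrightarrow> G y (w y) z = \<gamma> y z"
  shows "w differentiable (at x)"
proof -
  interpret Gx: pd_form "G x" by (rule pd[OF U(2)])
  let ?n = "DIM('e)"
  obtain E where E: "orthonormal_basis (G x) UNIV E"
    using Gx.orthonormal_basis_exists[OF subspace_UNIV] by blast
  have gE: "G x (E i) (E j) = (if i = j then 1 else 0)" if "i < ?n" "j < ?n" for i j
    using E that by (auto simp: orthonormal_basis_def dim_UNIV)
  define c where "c i y = G x (w y - w x) (E i)" for i y
  have wexp: "w y = w x + (\<Sum>i<?n. c i y *\<^sub>R E i)" for y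
    using Gx.orthonormal_expansion[OF E, of "w y - w x"] by (simp add: c_def dim_UNIV algebra_simps)
  define \<delta> where "\<delta> i y = \<gamma> y (E i) - G y (w x) (E i)" for i y
  have d\<delta>: "\<delta> i differentiable (at x)" for i
    unfolding \<delta>_def by (intro differentiable_diff d\<gamma> dG)
  have \<delta>x: "\<delta> i x = 0" for i using w[OF U(2), of "E i"] by (simp add: \<delta>_def)
  define m where "m i j y = G y (E j) (E i) - G x (E j) (E i)" for i j y
  have dm: "m i j differentiable (at x)" for i j
    unfolding m_def by (intro differentiable_diff dG) simp
  have mx: "m i j x = 0" for i j by (simp add: m_def)
  have eq: "c i y = \<delta> i y - (\<Sum>j<?n. c j y * m i j y)" if "y \<in> U" "i < ?n" for y i
  proof -
    interpret Gy: pd_form "G y" by (rule pd[OF that(1)])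
    have "\<delta> i y = G y (w y) (E i) - G y (w x) (E i)" by (simp add: \<delta>_def w[OF that(1)])
    also have "\<dots> = G y (\<Sum>j<?n. c j y *\<^sub>R E j) (E i)" by (subst wexp) (simp add: Gy.lin)
    also have "\<dots> = (\<Sum>j<?n. c j y * m i j y) + (\<Sum>j<?n. c j y * G x (E j) (E i))"
      by (simp add: Gy.lin m_def algebra_simps flip: sum.distrib)
    also have "(\<Sum>j<?n. c j y * G x (E j) (E i)) = (\<Sum>j<?n. if j = i then c i y else 0)"
      using gE that(2) by (intro sum.cong) auto
    also have "\<dots> = c i y" using that(2) by simp
    finally show ?thesis by simp
  qed
  define C where "C y = (\<Sum>i<?n. \<bar>c i y\<bar>)" for y
  define D where "D y = (\<Sum>i<?n. \<bar>\<delta> i y\<bar>)" for y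
  define M where "M y = (\<Sum>i<?n. \<Sum>j<?n. \<bar>m i j y\<bar>)" for y
  have t\<delta>: "\<delta> i \<midarrow>x\<rightarrow> 0" for i
    using differentiable_imp_continuous_within[OF d\<delta>] \<delta>x by (metis continuous_at isContD)
  have tm: "m i j \<midarrow>x\<rightarrow> 0" for i j
    using differentiable_imp_continuous_within[OF dm] mx by (metis continuous_at isContD)
  have tD: "D \<midarrow>x\<rightarrow> 0" unfolding D_def
    by (intro tendsto_null_sum tendsto_rabs_zero t\<delta>)
  have tM: "M \<midarrow>x\<rightarrow> 0" unfolding M_def
    by (intro tendsto_null_sum tendsto_rabs_zero tm)
  \<comment> \<open>Once the total perturbation is below 1/2, its contribution to \<open>C y\<close>
    is absorbed on the left. This leaves \<open>C y \<le> 2 * D y\<close>, so every coefficient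
    tends to 0.\<close>
  have "eventually (\<lambda>y. M y < 1/2) (at x)" using tM by (rule order_tendstoD) simp
  moreover have "eventually (\<lambda>y. y \<in> U) (at x)" using U eventually_at_topological by blast
  ultimately have Cb: "eventually (\<lambda>y. norm (C y) \<le> 2 * D y) (at x)"
  proof eventually_elim
    case (elim y)
    have c0: "\<bar>c j y\<bar> \<le> C y" if "j < ?n" for j
      unfolding C_def using that by (intro member_le_sum) auto
    have C0: "C y \<ge> 0" unfolding C_def by (intro sum_nonneg) simp
    have "(\<Sum>i<?n. \<bar>c i y\<bar>) \<le> (\<Sum>i<?n. \<bar>\<delta> i y\<bar> + (\<Sum>j<?n. C y * \<bar>m i j y\<bar>))"
    proof (rule sum_mono)
      fix i assume "i \<in> {..<?n}"
      then have "\<bar>c i y\<bar> \<le> \<bar>\<delta> i y\<bar> + \<bar>\<Sum>j<?n. c j y * m i j y\<bar>"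
        using eq[OF elim(2), of i] by simp
      also have "\<bar>\<Sum>j<?n. c j y * m i j y\<bar> \<le> (\<Sum>j<?n. \<bar>c j y * m i j y\<bar>)" by (rule sum_abs)
      also have "\<dots> \<le> (\<Sum>j<?n. C y * \<bar>m i j y\<bar>)"
        unfolding abs_mult by (intro sum_mono mult_right_mono c0) auto
      finally show "\<bar>c i y\<bar> \<le> \<bar>\<delta> i y\<bar> + (\<Sum>j<?n. C y * \<bar>m i j y\<bar>)" by simp
    qed
    then have "C y \<le> (\<Sum>i<?n. \<bar>\<delta> i y\<bar> + (\<Sum>j<?n. C y * \<bar>m i j y\<bar>))" by (simp only: C_def)
    also have "\<dots> = D y + C y * M y"
      by (simp add: D_def M_def sum.distrib sum_distrib_left)
    also have "\<dots> \<le> D y + C y * (1/2)" using elim(1) C0 by (intro add_left_mono mult_left_mono) auto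
    finally show ?case using C0 by simp
  qed
  have tC: "C \<midarrow>x\<rightarrow> 0"
    by (rule Lim_null_comparison[OF Cb]) (use tendsto_mult_right_zero[OF tD, of 2] in simp)
  have tc: "c i \<midarrow>x\<rightarrow> 0" if "i < ?n" for i
    by (rule Lim_null_comparison[OF _ tC], rule always_eventually)
       (use that in \<open>auto simp: C_def intro!: member_le_sum\<close>)
  \<comment> \<open>Convergence to 0 is enough: each product \<open>c j y * m i j y\<close> has
    derivative 0 at \<open>x\<close>, and \<open>c i\<close> inherits the derivative of
    \<open>\<delta> i\<close>.\<close>
  have dc: "c i differentiable (at x)" if "i < ?n" for i
  proof -
    have "((\<lambda>y. \<delta> i y - (\<Sum>j<?n. c j y * m i j y)) has_derivative (\<lambda>h. dd (\<delta> i) x h - (\<Sum>j<?n. 0))) (at x)"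
      by (intro has_derivative_diff has_derivative_sum has_derivative_dd d\<delta> has_derivative_zero_times tc dm mx) simp
    then have "(c i has_derivative (\<lambda>h. dd (\<delta> i) x h - (\<Sum>j<?n. 0))) (at x)"
      by (rule has_derivative_transform_within_open[OF _ U]) (simp add: eq[OF _ that, symmetric])
    then show ?thesis by (rule differentiableI)
  qed
  have "(\<lambda>y. w x + (\<Sum>i<?n. c i y *\<^sub>R E i)) differentiable (at x)"
    using differentiableI[OF has_derivative_scaleR_left[OF has_derivative_dd[OF dc]]]
    by (intro differentiable_add differentiable_sum) auto
  then show ?thesis using wexp by (metis (no_types, lifting) ext)
qed

section \<open>Local Riemannian geometry and the Gauss equation\<close>

text \<open>The Riemann tensor evaluated on coordinate-constant fields, whose brackets
  vanish.\<close>

definition curv :: "('e::euclidean_space \<Rightarrow> 'e \<Rightarrow> 'e \<Rightarrow> real) \<Rightarrow> 'e \<Rightarrow> 'e \<Rightarrow> 'e \<Rightarrow> 'e \<Rightarrow> 'e" where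
  "curv G x X Y Z = dd (\<lambda>y. christoffel G y Y Z) x X - dd (\<lambda>y. christoffel G y X Z) x Y
     + christoffel G x X (christoffel G x Y Z) - christoffel G x Y (christoffel G x X Z)"

text \<open>Two derivatives at each point are what the curvature uses, and what the induced metric
  of an immersion is shown to have below.\<close>

locale metric_on =
  fixes U :: "'e::euclidean_space set" and G :: "'e \<Rightarrow> 'e \<Rightarrow> 'e \<Rightarrow> real"
  assumes open_dom: "open U"
    and pd: "x \<in> U \<Longrightarrow> pd_form (G x)"
    and diff1: "x \<in> U \<Longrightarrow> (\<lambda>y. G y u v) differentiable (at x)"
    and diff2: "x \<in> U \<Longrightarrow> (\<lambda>y. dd (\<lambda>z. G z u v) y w) differentiable (at x)"
begin

lemma bilinear_G: "x \<in> U \<Longrightarrow> bilinear (G x)"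
  and sym_G: "x \<in> U \<Longrightarrow> G x u v = G x v u"
  using pd pd_form.bil pd_form.sym by blast+

lemma linear_dd_G_left: "x \<in> U \<Longrightarrow> linear (\<lambda>u. dd (\<lambda>y. G y u v) x h)"
  by (rule linear_dd_family[OF open_dom]) (auto simp: diff1 pd pd_form.linear_left)

lemma linear_dd_G_right: "x \<in> U \<Longrightarrow> linear (\<lambda>v. dd (\<lambda>y. G y u v) x h)"
  by (rule linear_dd_family[OF open_dom]) (auto simp: diff1 pd pd_form.linear_right)

lemma linear_dd_G: "x \<in> U \<Longrightarrow> linear (dd (\<lambda>y. G y u v) x)"
  by (rule linear_dd[OF diff1])

lemma dd_G_sym:
  assumes "x \<in> U"
  shows "dd (\<lambda>y. G y u v) x = dd (\<lambda>y. G y v u) x"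
  by (rule dd_cong_open[OF open_dom assms]) (rule sym_G)

lemmas linear_dd_G_simps =
  linear_add[OF linear_dd_G_left] linear_add[OF linear_dd_G_right] linear_add[OF linear_dd_G]
  linear_cmul[OF linear_dd_G_left] linear_cmul[OF linear_dd_G_right] linear_cmul[OF linear_dd_G]

lemma christoffel_eq:
  assumes "x \<in> U"
  shows "G x (christoffel G x u v) z =
    (dd (\<lambda>y. G y v z) x u + dd (\<lambda>y. G y u z) x v - dd (\<lambda>y. G y u v) x z) / 2"
proof -
  interpret pd_form "G x" by (rule pd[OF assms])
  let ?\<omega> = "\<lambda>z. (dd (\<lambda>y. G y v z) x u + dd (\<lambda>y. G y u z) x v - dd (\<lambda>y. G y u v) x z) / 2"
  have "linear ?\<omega>"
    by (rule linearI) (simp_all add: linear_dd_G_simps[OF assms] field_simps)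
  from theI'[OF riesz[OF this]] show ?thesis unfolding christoffel_def by blast
qed

lemma christoffel_sym:
  assumes "x \<in> U"
  shows "christoffel G x u v = christoffel G x v u"
  by (rule pd_form.nondegenerate[OF pd[OF assms]])
    (simp only: christoffel_eq[OF assms] dd_G_sym[OF assms, of u v] add.commute)

lemma linear_christoffel_right:
  assumes "x \<in> U"
  shows "linear (christoffel G x u)"
proof -
  interpret pd_form "G x" by (rule pd[OF assms])
  show ?thesis
    by (rule linearI; rule nondegenerate)
      (simp_all add: add_left scale_left christoffel_eq assms linear_dd_G_simps[OF assms] field_simps)
qed

lemma linear_christoffel_left:
  assumes "x \<in> U"
  shows "linear (\<lambda>u. christoffel G x u v)"
proof -
  have "(\<lambda>u. christoffel G x u v) = christoffel G x v"
    by (rule ext) (rule christoffel_sym[OF assms])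
  then show ?thesis using linear_christoffel_right[OF assms] by simp
qed

lemma bilinear_christoffel: "x \<in> U \<Longrightarrow> bilinear (christoffel G x)"
  unfolding bilinear_def using linear_christoffel_left linear_christoffel_right by blast

lemmas christoffel_lin =
  linear_add[OF linear_christoffel_left] linear_add[OF linear_christoffel_right]
  linear_diff[OF linear_christoffel_left] linear_diff[OF linear_christoffel_right]
  linear_neg[OF linear_christoffel_left] linear_neg[OF linear_christoffel_right]
  linear_cmul[OF linear_christoffel_left] linear_cmul[OF linear_christoffel_right]
  linear_0[OF linear_christoffel_left] linear_0[OF linear_christoffel_right]

lemma metric_compatible:
  assumes "x \<in> U"
  shows "dd (\<lambda>y. G y v w) x u = G x (christoffel G x u v) w + G x v (christoffel G x u w)"
  using christoffel_eq[OF assms, of u v w] christoffel_eq[OF assms, of u w v] sym_G[OF assms, of v]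
    dd_G_sym[OF assms, of w v] dd_G_sym[OF assms, of v u] dd_G_sym[OF assms, of w u]
  by (simp add: field_simps)

lemma christoffel_differentiable:
  assumes "x \<in> U"
  shows "(\<lambda>y. christoffel G y u v) differentiable (at x)"
proof (rule differentiable_riesz[OF open_dom assms pd diff1[OF assms]])
  show "(\<lambda>y. (dd (\<lambda>y. G y v z) y u + dd (\<lambda>y. G y u z) y v - dd (\<lambda>y. G y u v) y z) / 2) differentiable (at x)" for z
    by (intro differentiable_divide differentiable_diff differentiable_add diff2[OF assms]) auto
qed (auto simp: christoffel_eq)

text \<open>Metric compatibility for vector fields along a map. It serves the identity map as well
  as an immersion.\<close>

lemma has_derivative_metric_along:
  fixes F V Z :: "'x::real_normed_vector \<Rightarrow> 'e"
  assumes "open W" "x \<in> W" "\<And>y. y \<in> W \<Longrightarrow> F y \<in> U" "F differentiable (at x)"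
    and "V differentiable (at x)" "Z differentiable (at x)"
  shows "((\<lambda>y. G (F y) (V y) (Z y)) has_derivative (\<lambda>h.
    G (F x) (dd V x h + christoffel G (F x) (dd F x h) (V x)) (Z x)
    + G (F x) (V x) (dd Z x h + christoffel G (F x) (dd F x h) (Z x)))) (at x)"
proof -
  have xU: "F x \<in> U" using assms by blast
  interpret Gx: pd_form "G (F x)" by (rule pd[OF xU])
  have "dd (\<lambda>y. G (F y) v w) x h = dd (\<lambda>y. G y v w) (F x) (dd F x h)" for v w h
    by (rule dd_compose[OF diff1[OF xU] assms(4)])
  then have "((\<lambda>y. G (F y) (V y) (Z y)) has_derivative
      (\<lambda>h. dd (\<lambda>y. G y (V x) (Z x)) (F x) (dd F x h) + G (F x) (dd V x h) (Z x) + G (F x) (V x) (dd Z x h))) (at x)"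
    using has_derivative_bilinear_family[OF assms(1,2), of "\<lambda>y. G (F y)" V Z]
      bilinear_G[OF assms(3)] differentiable_compose'[OF diff1[OF xU] assms(4)] assms(5,6)
    by simp
  then show ?thesis by (simp add: metric_compatible[OF xU] Gx.lin algebra_simps)
qed

lemmas differentiable_metric_along = differentiableI[OF has_derivative_metric_along]
lemmas dd_metric_along = fun_cong[OF dd_eqI[OF has_derivative_metric_along]]

lemma differentiable_metric:
  assumes "x \<in> U" "V differentiable (at x)" "Z differentiable (at x)"
  shows "(\<lambda>y. G y (V y) (Z y)) differentiable (at x)"
  by (rule differentiable_metric_along[OF open_dom assms(1) _ differentiable_ident assms(2,3)])

lemma dd_metric:
  assumes "x \<in> U" "V differentiable (at x)" "Z differentiable (at x)"
  shows "dd (\<lambda>y. G y (V y) (Z y)) x h = G x (dd V x h + christoffel G x h (V x)) (Z x)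
    + G x (V x) (dd Z x h + christoffel G x h (Z x))"
  using dd_metric_along[OF open_dom assms(1) _ differentiable_ident assms(2,3)] by simp

lemma differentiable_christoffel_along:
  assumes "open W" "x \<in> W" "\<And>y. y \<in> W \<Longrightarrow> F y \<in> U" "F differentiable (at x)"
    and "V differentiable (at x)" "Z differentiable (at x)"
  shows "(\<lambda>y. christoffel G (F y) (V y) (Z y)) differentiable (at x)"
  by (rule differentiable_bilinear_family[OF assms(1,2), of "\<lambda>y. christoffel G (F y)" V Z])
    (use assms in \<open>auto intro: bilinear_christoffel
      differentiable_compose'[OF christoffel_differentiable[OF assms(3)[OF assms(2)]] assms(4)]\<close>)

lemma dd_christoffel_along:
  assumes "open W" "x \<in> W" "\<And>y. y \<in> W \<Longrightarrow> F y \<in> U" "F differentiable (at x)"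
    and "V differentiable (at x)" "Z differentiable (at x)"
  shows "dd (\<lambda>y. christoffel G (F y) (V y) (Z y)) x h =
    dd (\<lambda>q. christoffel G q (V x) (Z x)) (F x) (dd F x h)
    + christoffel G (F x) (dd V x h) (Z x) + christoffel G (F x) (V x) (dd Z x h)"
proof -
  have xU: "F x \<in> U" using assms by blast
  have "dd (\<lambda>y. christoffel G (F y) v w) x h = dd (\<lambda>y. christoffel G y v w) (F x) (dd F x h)" for v w
    by (rule dd_compose[OF christoffel_differentiable[OF xU] assms(4)])
  then show ?thesis
    using dd_bilinear_family[OF assms(1,2), of "\<lambda>y. christoffel G (F y)" V Z h]
      bilinear_christoffel[OF assms(3)]
      differentiable_compose'[OF christoffel_differentiable[OF xU] assms(4)] assms(5,6)
    by simp
qed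

lemma curvature_op_const:
  assumes "x \<in> U"
  shows "curvature_op G (\<lambda>_. X) (\<lambda>_. Y) (\<lambda>_. Z) x = curv G x X Y Z"
proof -
  have c: "nabla G (\<lambda>_. Y) (\<lambda>_. Z) = (\<lambda>x. christoffel G x Y Z)" for Y Z
    by (simp add: nabla_def fun_eq_iff)
  show ?thesis
    unfolding curvature_op_def c using assms by (simp add: nabla_def bracket_def curv_def christoffel_lin)
qed

text \<open>Metric compatibility trades derivatives of the Christoffel map for derivatives of scalar
  functions. For an induced metric these can be computed in the ambient space.\<close>

lemma metric_curv:
  assumes "x \<in> U"
  shows "G x (curv G x X Y Z) V =
    dd (\<lambda>y. G y (christoffel G y Y Z) V) x X - dd (\<lambda>y. G y (christoffel G y X Z) V) x Y
    - G x (christoffel G x Y Z) (christoffel G x X V) + G x (christoffel G x X Z) (christoffel G x Y V)"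
proof -
  interpret pd_form "G x" by (rule pd[OF assms])
  show ?thesis
    by (simp add: dd_metric[OF assms christoffel_differentiable[OF assms]] curv_def lin)
qed

end

section \<open>Immersions in coordinates\<close>

locale immersed = metric_on U G
  for U :: "'e::euclidean_space set" and G :: "'e \<Rightarrow> 'e \<Rightarrow> 'e \<Rightarrow> real" +
  fixes W :: "'d::euclidean_space set" and F :: "'d \<Rightarrow> 'e"
  assumes open_W: "open W" and F_mem: "y \<in> W \<Longrightarrow> F y \<in> U"
    and F1: "y \<in> W \<Longrightarrow> F differentiable (at y)"
    and F2: "y \<in> W \<Longrightarrow> (\<lambda>z. dd F z v) differentiable (at y)"
    and F3: "y \<in> W \<Longrightarrow> (\<lambda>z. dd (\<lambda>z. dd F z v) z u) differentiable (at y)"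
    and F_inj: "y \<in> W \<Longrightarrow> inj (dd F y)"
begin

definition GM :: "'d \<Rightarrow> 'd \<Rightarrow> 'd \<Rightarrow> real" where
  "GM y u v = G (F y) (dd F y u) (dd F y v)"

text \<open>The ambient covariant derivative, in direction \<open>u\<close>, of the field \<open>dF(v)\<close> along \<open>F\<close>.\<close>

definition DF2 :: "'d \<Rightarrow> 'd \<Rightarrow> 'd \<Rightarrow> 'e" where
  "DF2 y u v = dd (\<lambda>z. dd F z v) y u + christoffel G (F y) (dd F y u) (dd F y v)"

lemma dd_GM:
  assumes "y \<in> W"
  shows "((\<lambda>z. GM z u v) has_derivative
    (\<lambda>w. G (F y) (DF2 y w u) (dd F y v) + G (F y) (dd F y u) (DF2 y w v))) (at y)"
  unfolding GM_def DF2_def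
  by (rule has_derivative_metric_along[OF open_W assms F_mem F1[OF assms] F2[OF assms] F2[OF assms]])

text \<open>Torsion-freeness of the ambient connection along \<open>F\<close>: both the second
  derivative and the Christoffel term are symmetric.\<close>

lemma DF2_sym: "y \<in> W \<Longrightarrow> DF2 y u v = DF2 y v u"
  unfolding DF2_def
  by (intro arg_cong2[where f="(+)"] second_derivative_symmetric[OF open_W _ F1 F2] christoffel_sym F_mem)

lemma DF2_differentiable:
  assumes "y \<in> W"
  shows "(\<lambda>z. DF2 z u v) differentiable (at y)"
  unfolding DF2_def
  by (intro differentiable_add F3[OF assms]
    differentiable_christoffel_along[OF open_W assms F_mem F1[OF assms] F2[OF assms] F2[OF assms]])

lemma linear_dF: "y \<in> W \<Longrightarrow> linear (dd F y)"
  by (rule linear_dd[OF F1])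

lemma pd_form_GM:
  assumes "y \<in> W"
  shows "pd_form (GM y)"
proof
  interpret pd_form "G (F y)" by (rule pd[OF F_mem[OF assms]])
  note l = linear_dF[OF assms]
  show "bilinear (GM y)"
    unfolding bilinear_def GM_def
    by (auto intro!: linearI simp: linear_add[OF l] linear_cmul[OF l] lin)
  show "GM y u v = GM y v u" for u v unfolding GM_def by (rule sym)
  show "0 < GM y u u" if "u \<noteq> 0" for u
    unfolding GM_def using that linear_injective_0[OF l] F_inj[OF assms] by (intro pos) auto
qed

sublocale M: metric_on W GM
proof (rule metric_on.intro)
  fix y u v w assume y: "y \<in> W"
  show "(\<lambda>z. GM z u v) differentiable (at y)" by (rule differentiableI[OF dd_GM[OF y]])
  have "(\<lambda>z. G (F z) (DF2 z w u) (dd F z v) + G (F z) (dd F z u) (DF2 z w v)) differentiable (at y)"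
    by (intro differentiable_add differentiable_metric_along[OF open_W y F_mem F1[OF y]]
      F2[OF y] DF2_differentiable[OF y])
  moreover have "(\<lambda>z. dd (\<lambda>z. GM z u v) z w) differentiable (at y) \<longleftrightarrow>
      (\<lambda>z. G (F z) (DF2 z w u) (dd F z v) + G (F z) (dd F z u) (DF2 z w v)) differentiable (at y)"
    by (rule differentiable_cong_open[OF open_W y]) (rule fun_cong[OF dd_eqI[OF dd_GM]])
  ultimately show "(\<lambda>z. dd (\<lambda>z. GM z u v) z w) differentiable (at y)" by blast
qed (auto simp: open_W pd_form_GM)

text \<open>Tangentially, the ambient connection is the Levi-Civita connection of the induced
  metric. Inserting the derivatives of \<open>GM\<close> into the Koszul formula leaves a single
  pair of equal terms, by symmetry of \<open>DF2\<close>.\<close>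

lemma DF2_tangential:
  assumes "y \<in> W"
  shows "G (F y) (DF2 y u v) (dd F y z) = GM y (christoffel GM y u v) z"
proof -
  have "G (F y) (dd F y v) (DF2 y u z) = G (F y) (DF2 y u z) (dd F y v)"
    "G (F y) (dd F y u) (DF2 y v z) = G (F y) (DF2 y z v) (dd F y u)"
    "G (F y) (dd F y u) (DF2 y z v) = G (F y) (DF2 y z v) (dd F y u)"
    using sym_G[OF F_mem[OF assms]] DF2_sym[OF assms, of v z] by simp_all
  then show ?thesis
    unfolding M.christoffel_eq[OF assms] dd_eqI[OF dd_GM[OF assms]]
    using DF2_sym[OF assms, of v u] DF2_sym[OF assms, of u z] by simp
qed

text \<open>The Gauss formula turned round: the subtracted term is the tangential part of
  \<open>DF2\<close>, by \<open>DF2_tangential\<close>.\<close>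

definition sff :: "'d \<Rightarrow> 'd \<Rightarrow> 'd \<Rightarrow> 'e" where
  "sff y u v = DF2 y u v - dd F y (christoffel GM y u v)"

lemma sff_normal:
  assumes "y \<in> W"
  shows "G (F y) (sff y u v) (dd F y z) = 0" "G (F y) (dd F y z) (sff y u v) = 0"
proof -
  interpret pd_form "G (F y)" by (rule pd[OF F_mem[OF assms]])
  show "G (F y) (sff y u v) (dd F y z) = 0"
    unfolding sff_def lin DF2_tangential[OF assms] by (simp add: GM_def)
  then show "G (F y) (dd F y z) (sff y u v) = 0" using sym by metis
qed

lemma sff_sym: "y \<in> W \<Longrightarrow> sff y u v = sff y v u"
  unfolding sff_def by (simp add: DF2_sym M.christoffel_sym)

lemma bilinear_sff:
  assumes "y \<in> W"
  shows "bilinear (sff y)"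
proof -
  have "linear (sff y u)" for u
    unfolding sff_def DF2_def
    by (intro linear_compose_sub linear_compose_add linear_compose[OF linear_dF[OF assms], unfolded o_def]
        linear_compose[OF _ linear_dF[OF assms], unfolded o_def]
        linear_dd_family[OF open_W assms linear_dF F2[OF assms]]
        linear_christoffel_right[OF F_mem[OF assms]] M.linear_christoffel_right[OF assms])
  moreover from this have "linear (\<lambda>u. sff y u v)" for v
  proof -
    have "(\<lambda>u. sff y u v) = sff y v" by (rule ext) (rule sff_sym[OF assms])
    then show ?thesis using \<open>\<And>u. linear (sff y u)\<close> by simp
  qed
  ultimately show ?thesis by (simp add: bilinear_def)
qed

lemma gauss:
  assumes y: "y \<in> W"
  shows "GM y (curv GM y X Y Z) V =
    G (F y) (curv G (F y) (dd F y X) (dd F y Y) (dd F y Z)) (dd F y V)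
    + G (F y) (sff y Y Z) (sff y X V) - G (F y) (sff y X Z) (sff y Y V)"
proof -
  have yU: "F y \<in> U" by (rule F_mem[OF y])
  interpret pd_form "G (F y)" by (rule pd[OF yU])
  let ?\<Gamma> = "christoffel G (F y)" and ?f = "dd F y" and ?M = "christoffel GM y"
  \<comment> \<open>\<open>DF2_tangential\<close> is an identity on all of \<open>W\<close>, so
    under the derivative the induced Christoffel map may be replaced by the ambient field
    \<open>DF2\<close>.\<close>
  have tang: "dd (\<lambda>y. GM y (christoffel GM y Y Z) V) y X =
      G (F y) (dd (\<lambda>z. DF2 z Y Z) y X + ?\<Gamma> (?f X) (DF2 y Y Z)) (?f V) + G (F y) (DF2 y Y Z) (DF2 y X V)"
    for X Y Z V
  proof -
    have "dd (\<lambda>y. GM y (christoffel GM y Y Z) V) y = dd (\<lambda>z. G (F z) (DF2 z Y Z) (dd F z V)) y"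
      by (rule dd_cong_open[OF open_W y]) (simp add: DF2_tangential)
    then show ?thesis
      by (simp add: dd_metric_along[OF open_W y F_mem F1[OF y] DF2_differentiable[OF y] F2[OF y]]
        DF2_def[of y X V])
  qed
  have dDF2: "dd (\<lambda>z. DF2 z Y Z) y X = dd (\<lambda>z. dd (\<lambda>z. dd F z Z) z Y) y X
      + dd (\<lambda>q. christoffel G q (?f Y) (?f Z)) (F y) (?f X)
      + ?\<Gamma> (dd (\<lambda>z. dd F z Y) y X) (?f Z) + ?\<Gamma> (?f Y) (dd (\<lambda>z. dd F z Z) y X)" for X Y Z
  proof -
    have "dd (\<lambda>z. DF2 z Y Z) y = (\<lambda>h. dd (\<lambda>z. dd (\<lambda>z. dd F z Z) z Y) y h +
        dd (\<lambda>z. christoffel G (F z) (dd F z Y) (dd F z Z)) y h)"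
      unfolding DF2_def
      by (intro dd_eqI has_derivative_add has_derivative_dd F3[OF y]
        differentiable_christoffel_along[OF open_W y F_mem F1[OF y] F2[OF y] F2[OF y]])
    then show ?thesis
      by (simp add: dd_christoffel_along[OF open_W y F_mem F1[OF y] F2[OF y] F2[OF y]])
  qed
  have s3: "dd (\<lambda>z. dd (\<lambda>z. dd F z Z) z Y) y X = dd (\<lambda>z. dd (\<lambda>z. dd F z Z) z X) y Y"
    by (rule second_derivative_symmetric[OF open_W y F2 F3[OF y]])
  have s2: "dd (\<lambda>z. dd F z Y) y X = dd (\<lambda>z. dd F z X) y Y"
    by (rule second_derivative_symmetric[OF open_W y F1 F2[OF y]])
  \<comment> \<open>Antisymmetrization in \<open>X\<close> and \<open>Y\<close>: the third
    derivatives of \<open>F\<close> cancel by \<open>s3\<close>, the second derivatives by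
    \<open>s2\<close> and against those inside \<open>DF2\<close>. What remains is the ambient
    curvature.\<close>
  have pulled: "(dd (\<lambda>z. DF2 z Y Z) y X + ?\<Gamma> (?f X) (DF2 y Y Z)) - (dd (\<lambda>z. DF2 z X Z) y Y + ?\<Gamma> (?f Y) (DF2 y X Z))
      = curv G (F y) (?f X) (?f Y) (?f Z)"
    unfolding dDF2 s3 s2 by (simp add: DF2_def christoffel_lin[OF yU] curv_def)
  \<comment> \<open>The tangential products cancel the quadratic Christoffel terms of
    \<open>metric_curv\<close>, and only the normal products survive.\<close>
  have split: "G (F y) (DF2 y A B) (DF2 y C D) = G (F y) (sff y A B) (sff y C D) + GM y (?M A B) (?M C D)" for A B C D
  proof -
    have e: "DF2 y A B = sff y A B + ?f (?M A B)" for A B by (simp add: sff_def)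
    show ?thesis unfolding e lin by (simp add: sff_normal[OF y] GM_def)
  qed
  show ?thesis
    unfolding M.metric_curv[OF y] tang split pulled[symmetric] by (simp add: lin)
qed

end

section \<open>Contact metric structures in a coordinate domain\<close>

text \<open>The contact form is encoded as the metric dual \<open>G y X (\<xi> y)\<close>, so that
  its derivatives reduce to those of \<xi> and the Christoffel map.\<close>

locale contact_local = metric_on U G
  for U :: "'e::euclidean_space set" and G :: "'e \<Rightarrow> 'e \<Rightarrow> 'e \<Rightarrow> real" +
  fixes \<phi> :: "'e \<Rightarrow> 'e \<Rightarrow> 'e" and \<xi> :: "'e \<Rightarrow> 'e"
  assumes linear_\<phi>: "y \<in> U \<Longrightarrow> linear (\<phi> y)"
    and \<phi>1: "y \<in> U \<Longrightarrow> (\<lambda>z. \<phi> z u) differentiable (at y)"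
    and \<xi>1: "y \<in> U \<Longrightarrow> \<xi> differentiable (at y)"
    and \<xi>2: "y \<in> U \<Longrightarrow> (\<lambda>z. dd \<xi> z v) differentiable (at y)"
    and \<phi>\<phi>: "y \<in> U \<Longrightarrow> \<phi> y (\<phi> y X) = - X + G y X (\<xi> y) *\<^sub>R \<xi> y"
    and \<xi>\<xi>: "y \<in> U \<Longrightarrow> G y (\<xi> y) (\<xi> y) = 1"
    and \<phi>\<xi>: "y \<in> U \<Longrightarrow> \<phi> y (\<xi> y) = 0"
    and \<phi>_skew: "y \<in> U \<Longrightarrow> G y X (\<phi> y Y) = - G y (\<phi> y X) Y"
    and contact: "y \<in> U \<Longrightarrow>
      dd (\<lambda>z. G z Y (\<xi> z)) y X - dd (\<lambda>z. G z X (\<xi> z)) y Y = 2 * G y X (\<phi> y Y)"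
begin

text \<open>Here \<open>T = \<nabla>\<xi>\<close>, the symmetric part of which is \<open>S\<close>, and \<open>N K = \<nabla>\<^sub>\<xi>K\<close> for a field \<open>K\<close> of endomorphisms.\<close>

definition T :: "'e \<Rightarrow> 'e \<Rightarrow> 'e" where
  "T y X = dd \<xi> y X + christoffel G y X (\<xi> y)"

definition S :: "'e \<Rightarrow> 'e \<Rightarrow> 'e" where
  "S y X = T y X + \<phi> y X"

definition N :: "('e \<Rightarrow> 'e \<Rightarrow> 'e) \<Rightarrow> 'e \<Rightarrow> 'e \<Rightarrow> 'e" where
  "N K y X = dd (\<lambda>z. K z X) y (\<xi> y) + christoffel G y (\<xi> y) (K y X) - K y (christoffel G y (\<xi> y) X)"

lemma N_cong:
  assumes "y \<in> U" "\<And>z X. z \<in> U \<Longrightarrow> K z X = L z X"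
  shows "N K y X = N L y X"
  using dd_cong_open[OF open_dom assms(1), of "\<lambda>z. K z X" "\<lambda>z. L z X"] assms by (simp add: N_def)

lemma N_add:
  assumes "y \<in> U" "\<And>u. (\<lambda>z. K z u) differentiable (at y)" "\<And>u. (\<lambda>z. L z u) differentiable (at y)"
  shows "N (\<lambda>z X. K z X + L z X) y X = N K y X + N L y X"
proof -
  have "dd (\<lambda>z. K z X + L z X) y = (\<lambda>h. dd (\<lambda>z. K z X) y h + dd (\<lambda>z. L z X) y h)"
    by (intro dd_eqI has_derivative_add has_derivative_dd assms)
  then show ?thesis by (simp add: N_def christoffel_lin[OF assms(1)])
qed

lemma N_compose:
  assumes "y \<in> U" "\<And>z. z \<in> U \<Longrightarrow> linear (K z)"
    and "\<And>u. (\<lambda>z. K z u) differentiable (at y)" "\<And>u. (\<lambda>z. L z u) differentiable (at y)"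
  shows "N (\<lambda>z X. K z (L z X)) y X = N K y (L y X) + K y (N L y X)"
  using dd_linear_family[OF open_dom assms(1,2,3,4), of X "\<xi> y"] assms(2)[OF assms(1)]
  by (simp add: N_def linear_add linear_diff)

lemma linear_d\<xi>: "y \<in> U \<Longrightarrow> linear (dd \<xi> y)"
  by (rule linear_dd[OF \<xi>1])

lemma linear_T: "y \<in> U \<Longrightarrow> linear (T y)"
  unfolding T_def by (intro linear_compose_add linear_d\<xi> linear_christoffel_left)

lemma linear_S: "y \<in> U \<Longrightarrow> linear (S y)"
  unfolding S_def by (intro linear_compose_add linear_T linear_\<phi>)

lemma T1:
  assumes "y \<in> U"
  shows "(\<lambda>z. T z X) differentiable (at y)"
  unfolding T_def
  by (intro differentiable_add \<xi>2[OF assms] differentiable_christoffel_along[OF open_dom assms _ differentiable_ident]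
      \<xi>1[OF assms]) auto

lemma S1: "y \<in> U \<Longrightarrow> (\<lambda>z. S z X) differentiable (at y)"
  unfolding S_def by (intro differentiable_add T1 \<phi>1)

lemma dd_\<eta>:
  assumes "y \<in> U"
  shows "dd (\<lambda>z. G z Y (\<xi> z)) y X = G y (christoffel G y X Y) (\<xi> y) + G y Y (T y X)"
  using dd_metric[OF assms _ \<xi>1[OF assms], of "\<lambda>_. Y" X] by (simp add: T_def)

lemma \<eta>1:
  assumes "y \<in> U"
  shows "(\<lambda>z. G z Y (\<xi> z)) differentiable (at y)"
  by (rule differentiable_metric[OF assms _ \<xi>1[OF assms]]) simp

lemma \<eta>2:
  assumes "y \<in> U"
  shows "(\<lambda>z. dd (\<lambda>z. G z Y (\<xi> z)) z X) differentiable (at y)"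
proof -
  have "(\<lambda>z. G z (christoffel G z X Y) (\<xi> z) + G z Y (T z X)) differentiable (at y)"
    by (intro differentiable_add differentiable_metric assms christoffel_differentiable \<xi>1 T1) simp
  moreover have "(\<lambda>z. dd (\<lambda>z. G z Y (\<xi> z)) z X) differentiable (at y) \<longleftrightarrow>
    (\<lambda>z. G z (christoffel G z X Y) (\<xi> z) + G z Y (T z X)) differentiable (at y)"
    by (rule differentiable_cong_open[OF open_dom assms]) (rule dd_\<eta>)
  ultimately show ?thesis by blast
qed

text \<open>The exterior derivative is the antisymmetrized covariant derivative, since the
  Christoffel terms cancel. Thus the skew part of \<open>T\<close> is -\<phi>, which is why adding
  \<phi> in \<open>S\<close> leaves a symmetric operator.\<close>

lemma T_skew:
  assumes "y \<in> U"
  shows "G y Y (T y X) - G y X (T y Y) = 2 * G y X (\<phi> y Y)"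
  using contact[OF assms, of Y X] unfolding dd_\<eta>[OF assms] by (simp add: christoffel_sym[OF assms, of X Y])

lemma G_\<xi>_T:
  assumes "y \<in> U"
  shows "G y (\<xi> y) (T y X) = 0"
proof -
  have "dd (\<lambda>z. G z (\<xi> z) (\<xi> z)) y = dd (\<lambda>z. 1) y"
    by (rule dd_cong_open[OF open_dom assms \<xi>\<xi>])
  then have "G y (T y X) (\<xi> y) + G y (\<xi> y) (T y X) = 0"
    using dd_metric[OF assms \<xi>1[OF assms] \<xi>1[OF assms], of X] by (simp add: T_def)
  then show ?thesis using sym_G[OF assms, of "T y X"] by simp
qed

text \<open>\<xi> is geodesic: in \<open>T_skew\<close> with \<xi> as one argument, one term
  vanishes by the unit length of \<xi> and the other by \<phi>\<xi> = 0.\<close>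

lemma T_\<xi>:
  assumes "y \<in> U"
  shows "T y (\<xi> y) = 0"
proof -
  interpret pd_form "G y" by (rule pd[OF assms])
  have "G y (T y (\<xi> y)) Y = 0" for Y
    using T_skew[OF assms, of Y "\<xi> y"] G_\<xi>_T[OF assms] \<phi>_skew[OF assms, of "\<xi> y" Y]
    by (simp add: \<phi>\<xi>[OF assms] lin sym[of _ Y])
  then show ?thesis using self_eq_0_iff by blast
qed

lemma S_sym:
  assumes "y \<in> U"
  shows "G y (S y X) Y = G y X (S y Y)"
proof -
  interpret pd_form "G y" by (rule pd[OF assms])
  show ?thesis
    using T_skew[OF assms, of Y X] \<phi>_skew[OF assms, of X Y] sym[of "T y X" Y] by (simp add: S_def lin)
qed

lemma S_\<xi>: "y \<in> U \<Longrightarrow> S y (\<xi> y) = 0"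
  by (simp add: S_def T_\<xi> \<phi>\<xi>)

lemma G_S_\<xi>:
  assumes "y \<in> U"
  shows "G y (S y X) (\<xi> y) = 0"
  using S_sym[OF assms, of X "\<xi> y"] pd_form.zero_right[OF pd[OF assms]] S_\<xi>[OF assms] by simp

text \<open>The fundamental 2-form is exact up to a factor, hence closed. Each summand is half a
  difference of two second derivatives of the contact form, and these cancel in pairs.\<close>

lemma \<Phi>_closed:
  assumes "y \<in> U"
  shows "dd (\<lambda>z. G z X (\<phi> z Y)) y Z + dd (\<lambda>z. G z Y (\<phi> z Z)) y X + dd (\<lambda>z. G z Z (\<phi> z X)) y Y = 0"
proof -
  have d: "2 * dd (\<lambda>z. G z X (\<phi> z Y)) y Z =
      dd (\<lambda>z. dd (\<lambda>z. G z Y (\<xi> z)) z X) y Z - dd (\<lambda>z. dd (\<lambda>z. G z X (\<xi> z)) z Y) y Z" for X Y Z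
  proof -
    have g: "(\<lambda>z. G z X (\<phi> z Y)) differentiable (at y)"
      by (intro differentiable_metric assms \<phi>1) simp
    have "dd (\<lambda>z. 2 * G z X (\<phi> z Y)) y = (\<lambda>h. 2 * dd (\<lambda>z. G z X (\<phi> z Y)) y h)"
      by (intro dd_eqI has_derivative_mult_right has_derivative_dd g)
    moreover have "dd (\<lambda>z. 2 * G z X (\<phi> z Y)) y =
        dd (\<lambda>z. dd (\<lambda>z. G z Y (\<xi> z)) z X - dd (\<lambda>z. G z X (\<xi> z)) z Y) y"
      by (rule dd_cong_open[OF open_dom assms]) (simp only: contact)
    moreover have "dd (\<lambda>z. dd (\<lambda>z. G z Y (\<xi> z)) z X - dd (\<lambda>z. G z X (\<xi> z)) z Y) y =
        (\<lambda>h. dd (\<lambda>z. dd (\<lambda>z. G z Y (\<xi> z)) z X) y h - dd (\<lambda>z. dd (\<lambda>z. G z X (\<xi> z)) z Y) y h)"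
      by (intro dd_eqI has_derivative_diff has_derivative_dd \<eta>2[OF assms])
    ultimately show ?thesis by metis
  qed
  have s: "dd (\<lambda>z. dd (\<lambda>z. G z Y (\<xi> z)) z X) y Z = dd (\<lambda>z. dd (\<lambda>z. G z Y (\<xi> z)) z Z) y X" for X Y Z
    by (rule second_derivative_symmetric[OF open_dom assms \<eta>1 \<eta>2[OF assms]])
  show ?thesis
    using d[of X Y Z] d[of Y Z X] d[of Z X Y] s[of Y X Z] s[of X Y Z] s[of Z Y X] by linarith
qed

text \<open>The Cartan formula for the Lie derivative of the fundamental 2-form along \<xi>:
  inserting \<xi> into \<open>\<Phi>_closed\<close> expresses the derivative along \<xi> by
  derivatives of contractions with \<xi>, which vanish identically. Writing \<open>T\<close> as
  \<open>S\<close> minus \<phi> makes the \<phi>-terms cancel.\<close>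

lemma N_\<phi>_weak:
  assumes "y \<in> U"
  shows "N \<phi> y Y = - (S y (\<phi> y Y) + \<phi> y (S y Y))"
proof -
  interpret pd_form "G y" by (rule pd[OF assms])
  let ?\<Gamma> = "christoffel G y" and ?\<xi> = "\<xi> y"
  note lphi = linear_add[OF linear_\<phi>[OF assms]] linear_diff[OF linear_\<phi>[OF assms]] linear_0[OF linear_\<phi>[OF assms]]
  have "G y X (N \<phi> y Y) = G y X (- (S y (\<phi> y Y) + \<phi> y (S y Y)))" for X
  proof -
    \<comment> \<open>The contraction vanishes on all of \<open>U\<close>, so the derivative of the
      2-form with \<xi> frozen at \<open>y\<close> is traded for a derivative of \<xi>;
      \<open>e2\<close> does the same in the other argument.\<close>
    have "dd (\<lambda>z. G z Y (\<phi> z (\<xi> z))) y = dd (\<lambda>_. 0) y"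
      by (rule dd_cong_open[OF open_dom assms]) (simp add: \<phi>\<xi> pd pd_form.zero_right)
    then have e1: "dd (\<lambda>z. G z Y (\<phi> z ?\<xi>)) y X + G y Y (\<phi> y (dd \<xi> y X)) = 0"
      using dd_linear_family[OF open_dom assms, of "\<lambda>z u. G z Y (\<phi> z u)" \<xi> X]
        linear_compose[OF linear_\<phi> pd_form.linear_right[OF pd], unfolded o_def] \<xi>1[OF assms]
        differentiable_metric[OF assms _ \<phi>1[OF assms]] by simp
    have "dd (\<lambda>z. G z (\<xi> z) (\<phi> z X)) y = dd (\<lambda>_. 0) y"
      by (rule dd_cong_open[OF open_dom assms]) (simp add: \<phi>_skew \<phi>\<xi> pd pd_form.zero_left)
    then have e2: "dd (\<lambda>z. G z ?\<xi> (\<phi> z X)) y Y + G y (dd \<xi> y Y) (\<phi> y X) = 0"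
      using dd_linear_family[OF open_dom assms, of "\<lambda>z u. G z u (\<phi> z X)" \<xi> Y]
        pd_form.linear_left[OF pd] \<xi>1[OF assms]
        differentiable_metric[OF assms _ \<phi>1[OF assms]] by simp
    have e3: "dd (\<lambda>z. G z X (\<phi> z Y)) y ?\<xi> =
        G y (?\<Gamma> ?\<xi> X) (\<phi> y Y) + G y X (dd (\<lambda>z. \<phi> z Y) y ?\<xi> + ?\<Gamma> ?\<xi> (\<phi> y Y))"
      using dd_metric[OF assms _ \<phi>1[OF assms], of "\<lambda>_. X" Y ?\<xi>] by simp
    have "G y X (N \<phi> y Y) = dd (\<lambda>z. G z X (\<phi> z Y)) y ?\<xi> - G y (?\<Gamma> ?\<xi> X) (\<phi> y Y) - G y X (\<phi> y (?\<Gamma> ?\<xi> Y))"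
      unfolding e3 N_def by (simp add: lin)
    also have "dd (\<lambda>z. G z X (\<phi> z Y)) y ?\<xi> = G y Y (\<phi> y (dd \<xi> y X)) + G y (dd \<xi> y Y) (\<phi> y X)"
      using \<Phi>_closed[OF assms, of X Y ?\<xi>] e1 e2 by linarith
    also have "G y Y (\<phi> y (dd \<xi> y X)) = - G y (dd \<xi> y X) (\<phi> y Y)"
      unfolding \<phi>_skew[OF assms, of Y] by (simp add: sym)
    also have "G y (dd \<xi> y Y) (\<phi> y X) = - G y X (\<phi> y (dd \<xi> y Y))"
      unfolding \<phi>_skew[OF assms, of "dd \<xi> y Y"] by (simp add: sym)
    finally have "G y X (N \<phi> y Y) = - G y (T y X) (\<phi> y Y) - G y X (\<phi> y (T y Y))"
      unfolding T_def christoffel_sym[OF assms, of _ ?\<xi>] by (simp add: lin lphi)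
    also have "\<dots> = - G y (S y X) (\<phi> y Y) + G y (\<phi> y X) (\<phi> y Y) - G y X (\<phi> y (S y Y)) + G y X (\<phi> y (\<phi> y Y))"
      by (simp add: S_def lin lphi)
    also have "\<dots> = - G y X (S y (\<phi> y Y)) - G y X (\<phi> y (S y Y))"
      using \<phi>_skew[OF assms, of X "\<phi> y Y"] S_sym[OF assms, of X "\<phi> y Y"] by linarith
    finally show ?thesis by (simp add: lin)
  qed
  then show ?thesis using sym nondegenerate by metis
qed

text \<open>Differentiate the formula for the square of \<phi> along \<xi>: its right side is
  parallel in that direction because \<xi> is geodesic.\<close>

lemma N_\<phi>\<phi>:
  assumes "y \<in> U"
  shows "N \<phi> y (\<phi> y X) + \<phi> y (N \<phi> y X) = 0"
proof -
  interpret pd_form "G y" by (rule pd[OF assms])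
  let ?\<xi> = "\<xi> y"
  have "N \<phi> y (\<phi> y X) + \<phi> y (N \<phi> y X) = N (\<lambda>z X. \<phi> z (\<phi> z X)) y X"
    by (rule N_compose[OF assms linear_\<phi> \<phi>1[OF assms] \<phi>1[OF assms], symmetric])
  also have "\<dots> = N (\<lambda>z X. - X + G z X (\<xi> z) *\<^sub>R \<xi> z) y X"
    by (rule N_cong[OF assms]) (rule \<phi>\<phi>)
  also have "\<dots> = 0"
  proof -
    have "dd (\<lambda>z. - X + G z X (\<xi> z) *\<^sub>R \<xi> z) y =
        (\<lambda>h. 0 + (G y X ?\<xi> *\<^sub>R dd \<xi> y h + dd (\<lambda>z. G z X (\<xi> z)) y h *\<^sub>R ?\<xi>))"
      by (intro dd_eqI has_derivative_add has_derivative_const has_derivative_scaleR has_derivative_dd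
          \<eta>1[OF assms] \<xi>1[OF assms])
    moreover have "dd \<xi> y ?\<xi> = - christoffel G y ?\<xi> ?\<xi>"
      using T_\<xi>[OF assms] unfolding T_def by (simp add: eq_neg_iff_add_eq_0)
    ultimately show ?thesis
      by (simp add: N_def dd_\<eta>[OF assms] T_\<xi>[OF assms] lin christoffel_lin[OF assms])
  qed
  finally show ?thesis .
qed

text \<open>Insert \<open>N_\<phi>_weak\<close> into \<open>N_\<phi>\<phi>\<close>: twice
  \<open>\<phi>S\<phi>\<close> plus S composed with the square of \<phi> on either side is zero.
  That square acts as -1 here, since \<open>S\<close> kills \<xi> and has its image orthogonal to
  \<xi>.\<close>

lemma \<phi>S\<phi>:
  assumes "y \<in> U"
  shows "\<phi> y (S y (\<phi> y X)) = S y X"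
proof -
  note l = linear_add[OF linear_\<phi>[OF assms]] linear_neg[OF linear_\<phi>[OF assms]]
    linear_add[OF linear_S[OF assms]] linear_neg[OF linear_S[OF assms]] linear_cmul[OF linear_S[OF assms]]
    linear_diff[OF linear_\<phi>[OF assms]] linear_diff[OF linear_S[OF assms]]
  have "2 *\<^sub>R \<phi> y (S y (\<phi> y X)) = 2 *\<^sub>R S y X"
    using N_\<phi>\<phi>[OF assms, of X] unfolding N_\<phi>_weak[OF assms]
    by (simp add: l \<phi>\<phi>[OF assms] S_\<xi>[OF assms] G_S_\<xi>[OF assms] scaleR_2 algebra_simps)
  then show ?thesis by simp
qed

lemma S\<phi>:
  assumes "y \<in> U"
  shows "S y (\<phi> y X) = - \<phi> y (S y X)"
proof -
  have "\<phi> y (S y X) = \<phi> y (\<phi> y (S y (\<phi> y X)))" by (simp add: \<phi>S\<phi>[OF assms])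
  then show ?thesis unfolding \<phi>\<phi>[OF assms] by (simp add: G_S_\<xi>[OF assms])
qed

lemma N_\<phi>: "y \<in> U \<Longrightarrow> N \<phi> y X = 0"
  by (simp add: N_\<phi>_weak S\<phi>)

text \<open>With the torsion-free connection the Lie derivative is \<open>N \<phi>\<close>, which is
  zero, plus the commutator of \<phi> with \<open>T\<close>. The part -\<phi> of \<open>T\<close>
  commutes with \<phi>, so only \<open>S\<close> contributes; halving gives h = \<phi>S.\<close>

lemma lie_\<phi>:
  assumes "y \<in> U"
  shows "bracket \<xi> (\<lambda>z. \<phi> z X) y - \<phi> y (bracket \<xi> (\<lambda>_. X) y) = 2 *\<^sub>R \<phi> y (S y X)"
proof -
  note l = linear_add[OF linear_\<phi>[OF assms]] linear_neg[OF linear_\<phi>[OF assms]]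
  have "bracket \<xi> (\<lambda>z. \<phi> z X) y - \<phi> y (bracket \<xi> (\<lambda>_. X) y) = N \<phi> y X - T y (\<phi> y X) + \<phi> y (T y X)"
    by (simp add: bracket_def N_def T_def l christoffel_sym[OF assms, of _ "\<xi> y"])
  also have "\<dots> = - S y (\<phi> y X) + \<phi> y (S y X)"
    by (simp add: N_\<phi>[OF assms] S_def l)
  finally show ?thesis by (simp add: S\<phi>[OF assms] scaleR_2)
qed

text \<open>The Riccati equation of the geodesic field \<xi> for the endomorphism
  \<open>T\<close>.\<close>

lemma curv_\<xi>_\<xi>:
  assumes "y \<in> U"
  shows "curv G y X (\<xi> y) (\<xi> y) = - N T y X - T y (T y X)"
proof -
  let ?\<Gamma> = "christoffel G y" and ?\<xi> = "\<xi> y" and ?d = "dd \<xi> y"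
  note ld = linear_add[OF linear_d\<xi>[OF assms]]
  note along = dd_christoffel_along[OF open_dom assms _ differentiable_ident]
  have "dd (\<lambda>z. T z (\<xi> z)) y = dd (\<lambda>_. 0) y"
    by (rule dd_cong_open[OF open_dom assms T_\<xi>])
  then have "dd (\<lambda>z. T z ?\<xi>) y X + T y (?d X) = 0"
    using dd_linear_family[OF open_dom assms linear_T T1[OF assms] \<xi>1[OF assms], of X] by simp
  moreover have dT: "dd (\<lambda>z. T z X) y h =
      dd (\<lambda>z. dd \<xi> z X) y h + (dd (\<lambda>q. christoffel G q X ?\<xi>) y h + ?\<Gamma> X (?d h))" for X h
  proof -
    have "dd (\<lambda>z. T z X) y = (\<lambda>h. dd (\<lambda>z. dd \<xi> z X) y h + dd (\<lambda>z. christoffel G z X (\<xi> z)) y h)"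
      unfolding T_def
      by (intro dd_eqI has_derivative_add has_derivative_dd \<xi>2[OF assms] \<xi>1[OF assms]
        differentiable_christoffel_along[OF open_dom assms _ differentiable_ident]) auto
    then show ?thesis
      using along[of "\<lambda>_. X" \<xi> h] \<xi>1[OF assms] by (simp add: christoffel_lin[OF assms])
  qed
  moreover have "dd (\<lambda>z. dd \<xi> z ?\<xi>) y X = dd (\<lambda>z. dd \<xi> z X) y ?\<xi>"
    by (rule second_derivative_symmetric[OF open_dom assms \<xi>1 \<xi>2[OF assms]])
  ultimately have e: "dd (\<lambda>q. christoffel G q ?\<xi> ?\<xi>) y X =
      - dd (\<lambda>z. dd \<xi> z X) y ?\<xi> - ?\<Gamma> ?\<xi> (?d X) - T y (?d X)"
    by (simp add: algebra_simps eq_neg_iff_add_eq_0)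
  have d\<xi>\<xi>: "?d ?\<xi> = - ?\<Gamma> ?\<xi> ?\<xi>"
    using T_\<xi>[OF assms] unfolding T_def by (simp add: eq_neg_iff_add_eq_0)
  show ?thesis
    unfolding curv_def e N_def dT d\<xi>\<xi>
    by (simp add: T_def ld christoffel_lin[OF assms] christoffel_sym[OF assms, of X ?\<xi>]
        christoffel_sym[OF assms, of "?d X" ?\<xi>] christoffel_sym[OF assms, of "?\<Gamma> ?\<xi> X" ?\<xi>])
qed

text \<open>Apply the Leibniz rule for \<open>N\<close> to \<open>\<phi>S\<phi> = S\<close>; the
  terms containing \<open>N \<phi>\<close> vanish.\<close>

lemma \<phi>_N_S_\<phi>:
  assumes "y \<in> U"
  shows "\<phi> y (N S y (\<phi> y X)) = N S y X"
proof -
  note l0 = linear_0[OF linear_S[OF assms]]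
  have d: "(\<lambda>z. S z (\<phi> z u)) differentiable (at y)" for u
    by (rule differentiable_linear_family[OF open_dom assms linear_S S1[OF assms] \<phi>1[OF assms]])
  have "N S y X = N (\<lambda>z X. \<phi> z (S z (\<phi> z X))) y X"
    by (rule N_cong[OF assms]) (simp add: \<phi>S\<phi>)
  also have "\<dots> = N \<phi> y (S y (\<phi> y X)) + \<phi> y (N (\<lambda>z X. S z (\<phi> z X)) y X)"
    by (rule N_compose[OF assms linear_\<phi> \<phi>1[OF assms] d])
  also have "N (\<lambda>z X. S z (\<phi> z X)) y X = N S y (\<phi> y X) + S y (N \<phi> y X)"
    by (rule N_compose[OF assms linear_S S1[OF assms] \<phi>1[OF assms]])
  finally show ?thesis by (simp add: N_\<phi>[OF assms] l0)
qed

lemma S_eq_0: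
  assumes "y \<in> U"
    and curv: "\<And>X. curv G y X (\<xi> y) (\<xi> y) = X - G y X (\<xi> y) *\<^sub>R \<xi> y + \<mu> *\<^sub>R \<phi> y (S y X)"
  shows "S y X = 0"
proof -
  interpret pd_form "G y" by (rule pd[OF assms(1)])
  note l = linear_add[OF linear_\<phi>[OF assms(1)]] linear_neg[OF linear_\<phi>[OF assms(1)]]
    linear_add[OF linear_S[OF assms(1)]] linear_neg[OF linear_S[OF assms(1)]]
    linear_diff[OF linear_\<phi>[OF assms(1)]] linear_diff[OF linear_S[OF assms(1)]]
    linear_cmul[OF linear_\<phi>[OF assms(1)]] linear_0[OF linear_\<phi>[OF assms(1)]]
  have NT: "N T y X = N S y X" for X
  proof -
    have "N S y X = N (\<lambda>z X. T z X + \<phi> z X) y X" by (rule N_cong[OF assms(1)]) (rule S_def)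
    then show ?thesis using N_add[OF assms(1) T1[OF assms(1)] \<phi>1[OF assms(1)], where X=X]
      by (simp add: N_\<phi>[OF assms(1)])
  qed
  have T: "T y X = S y X - \<phi> y X" for X by (simp add: S_def)
  have e: "N S y X + S y (S y X) + \<mu> *\<^sub>R \<phi> y (S y X) = 0" for X
    using curv[of X] unfolding curv_\<xi>_\<xi>[OF assms(1)] NT T
    by (simp add: l S\<phi>[OF assms(1)] \<phi>\<phi>[OF assms(1)] algebra_simps)
  \<comment> \<open>Conjugating \<open>e\<close> by \<phi> keeps the first and the last term and
    changes the sign of the middle one, so subtraction isolates it.\<close>
  have "\<phi> y (N S y (\<phi> y X) + S y (S y (\<phi> y X)) + \<mu> *\<^sub>R \<phi> y (S y (\<phi> y X))) = 0"
    unfolding e by (simp add: l)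
  then have "N S y X - S y (S y X) + \<mu> *\<^sub>R \<phi> y (S y X) = 0"
    by (simp add: l \<phi>_N_S_\<phi>[OF assms(1)] S\<phi>[OF assms(1)] \<phi>S\<phi>[OF assms(1)] \<phi>\<phi>[OF assms(1)] G_S_\<xi>[OF assms(1)])
  then have "N S y X + S y (S y X) + \<mu> *\<^sub>R \<phi> y (S y X) - (N S y X - S y (S y X) + \<mu> *\<^sub>R \<phi> y (S y X)) = 0"
    using e[of X] by simp
  then have "2 *\<^sub>R S y (S y X) = 0" by (simp add: scaleR_2)
  then have "S y (S y X) = 0" by simp
  \<comment> \<open>Symmetry moves one factor across, and the definite metric then forces
    \<open>S y X\<close> itself to vanish.\<close>
  then have "G y (S y X) (S y X) = 0" using S_sym[OF assms(1), of X "S y X"] by (simp add: lin)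
  then show ?thesis by (simp add: self_eq_0_iff)
qed

end

section \<open>Contact metric manifolds\<close>

locale manifold =
  fixes A :: "('a::{t2_space, second_countable_topology}, 'e::euclidean_space) chart set"
  assumes atlas: "smooth_atlas A"
begin

lemma is_chart: "c \<in> A \<Longrightarrow> is_chart c"
  using atlas by (auto simp: smooth_atlas_def)

lemma open_chart: "c \<in> A \<Longrightarrow> open (fst c)"
  using is_chart by (auto simp: is_chart_def)

lemma open_chart_image: "c \<in> A \<Longrightarrow> open (chart_image c)"
  using is_chart by (auto simp: is_chart_def)

lemma chart_at: "chart_at A p \<in> A" "p \<in> fst (chart_at A p)"
proof -
  have "p \<in> (\<Union>c\<in>A. fst c)" using atlas by (simp add: smooth_atlas_def)
  then have "\<exists>c. c \<in> A \<and> p \<in> fst c" by blast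
  from someI_ex[OF this] show "chart_at A p \<in> A" "p \<in> fst (chart_at A p)"
    by (auto simp: chart_at_def)
qed

lemma inv_coords_coords: "c \<in> A \<Longrightarrow> q \<in> fst c \<Longrightarrow> inv_coords c (coords c q) = q"
  using is_chart by (auto simp: is_chart_def homeomorphism_def)

lemma coords_inv_coords: "c \<in> A \<Longrightarrow> x \<in> chart_image c \<Longrightarrow> coords c (inv_coords c x) = x"
  using is_chart by (auto simp: is_chart_def homeomorphism_def)

lemma inv_coords_mem: "c \<in> A \<Longrightarrow> x \<in> chart_image c \<Longrightarrow> inv_coords c x \<in> fst c"
  using is_chart[of c] unfolding is_chart_def homeomorphism_def by blast

lemma coords_mem: "q \<in> fst c \<Longrightarrow> coords c q \<in> chart_image c"
  by (simp add: chart_image_def)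

lemma open_coords_image:
  assumes "c \<in> A" "open T"
  shows "open (coords c ` (fst c \<inter> T))"
proof -
  have h: "homeomorphism (fst c) (chart_image c) (coords c) (inv_coords c)"
    using is_chart[OF assms(1)] by (simp add: is_chart_def)
  have "openin (top_of_set (fst c)) (fst c \<inter> T)" using assms(2) by auto
  from homeomorphism_imp_open_map[OF h this] show ?thesis
    using open_chart_image[OF assms(1)] openin_open_trans by blast
qed

lemma coords_image_iff:
  assumes "c \<in> A"
  shows "x \<in> coords c ` (fst c \<inter> T) \<longleftrightarrow> x \<in> chart_image c \<and> inv_coords c x \<in> T"
  using inv_coords_coords[OF assms] coords_inv_coords[OF assms] inv_coords_mem[OF assms]
  by (auto simp: chart_image_def image_iff)

lemma smooth_transition:
  assumes "c \<in> A" "d \<in> A"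
  shows "smooth_on (coords c ` (fst c \<inter> fst d)) (coords d \<circ> inv_coords c)"
  using atlas assms by (simp add: smooth_atlas_def)

lemma transition_differentiable:
  assumes "c \<in> A" "d \<in> A" "q \<in> fst c" "q \<in> fst d"
  shows "(coords d \<circ> inv_coords c) differentiable (at (coords c q))"
  using smooth_on_differentiable[OF smooth_transition[OF assms(1,2)]] assms(3,4) by blast

lemma linear_tangent_change:
  assumes "c \<in> A" "d \<in> A" "q \<in> fst c" "q \<in> fst d"
  shows "linear (tangent_change c d q)"
  unfolding tangent_change_def by (rule linear_dd[OF transition_differentiable[OF assms]])

lemma tangent_change_self:
  assumes "c \<in> A" "q \<in> fst c"
  shows "tangent_change c c q u = u"
proof -
  have "dd (coords c \<circ> inv_coords c) (coords c q) = dd (\<lambda>x. x) (coords c q)"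
    by (rule dd_cong_open[OF open_chart_image[OF assms(1)] coords_mem[OF assms(2)]])
      (simp add: coords_inv_coords[OF assms(1)])
  then show ?thesis by (simp add: tangent_change_def)
qed

lemma tangent_change_trans:
  assumes "b \<in> A" "c \<in> A" "d \<in> A" "q \<in> fst b" "q \<in> fst c" "q \<in> fst d"
  shows "tangent_change c d q (tangent_change b c q u) = tangent_change b d q u"
proof -
  let ?T = "fst c \<inter> fst d"
  have "dd (coords d \<circ> inv_coords b) (coords b q) =
      dd (\<lambda>x. (coords d \<circ> inv_coords c) ((coords c \<circ> inv_coords b) x)) (coords b q)"
  proof (rule dd_cong_open)
    show "open (coords b ` (fst b \<inter> ?T))"
      by (intro open_coords_image open_Int open_chart assms)
    show "coords b q \<in> coords b ` (fst b \<inter> ?T)" using assms by blast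
    fix x assume "x \<in> coords b ` (fst b \<inter> ?T)"
    then have "inv_coords b x \<in> fst c" using coords_image_iff[OF assms(1)] by blast
    then show "(coords d \<circ> inv_coords b) x = (coords d \<circ> inv_coords c) ((coords c \<circ> inv_coords b) x)"
      by (simp add: inv_coords_coords[OF assms(2)])
  qed
  moreover have "(coords c \<circ> inv_coords b) (coords b q) = coords c q"
    by (simp add: inv_coords_coords assms)
  ultimately show ?thesis
    unfolding tangent_change_def
    using dd_compose[of "coords d \<circ> inv_coords c" "coords c \<circ> inv_coords b" "coords b q" u]
      transition_differentiable assms by (simp add: o_def)
qed

lemma tangent_change_inverse:
  assumes "c \<in> A" "d \<in> A" "q \<in> fst c" "q \<in> fst d"
  shows "tangent_change d c q (tangent_change c d q u) = u"
  using tangent_change_trans[OF assms(1,2,1,3,4,3)] tangent_change_self[OF assms(1,3)] by simp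

text \<open>In the chart chosen at \<open>p\<close> the change of coordinates at \<open>p\<close> is
  the identity. This is the link between the tensors at a point and their coordinate fields.\<close>

lemma rep_at:
  assumes "c = chart_at A p"
  shows "metric_rep A c g (coords c p) u v = g p u v"
    and "vec_rep A c X (coords c p) = X p"
    and "endo_rep A c \<Phi> (coords c p) u = \<Phi> p u"
  using chart_at[of p] inv_coords_coords[of c p] tangent_change_self[of c p] assms
  by (simp_all add: metric_rep_def vec_rep_def endo_rep_def Let_def)

lemma metric_on_rep:
  assumes "riemannian_metric A g" "c \<in> A"
  shows "metric_on (chart_image c) (metric_rep A c g)"
proof
  have s: "smooth_on (chart_image c) (\<lambda>x. metric_rep A c g x u v)" for u v
    using assms by (simp add: riemannian_metric_def)
  show "open (chart_image c)" by (rule open_chart_image[OF assms(2)])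
  fix x assume x: "x \<in> chart_image c"
  show "(\<lambda>x. metric_rep A c g x u v) differentiable (at x)" for u v
    by (rule smooth_on_differentiable[OF s x])
  show "(\<lambda>y. dd (\<lambda>z. metric_rep A c g z u v) y w) differentiable (at x)" for u v w
    by (rule smooth_on_differentiable[OF smooth_on_dd[OF s] x])
  define q where "q = inv_coords c x"
  let ?P = "tangent_change c (chart_at A q) q"
  have q: "q \<in> fst c" using inv_coords_mem[OF assms(2) x] by (simp add: q_def)
  have l: "linear ?P" by (rule linear_tangent_change[OF assms(2) chart_at(1) q chart_at(2)])
  have e: "metric_rep A c g x u v = g q (?P u) (?P v)" for u v
    by (simp add: metric_rep_def q_def Let_def)
  have g: "bilinear (g q)" "g q u v = g q v u" "u \<noteq> 0 \<Longrightarrow> 0 < g q u u" for u v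
    using assms(1) by (auto simp: riemannian_metric_def)
  show "bilinear (metric_rep A c g x)"
    unfolding bilinear_def e
    by (auto intro!: linearI simp: linear_add[OF l] linear_cmul[OF l] bilinear_ladd[OF g(1)]
      bilinear_radd[OF g(1)] bilinear_lmul[OF g(1)] bilinear_rmul[OF g(1)])
  show "metric_rep A c g x u v = metric_rep A c g x v u" for u v unfolding e by (rule g(2))
  show "0 < metric_rep A c g x u u" if "u \<noteq> 0" for u
    unfolding e
  proof (rule g(3))
    show "?P u \<noteq> 0"
      using tangent_change_inverse[OF assms(2) chart_at(1) q chart_at(2), of u] that
        linear_0[OF linear_tangent_change[OF chart_at(1) assms(2) chart_at(2) q]] by force
  qed
qed

end

text \<open>Naturality of the exterior derivative: the terms with second derivatives of
  \<open>\<psi>\<close> are symmetric and drop out. It is applied to changes of coordinates, and to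
  the immersion with pulled back form 0.\<close>

lemma pullback_exterior_derivative:
  fixes \<psi> :: "'x::euclidean_space \<Rightarrow> 'y::euclidean_space"
  assumes W: "open W" "x \<in> W" and \<psi>1: "\<And>z. z \<in> W \<Longrightarrow> \<psi> differentiable (at z)"
    and \<psi>2: "\<And>v. (\<lambda>z. dd \<psi> z v) differentiable (at x)"
    and \<omega>: "\<And>z. z \<in> W \<Longrightarrow> linear (\<omega> (\<psi> z))" "\<And>u. (\<lambda>y. \<omega> y u) differentiable (at (\<psi> x))"
    and \<theta>: "\<And>z u. z \<in> W \<Longrightarrow> \<theta> z u = \<omega> (\<psi> z) (dd \<psi> z u)"
  shows "dd (\<lambda>z. \<theta> z Y) x X - dd (\<lambda>z. \<theta> z X) x Y =
    dd (\<lambda>y. \<omega> y (dd \<psi> x Y)) (\<psi> x) (dd \<psi> x X) - dd (\<lambda>y. \<omega> y (dd \<psi> x X)) (\<psi> x) (dd \<psi> x Y)"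
proof -
  have e: "dd (\<lambda>z. \<theta> z Y) x X = dd (\<lambda>y. \<omega> y (dd \<psi> x Y)) (\<psi> x) (dd \<psi> x X)
      + \<omega> (\<psi> x) (dd (\<lambda>z. dd \<psi> z Y) x X)" for X Y
  proof -
    have "dd (\<lambda>z. \<theta> z Y) x X = dd (\<lambda>z. \<omega> (\<psi> z) (dd \<psi> z Y)) x X"
      using dd_cong_open[OF W, of "\<lambda>z. \<theta> z Y" "\<lambda>z. \<omega> (\<psi> z) (dd \<psi> z Y)"] \<theta> by simp
    also have "\<dots> = dd (\<lambda>z. \<omega> (\<psi> z) (dd \<psi> x Y)) x X + \<omega> (\<psi> x) (dd (\<lambda>z. dd \<psi> z Y) x X)"
      by (rule dd_linear_family[OF W, of "\<lambda>z. \<omega> (\<psi> z)"])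
        (intro \<omega>(1) differentiable_compose'[where f="\<lambda>y. \<omega> y _" and g=\<psi>] \<omega>(2) \<psi>1[OF W(2)] \<psi>2 | assumption)+
    also have "dd (\<lambda>z. \<omega> (\<psi> z) (dd \<psi> x Y)) x X = dd (\<lambda>y. \<omega> y (dd \<psi> x Y)) (\<psi> x) (dd \<psi> x X)"
      by (rule dd_compose[OF \<omega>(2) \<psi>1[OF W(2)]])
    finally show ?thesis .
  qed
  have "dd (\<lambda>z. dd \<psi> z Y) x X = dd (\<lambda>z. dd \<psi> z X) x Y"
    by (rule second_derivative_symmetric[OF W \<psi>1 \<psi>2])
  then show ?thesis unfolding e by simp
qed

section \<open>The contact structure in charts and the vanishing of h\<close>

locale contact_manifold = manifold A
  for A :: "('a::{t2_space, second_countable_topology}, 'e::euclidean_space) chart set" +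
  fixes \<phi> :: "'a \<Rightarrow> 'e \<Rightarrow> 'e" and \<xi> :: "'a \<Rightarrow> 'e" and \<eta> :: "'a \<Rightarrow> 'e \<Rightarrow> real"
    and g :: "'a \<Rightarrow> 'e \<Rightarrow> 'e \<Rightarrow> real"
  assumes contact_metric: "contact_metric A \<phi> \<xi> \<eta> g"
begin

lemma acm: "almost_contact_metric A \<phi> \<xi> \<eta> g"
  using contact_metric by (simp add: contact_metric_def)

lemma metric: "riemannian_metric A g"
  using acm by (simp add: almost_contact_metric_def)

text \<open>The algebraic axioms are transported pointwise by the mutually inverse tangent maps
  \<open>?P\<close> and \<open>?Q\<close>. Only the contact condition involves derivatives: at the
  point \<open>q\<close> it is stated in the chart \<open>d\<close> chosen there, and has to be
  pulled back to the fixed chart \<open>c\<close>.\<close>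

lemma contact_rep:
  assumes "c \<in> A"
  shows "contact_local (chart_image c) (metric_rep A c g) (endo_rep A c \<phi>) (vec_rep A c \<xi>)"
proof -
  note acm' = acm[unfolded almost_contact_metric_def smooth_one_form_def smooth_endo_field_def
      smooth_vector_field_def]
  interpret metric_on "chart_image c" "metric_rep A c g" by (rule metric_on_rep[OF metric assms])
  have s\<phi>: "smooth_on (chart_image c) (\<lambda>x. endo_rep A c \<phi> x u)" for u
    using acm' assms by blast
  have s\<xi>: "smooth_on (chart_image c) (vec_rep A c \<xi>)"
    using acm' assms by blast
  have \<phi>: "linear (\<phi> q)" "\<phi> q (\<phi> q X) = - X + \<eta> q X *\<^sub>R \<xi> q" "\<eta> q (\<xi> q) = 1"
    "\<phi> q (\<xi> q) = 0" "g q X (\<xi> q) = \<eta> q X" "g q X (\<phi> q Y) = - g q (\<phi> q X) Y" "linear (\<eta> q)" for q X Y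
    using acm' by blast+
  show ?thesis
  proof (intro contact_local.intro contact_local_axioms.intro metric_on_axioms)
    fix x assume x: "x \<in> chart_image c"
    define q where "q = inv_coords c x"
    define d where "d = chart_at A q"
    have q: "q \<in> fst c" using inv_coords_mem[OF assms x] by (simp add: q_def)
    have d: "d \<in> A" "q \<in> fst d" unfolding d_def by (rule chart_at)+
    have xq: "coords c q = x" unfolding q_def by (rule coords_inv_coords[OF assms x])
    let ?P = "tangent_change c d q" and ?Q = "tangent_change d c q"
    have PQ: "?P (?Q u) = u" "?Q (?P u) = u" for u
      by (rule tangent_change_inverse[OF d(1) assms d(2) q] tangent_change_inverse[OF assms d(1) q d(2)])+
    have P: "linear ?P" by (rule linear_tangent_change[OF assms d(1) q d(2)])
    have Q: "linear ?Q" by (rule linear_tangent_change[OF d(1) assms d(2) q])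
    note lQ = linear_add[OF Q] linear_neg[OF Q] linear_cmul[OF Q] linear_0[OF Q] linear_diff[OF Q]
    have rm: "metric_rep A c g x u v = g q (?P u) (?P v)" for u v
      by (simp add: metric_rep_def q_def d_def Let_def)
    have rv: "vec_rep A c \<xi> x = ?Q (\<xi> q)"
      by (simp add: vec_rep_def q_def d_def Let_def)
    have re: "endo_rep A c \<phi> x u = ?Q (\<phi> q (?P u))" for u
      by (simp add: endo_rep_def q_def d_def Let_def)
    show "linear (endo_rep A c \<phi> x)"
      unfolding re by (intro linear_compose[OF P, unfolded o_def] linear_compose[OF _ Q, unfolded o_def]
        linear_compose[OF _ \<phi>(1), unfolded o_def] P)
    show "(\<lambda>z. endo_rep A c \<phi> z u) differentiable (at x)" for u
      by (rule smooth_on_differentiable[OF s\<phi> x])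
    show "vec_rep A c \<xi> differentiable (at x)"
      by (rule smooth_on_differentiable[OF s\<xi> x])
    show "(\<lambda>z. dd (vec_rep A c \<xi>) z v) differentiable (at x)" for v
      by (rule smooth_on_differentiable[OF smooth_on_dd[OF s\<xi>] x])
    show "endo_rep A c \<phi> x (endo_rep A c \<phi> x X) = - X + metric_rep A c g x X (vec_rep A c \<xi> x) *\<^sub>R vec_rep A c \<xi> x" for X
      unfolding re rm rv PQ by (simp add: \<phi> lQ PQ)
    show "metric_rep A c g x (vec_rep A c \<xi> x) (vec_rep A c \<xi> x) = 1"
      unfolding rm rv PQ by (simp add: \<phi>)
    show "endo_rep A c \<phi> x (vec_rep A c \<xi> x) = 0"
      unfolding re rv PQ by (simp add: \<phi> lQ)
    show "metric_rep A c g x X (endo_rep A c \<phi> x Y) = - metric_rep A c g x (endo_rep A c \<phi> x X) Y" for X Y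
      unfolding re rm PQ by (rule \<phi>)
    have form: "form_rep A b \<eta> z X = \<eta> r (tangent_change b (chart_at A r) r X)"
      if "r = inv_coords b z" for b z X r
      using that by (simp add: form_rep_def Let_def)
    show "dd (\<lambda>z. metric_rep A c g z Y (vec_rep A c \<xi> z)) x X - dd (\<lambda>z. metric_rep A c g z X (vec_rep A c \<xi> z)) x Y
        = 2 * metric_rep A c g x X (endo_rep A c \<phi> x Y)" for X Y
    proof -
      let ?W = "coords c ` (fst c \<inter> fst d)" and ?\<psi> = "coords d \<circ> inv_coords c"
      have W: "open ?W" by (intro open_coords_image assms open_chart d)
      have xW: "x \<in> ?W" using q d xq by blast
      have \<psi>x: "?\<psi> x = coords d q" by (simp add: q_def)
      have \<psi>': "dd ?\<psi> x = ?P" by (simp add: tangent_change_def xq)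
      \<comment> \<open>On the overlap, the contact form in chart \<open>c\<close> is the pullback
        of its representative in chart \<open>d\<close>, by the cocycle rule for tangent
        changes.\<close>
      have \<theta>: "metric_rep A c g z X (vec_rep A c \<xi> z) = form_rep A d \<eta> (?\<psi> z) (dd ?\<psi> z X)"
        if "z \<in> ?W" for z X
      proof -
        define r where "r = inv_coords c z"
        have r: "r \<in> fst c" "r \<in> fst d" "coords c r = z"
          using that coords_image_iff[OF assms] inv_coords_mem[OF assms] coords_inv_coords[OF assms]
          by (auto simp: r_def)
        have i: "inv_coords d (coords d r) = r" by (rule inv_coords_coords[OF d(1) r(2)])
        have "metric_rep A c g z X (vec_rep A c \<xi> z) = \<eta> r (tangent_change c (chart_at A r) r X)"
          using tangent_change_inverse[OF chart_at(1) assms chart_at(2) r(1)]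
          by (simp add: metric_rep_def vec_rep_def r_def[symmetric] \<phi> Let_def)
        also have "\<dots> = \<eta> r (tangent_change d (chart_at A r) r (tangent_change c d r X))"
          using tangent_change_trans[OF assms d(1) chart_at(1) r(1,2) chart_at(2)] by simp
        also have "\<dots> = form_rep A d \<eta> (?\<psi> z) (dd ?\<psi> z X)"
          using form[of r d "coords d r"] i
          by (simp add: tangent_change_def[of c d] r r_def[symmetric])
        finally show ?thesis .
      qed
      have "dd (\<lambda>z. metric_rep A c g z Y (vec_rep A c \<xi> z)) x X - dd (\<lambda>z. metric_rep A c g z X (vec_rep A c \<xi> z)) x Y
          = dd (\<lambda>y. form_rep A d \<eta> y (?P Y)) (coords d q) (?P X) - dd (\<lambda>y. form_rep A d \<eta> y (?P X)) (coords d q) (?P Y)"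
      proof -
        have lin: "linear (form_rep A d \<eta> (?\<psi> z))" if "z \<in> ?W" for z
        proof -
          have "inv_coords c z \<in> fst d" using that coords_image_iff[OF assms] by blast
          then have r: "inv_coords d (?\<psi> z) \<in> fst d" by (simp add: inv_coords_coords[OF d(1)])
          show ?thesis unfolding form[OF refl]
            by (rule linear_compose[OF _ \<phi>(7), unfolded o_def])
              (rule linear_tangent_change[OF d(1) chart_at(1) r chart_at(2)])
        qed
        have sf: "smooth_on (chart_image d) (\<lambda>y. form_rep A d \<eta> y u)" for u
          using acm' d(1) by blast
        have dx: "?\<psi> x \<in> chart_image d" unfolding \<psi>x by (rule coords_mem[OF d(2)])
        note s\<psi> = smooth_transition[OF assms d(1)]
        show ?thesis
          using pullback_exterior_derivative[OF W xW smooth_on_differentiable[OF s\<psi>]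
            smooth_on_differentiable[OF smooth_on_dd[OF s\<psi>] xW] lin smooth_on_differentiable[OF sf dx] \<theta>, where X=X and Y=Y]
          unfolding \<psi>x \<psi>' by simp
      qed
      also have "\<dots> = 2 * ext_deriv A \<eta> q (?P X) (?P Y)"
        by (simp add: ext_deriv_def d_def Let_def)
      also have "\<dots> = 2 * g q (?P X) (\<phi> q (?P Y))"
        using contact_metric by (simp add: contact_metric_def)
      also have "\<dots> = 2 * metric_rep A c g x X (endo_rep A c \<phi> x Y)"
        unfolding rm re PQ ..
      finally show ?thesis .
    qed
  qed
qed

text \<open>Take Y = Z = \<xi>. Since h\<xi> = 0, \<phi>\<xi> = 0 and hX is orthogonal to \<xi>, the
  \<open>R2\<close>, \<open>R51\<close> and \<open>R52\<close> terms vanish, \<open>R4\<close> gives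
  hX and \<open>R6\<close> gives -hX; \<open>R1\<close> and \<open>R3\<close> give opposite
  multiples of X - \<eta>(X)\<xi>. This is the curvature hypothesis of \<open>S_eq_0\<close> with
  \<mu> = f4 - f6.\<close>

lemma h_tensor_0:
  assumes "\<And>X Y Z. riemann A g p X Y Z =
        f1 *\<^sub>R R1 (g p) X Y Z
        + f2 *\<^sub>R R2 (g p) (\<phi> p) X Y Z
        + (f1 - 1) *\<^sub>R R3 (g p) (\<xi> p) (\<eta> p) X Y Z
        + f4 *\<^sub>R R4 (g p) (h_tensor A \<phi> \<xi> p) X Y Z
        + f51 *\<^sub>R R51 (g p) (h_tensor A \<phi> \<xi> p) X Y Z
        + f52 *\<^sub>R R52 (g p) (\<phi> p) (h_tensor A \<phi> \<xi> p) X Y Z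
        + f6 *\<^sub>R R6 (g p) (\<xi> p) (\<eta> p) (h_tensor A \<phi> \<xi> p) X Y Z"
  shows "h_tensor A \<phi> \<xi> p X = 0"
proof -
  let ?c = "chart_at A p"
  let ?G = "metric_rep A ?c g" and ?x = "coords ?c p"
  interpret L: contact_local "chart_image ?c" ?G "endo_rep A ?c \<phi>" "vec_rep A ?c \<xi>"
    by (rule contact_rep[OF chart_at(1)])
  have x: "?x \<in> chart_image ?c" by (rule coords_mem[OF chart_at(2)])
  note r = rep_at[OF refl]
  have Gp: "?G ?x = g p" and \<phi>p: "endo_rep A ?c \<phi> ?x = \<phi> p"
    by (intro ext r)+
  interpret pd_form "g p"
    using L.pd[OF x] unfolding Gp .
  have l\<phi>: "linear (\<phi> p)" using L.linear_\<phi>[OF x] unfolding \<phi>p .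
  have h: "h_tensor A \<phi> \<xi> p X = \<phi> p (L.S ?x X)" for X
    unfolding h_tensor_def lie_deriv_endo_def Let_def L.lie_\<phi>[OF x] by (simp add: r)
  note acm' = acm[unfolded almost_contact_metric_def]
  have \<eta>: "g p X (\<xi> p) = \<eta> p X" for X using acm' by blast
  have "\<eta> p (\<xi> p) = 1" "\<phi> p (\<xi> p) = 0" using acm' by blast+
  then have \<phi>: "\<eta> p X = g p X (\<xi> p)" "g p (\<xi> p) (\<xi> p) = 1" "\<phi> p (\<xi> p) = 0" for X
    by (simp_all add: \<eta>)
  have h\<xi>: "h_tensor A \<phi> \<xi> p (\<xi> p) = 0"
    using L.S_\<xi>[OF x] unfolding h r by (simp add: linear_0[OF l\<phi>])
  have gh\<xi>: "g p (\<phi> p X) (\<xi> p) = 0" for X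
    unfolding \<eta> using acm' by blast
  have "curv ?G ?x X (\<xi> p) (\<xi> p) = X - g p X (\<xi> p) *\<^sub>R \<xi> p + (f4 - f6) *\<^sub>R \<phi> p (L.S ?x X)" for X
  proof -
    have "curv ?G ?x X (\<xi> p) (\<xi> p) = riemann A g p X (\<xi> p) (\<xi> p)"
      unfolding riemann_def using L.curvature_op_const[OF x] by simp
    also have "\<dots> = X - g p X (\<xi> p) *\<^sub>R \<xi> p + (f4 - f6) *\<^sub>R h_tensor A \<phi> \<xi> p X"
      unfolding assms R1_def R2_def R3_def R4_def R51_def R52_def R6_def
      by (simp add: \<phi> h\<xi> zero_left zero_right algebra_simps) (simp add: h gh\<xi> algebra_simps)
    finally show ?thesis by (simp add: h)
  qed
  then have "L.S ?x X = 0" for X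
    by (intro L.S_eq_0[OF x, where \<mu>="f4 - f6"]) (simp add: r)
  then show ?thesis by (simp add: h linear_0[OF l\<phi>])
qed

end

section \<open>Immersions\<close>

lemma christoffel_cong_open:
  assumes "open W" "x \<in> W" "\<And>y. y \<in> W \<Longrightarrow> G y = G' y"
  shows "christoffel G x = christoffel G' x"
proof -
  have "dd (\<lambda>y. G y u v) x = dd (\<lambda>y. G' y u v) x" for u v
    by (rule dd_cong_open[OF assms(1,2)]) (simp add: assms(3))
  then show ?thesis using assms(3)[OF assms(2)] unfolding christoffel_def by simp
qed

text \<open>The coordinate metric of the submanifold agrees with \<open>GM\<close> only where the
  immersion stays in one ambient chart, so the curvature must be seen to depend on the germ of the
  metric alone.\<close>

lemma curvature_op_const_cong_open:
  assumes "open W" "x \<in> W" "\<And>y. y \<in> W \<Longrightarrow> G y = G' y"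
  shows "curvature_op G (\<lambda>_. X) (\<lambda>_. Y) (\<lambda>_. Z) x = curvature_op G' (\<lambda>_. X) (\<lambda>_. Y) (\<lambda>_. Z) x"
proof -
  have chr: "christoffel G y = christoffel G' y" if "y \<in> W" for y
    by (rule christoffel_cong_open[OF assms(1) that assms(3)])
  have nab: "nabla G (\<lambda>_. Y) (\<lambda>_. Z) y = nabla G' (\<lambda>_. Y) (\<lambda>_. Z) y" if "y \<in> W" for y Y Z
    by (simp add: nabla_def chr[OF that])
  have "dd (nabla G (\<lambda>_. Y) (\<lambda>_. Z)) x = dd (nabla G' (\<lambda>_. Y) (\<lambda>_. Z)) x" for Y Z
    by (rule dd_cong_open[OF assms(1,2) nab])
  then show ?thesis
    unfolding curvature_op_def nabla_def[of _ "\<lambda>_. X" "nabla _ _ _"] nabla_def[of _ "\<lambda>_. Y" "nabla _ _ _"]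
      nab[OF assms(2)] nabla_def[of _ "bracket _ _"] chr[OF assms(2)] by simp
qed

locale riemannian_immersion = A: manifold A + B: manifold B
  for A :: "('a::{t2_space, second_countable_topology}, 'e::euclidean_space) chart set"
    and B :: "('b::{t2_space, second_countable_topology}, 'd::euclidean_space) chart set" +
  fixes g :: "'a \<Rightarrow> 'e \<Rightarrow> 'e \<Rightarrow> real" and \<iota> :: "'b \<Rightarrow> 'a"
  assumes metric: "riemannian_metric A g" and immersion: "smooth_immersion B A \<iota>"
begin

lemma open_preimage:
  assumes "d \<in> A"
  shows "open (\<iota> -` fst d)"
proof (rule open_vimage[OF A.open_chart[OF assms]])
  show "continuous_on UNIV \<iota>" using immersion by (simp add: smooth_immersion_def)
qed

lemma smooth_map_rep:
  "c \<in> B \<Longrightarrow> d \<in> A \<Longrightarrow> smooth_on (coords c ` (fst c \<inter> \<iota> -` fst d)) (map_rep c d \<iota>)"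
  using immersion by (simp add: smooth_immersion_def)

lemma map_rep_differentiable:
  assumes "c \<in> B" "d \<in> A" "q \<in> fst c" "\<iota> q \<in> fst d"
  shows "map_rep c d \<iota> differentiable (at (coords c q))"
  by (rule smooth_on_differentiable[OF smooth_map_rep[OF assms(1,2)]]) (use assms in auto)

lemma map_rep_coords:
  assumes "c \<in> B" "q \<in> fst c"
  shows "map_rep c d \<iota> (coords c q) = coords d (\<iota> q)"
  using B.inv_coords_coords[OF assms] by (simp add: map_rep_def)

lemma dd_map_rep_target:
  assumes "c \<in> B" "d \<in> A" "d' \<in> A" "q \<in> fst c" "\<iota> q \<in> fst d" "\<iota> q \<in> fst d'"
  shows "dd (map_rep c d' \<iota>) (coords c q) u
    = tangent_change d d' (\<iota> q) (dd (map_rep c d \<iota>) (coords c q) u)"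
proof -
  let ?W = "coords c ` (fst c \<inter> (\<iota> -` fst d \<inter> \<iota> -` fst d'))"
  have "dd (map_rep c d' \<iota>) (coords c q) =
      dd (\<lambda>y. (coords d' \<circ> inv_coords d) (map_rep c d \<iota> y)) (coords c q)"
  proof (rule dd_cong_open)
    show "open ?W" by (intro B.open_coords_image open_Int open_preimage assms)
    show "coords c q \<in> ?W" using assms by blast
    fix y assume "y \<in> ?W"
    then obtain r where r: "r \<in> fst c" "\<iota> r \<in> fst d" "y = coords c r" by blast
    show "map_rep c d' \<iota> y = (coords d' \<circ> inv_coords d) (map_rep c d \<iota> y)"
      using r assms by (simp add: map_rep_coords A.inv_coords_coords)
  qed
  then show ?thesis
    using dd_compose[of "coords d' \<circ> inv_coords d" "map_rep c d \<iota>" "coords c q" u]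
      A.transition_differentiable[OF assms(2,3,5,6)] map_rep_differentiable[OF assms(1,2,4,5)]
    by (simp add: tangent_change_def map_rep_coords[OF assms(1,4)])
qed

lemma dd_map_rep_source:
  assumes "c \<in> B" "c' \<in> B" "d \<in> A" "q \<in> fst c" "q \<in> fst c'" "\<iota> q \<in> fst d"
  shows "dd (map_rep c d \<iota>) (coords c q) u
    = dd (map_rep c' d \<iota>) (coords c' q) (tangent_change c c' q u)"
proof -
  let ?W = "coords c ` (fst c \<inter> fst c')"
  have "dd (map_rep c d \<iota>) (coords c q) =
      dd (\<lambda>y. map_rep c' d \<iota> ((coords c' \<circ> inv_coords c) y)) (coords c q)"
  proof (rule dd_cong_open)
    show "open ?W" by (intro B.open_coords_image B.open_chart assms)
    show "coords c q \<in> ?W" using assms by blast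
    fix y assume "y \<in> ?W"
    then obtain r where r: "r \<in> fst c" "r \<in> fst c'" "y = coords c r" by blast
    show "map_rep c d \<iota> y = map_rep c' d \<iota> ((coords c' \<circ> inv_coords c) y)"
      using r assms by (simp add: map_rep_coords B.inv_coords_coords)
  qed
  then show ?thesis
    using dd_compose[of "map_rep c' d \<iota>" "coords c' \<circ> inv_coords c" "coords c q" u]
      B.transition_differentiable[OF assms(1,2,4,5)] map_rep_differentiable[OF assms(2,3,5,6)]
    by (simp add: tangent_change_def B.inv_coords_coords[OF assms(1,4)])
qed

text \<open>The differential at \<open>q\<close> is taken in the charts chosen at \<open>q\<close>,
  which may vary with \<open>q\<close>; this expresses it through one fixed local
  representative.\<close>

lemma differential_rep:
  assumes "c \<in> B" "d \<in> A" "q \<in> fst c" "\<iota> q \<in> fst d"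
  shows "differential B A \<iota> q (tangent_change c (chart_at B q) q u)
    = tangent_change d (chart_at A (\<iota> q)) (\<iota> q) (dd (map_rep c d \<iota>) (coords c q) u)"
  unfolding differential_def
  using dd_map_rep_target[OF assms(1,2) A.chart_at(1) assms(3,4) A.chart_at(2)]
    dd_map_rep_source[OF assms(1) B.chart_at(1) A.chart_at(1) assms(3) B.chart_at(2) A.chart_at(2)]
  by simp

lemma differential_eq: "differential B A \<iota> p =
    dd (map_rep (chart_at B p) (chart_at A (\<iota> p)) \<iota>) (coords (chart_at B p) p)"
  by (simp add: differential_def fun_eq_iff)

lemma linear_differential: "linear (differential B A \<iota> p)"
  unfolding differential_eq by (intro linear_dd map_rep_differentiable A.chart_at B.chart_at)

lemma inj_differential: "inj (differential B A \<iota> p)"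
  using immersion by (simp add: smooth_immersion_def)

lemma immersed_rep:
  assumes "c \<in> B" "d \<in> A"
  shows "immersed (chart_image d) (metric_rep A d g) (coords c ` (fst c \<inter> \<iota> -` fst d)) (map_rep c d \<iota>)"
proof -
  let ?W = "coords c ` (fst c \<inter> \<iota> -` fst d)" and ?F = "map_rep c d \<iota>"
  note s = smooth_map_rep[OF assms]
  show ?thesis
  proof (intro immersed.intro immersed_axioms.intro A.metric_on_rep metric assms)
    show "open ?W" by (intro B.open_coords_image open_preimage assms)
    fix y assume y: "y \<in> ?W"
    then obtain q where q: "q \<in> fst c" "\<iota> q \<in> fst d" "y = coords c q" by blast
    show "?F y \<in> chart_image d"
      using q by (simp add: map_rep_coords assms A.coords_mem)
    show "?F differentiable (at y)" by (rule smooth_on_differentiable[OF s y])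
    show "(\<lambda>z. dd ?F z v) differentiable (at y)" for v
      by (rule smooth_on_differentiable[OF smooth_on_dd[OF s] y])
    show "(\<lambda>z. dd (\<lambda>z. dd ?F z v) z u) differentiable (at y)" for u v
      by (rule smooth_on_differentiable[OF smooth_on_dd[OF smooth_on_dd[OF s]] y])
    show "inj (dd ?F y)"
    proof (rule injI)
      fix u v assume "dd ?F y u = dd ?F y v"
      then have "differential B A \<iota> q (tangent_change c (chart_at B q) q u)
          = differential B A \<iota> q (tangent_change c (chart_at B q) q v)"
        using differential_rep[OF assms q(1,2)] q(3) by simp
      then have "tangent_change c (chart_at B q) q u = tangent_change c (chart_at B q) q v"
        using inj_differential by (simp add: inj_eq)
      then show "u = v"
        using B.tangent_change_inverse[OF assms(1) B.chart_at(1) q(1) B.chart_at(2)] by metis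
    qed
  qed
qed

lemma induced_metric_rep:
  assumes "c \<in> B" "d \<in> A" "y \<in> coords c ` (fst c \<inter> \<iota> -` fst d)"
  shows "metric_rep B c (induced_metric B A g \<iota>) y u v
    = metric_rep A d g (map_rep c d \<iota> y) (dd (map_rep c d \<iota>) y u) (dd (map_rep c d \<iota>) y v)"
proof -
  obtain q where q: "q \<in> fst c" "\<iota> q \<in> fst d" "y = coords c q" using assms(3) by blast
  show ?thesis
    using differential_rep[OF assms(1,2) q(1,2)] q assms
    by (simp add: metric_rep_def induced_metric_def Let_def B.inv_coords_coords map_rep_coords A.inv_coords_coords)
qed

lemma pd_form_metric: "pd_form (g q)"
  using metric by (auto simp: riemannian_metric_def intro: pd_form.intro)

lemma pd_form_induced: "pd_form (induced_metric B A g \<iota> p)"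
proof -
  interpret pd_form "g (\<iota> p)" by (rule pd_form_metric)
  note l = linear_differential[of p]
  show ?thesis
  proof (rule pd_form.intro)
    show "bilinear (induced_metric B A g \<iota> p)"
      unfolding bilinear_def induced_metric_def
      by (auto intro!: linearI simp: linear_add[OF l] linear_cmul[OF l] lin)
    show "induced_metric B A g \<iota> p u v = induced_metric B A g \<iota> p v u" for u v
      unfolding induced_metric_def by (rule sym)
    show "0 < induced_metric B A g \<iota> p u u" if "u \<noteq> 0" for u
      unfolding induced_metric_def using that linear_injective_0[OF l] inj_differential by (intro pos) auto
  qed
qed

text \<open>Two admissible normal parts differ by a vector that is both tangent and normal, hence
  zero.\<close>

lemma normal_part_eq:
  assumes "N \<in> normal_vectors B A g \<iota> p" "w - N = differential B A \<iota> p v"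
  shows "normal_part B A g \<iota> p w = N"
  unfolding normal_part_def
proof (rule the_equality)
  interpret pd_form "g (\<iota> p)" by (rule pd_form_metric)
  show "N \<in> normal_vectors B A g \<iota> p \<and> w - N \<in> range (differential B A \<iota> p)"
    using assms by blast
  fix M assume M: "M \<in> normal_vectors B A g \<iota> p \<and> w - M \<in> range (differential B A \<iota> p)"
  then obtain v' where v': "w - M = differential B A \<iota> p v'" by blast
  have "M - N = differential B A \<iota> p (v - v')"
    unfolding linear_diff[OF linear_differential] v'[symmetric] assms(2)[symmetric] by simp
  moreover have "g (\<iota> p) (differential B A \<iota> p u) (M - N) = 0" for u
    using M assms(1) by (simp add: normal_vectors_def diff_right)
  ultimately have "g (\<iota> p) (M - N) (M - N) = 0" by simp
  then show "M = N" by (simp add: self_eq_0_iff)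
qed

text \<open>Identifies the objects at \<open>p\<close> with those of \<open>immersed\<close> in the
  charts chosen at \<open>p\<close> and at its image. The Christoffel map of the induced metric
  supplies the tangential vector that \<open>normal_part_eq\<close> asks for.\<close>

lemma second_fundamental_form_props:
  fixes p :: 'b
  defines "\<sigma> \<equiv> second_fundamental_form B A g \<iota> p" and "J \<equiv> differential B A \<iota> p"
    and "gM \<equiv> induced_metric B A g \<iota>"
  shows "bilinear \<sigma>" and "\<sigma> u v = \<sigma> v u" and "g (\<iota> p) (J w) (\<sigma> u v) = 0"
    and "gM p (riemann B gM p X Y Z) V = g (\<iota> p) (riemann A g (\<iota> p) (J X) (J Y) (J Z)) (J V)
      + g (\<iota> p) (\<sigma> Y Z) (\<sigma> X V) - g (\<iota> p) (\<sigma> X Z) (\<sigma> Y V)"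
proof -
  let ?c = "chart_at B p" and ?d = "chart_at A (\<iota> p)"
  let ?W = "coords ?c ` (fst ?c \<inter> \<iota> -` fst ?d)" and ?F = "map_rep ?c ?d \<iota>"
  let ?G = "metric_rep A ?d g" and ?x = "coords ?c p"
  interpret I: immersed "chart_image ?d" ?G ?W ?F
    by (rule immersed_rep[OF B.chart_at(1) A.chart_at(1)])
  interpret pd_form "g (\<iota> p)" by (rule pd_form_metric)
  have x: "?x \<in> ?W" using A.chart_at(2) B.chart_at(2) by blast
  have Fx: "?F ?x = coords ?d (\<iota> p)" by (rule map_rep_coords[OF B.chart_at])
  have Gx: "?G (?F ?x) = g (\<iota> p)" unfolding Fx by (intro ext A.rep_at[OF refl])
  have J: "dd ?F ?x = J" unfolding J_def differential_eq ..
  have \<sigma>: "\<sigma> u v = I.sff ?x u v" for u v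
  proof -
    have "\<sigma> u v = normal_part B A g \<iota> p (I.DF2 ?x u v)"
      by (simp add: \<sigma>_def second_fundamental_form_def I.DF2_def Let_def)
    also have "\<dots> = I.sff ?x u v"
    proof (rule normal_part_eq)
      show "I.sff ?x u v \<in> normal_vectors B A g \<iota> p"
        using I.sff_normal(2)[OF x] by (simp add: normal_vectors_def Gx J J_def)
      show "I.DF2 ?x u v - I.sff ?x u v = differential B A \<iota> p (christoffel I.GM ?x u v)"
        by (simp add: I.sff_def J J_def)
    qed
    finally show ?thesis .
  qed
  then have \<sigma>': "\<sigma> = I.sff ?x" by (intro ext)
  show "bilinear \<sigma>" unfolding \<sigma>' by (rule I.bilinear_sff[OF x])
  show "\<sigma> u v = \<sigma> v u" unfolding \<sigma> by (rule I.sff_sym[OF x])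
  show "g (\<iota> p) (J w) (\<sigma> u v) = 0" using I.sff_normal(2)[OF x, of w u v] unfolding Gx J \<sigma> .
  have GM: "metric_rep B ?c gM y = I.GM y" if "y \<in> ?W" for y
    unfolding gM_def by (intro ext) (simp add: I.GM_def induced_metric_rep[OF B.chart_at(1) A.chart_at(1) that])
  have "gM p = I.GM ?x" using GM[OF x] B.rep_at(1)[OF refl, of p gM] by (simp add: fun_eq_iff)
  moreover have "riemann B gM p X Y Z = curv I.GM ?x X Y Z"
    unfolding riemann_def I.M.curvature_op_const[OF x, symmetric]
    by (rule curvature_op_const_cong_open[OF I.open_W x GM])
  moreover have "riemann A g (\<iota> p) (J X) (J Y) (J Z) = curv ?G (?F ?x) (J X) (J Y) (J Z)"
    unfolding riemann_def Fx[symmetric] by (rule I.curvature_op_const[OF I.F_mem[OF x]])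
  ultimately show "gM p (riemann B gM p X Y Z) V = g (\<iota> p) (riemann A g (\<iota> p) (J X) (J Y) (J Z)) (J V)
      + g (\<iota> p) (\<sigma> Y Z) (\<sigma> X V) - g (\<iota> p) (\<sigma> X Z) (\<sigma> Y V)"
    using I.gauss[OF x, of X Y Z V] unfolding Gx J \<sigma> by simp
qed

end

section \<open>C-totally real submanifolds\<close>

locale C_totally_real_submanifold = riemannian_immersion A B g \<iota> + contact_manifold A \<phi> \<xi> \<eta> g
  for A :: "('a::{t2_space, second_countable_topology}, 'e::euclidean_space) chart set"
    and B :: "('b::{t2_space, second_countable_topology}, 'd::euclidean_space) chart set"
    and \<phi> :: "'a \<Rightarrow> 'e \<Rightarrow> 'e" and \<xi> :: "'a \<Rightarrow> 'e" and \<eta> :: "'a \<Rightarrow> 'e \<Rightarrow> real"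
    and g :: "'a \<Rightarrow> 'e \<Rightarrow> 'e \<Rightarrow> real" and \<iota> :: "'b \<Rightarrow> 'a" +
  assumes C_totally_real: "C_totally_real B A \<xi> g \<iota>"
begin

lemma \<eta>_tangent: "\<eta> (\<iota> q) (differential B A \<iota> q u) = 0"
proof -
  have "g (\<iota> q) X (\<xi> (\<iota> q)) = \<eta> (\<iota> q) X" for X
    using acm[unfolded almost_contact_metric_def] by blast
  moreover have "g (\<iota> q) (differential B A \<iota> q u) (\<xi> (\<iota> q)) = 0"
    using C_totally_real by (simp add: C_totally_real_def normal_vectors_def)
  ultimately show ?thesis by simp
qed

text \<open>The tangent spaces are isotropic for \<open>d\<eta>\<close>, because \<open>\<eta>\<close> pulls back to \<open>0\<close>.\<close>

lemma \<phi>_tangent: "g (\<iota> p) (differential B A \<iota> p X) (\<phi> (\<iota> p) (differential B A \<iota> p Y)) = 0"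
proof -
  let ?c = "chart_at B p" and ?d = "chart_at A (\<iota> p)"
  let ?W = "coords ?c ` (fst ?c \<inter> \<iota> -` fst ?d)" and ?F = "map_rep ?c ?d \<iota>"
  let ?G = "metric_rep A ?d g" and ?x = "coords ?c p" and ?\<xi> = "vec_rep A ?d \<xi>"
  interpret I: immersed "chart_image ?d" ?G ?W ?F
    by (rule immersed_rep[OF B.chart_at(1) A.chart_at(1)])
  interpret L: contact_local "chart_image ?d" ?G "endo_rep A ?d \<phi>" ?\<xi>
    by (rule contact_rep[OF A.chart_at(1)])
  have x: "?x \<in> ?W" using A.chart_at(2) B.chart_at(2) by blast
  have Fx: "?F ?x = coords ?d (\<iota> p)" by (rule map_rep_coords[OF B.chart_at])
  have J: "dd ?F ?x = differential B A \<iota> p" unfolding differential_eq ..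
  have z: "?G (?F y) (dd ?F y u) (?\<xi> (?F y)) = 0" if "y \<in> ?W" for y u
  proof -
    from that obtain q where q: "q \<in> fst ?c" "\<iota> q \<in> fst ?d" "y = coords ?c q" by blast
    have e: "inv_coords ?d (coords ?d (\<iota> q)) = \<iota> q" by (rule A.inv_coords_coords[OF A.chart_at(1) q(2)])
    have "?G (?F y) (dd ?F y u) (?\<xi> (?F y)) =
        g (\<iota> q) (tangent_change ?d (chart_at A (\<iota> q)) (\<iota> q) (dd ?F (coords ?c q) u)) (\<xi> (\<iota> q))"
      using A.tangent_change_inverse[OF A.chart_at(1) A.chart_at(1) A.chart_at(2) q(2)]
      by (simp add: q(3) map_rep_coords[OF B.chart_at(1) q(1)] metric_rep_def vec_rep_def Let_def e)
    also have "\<dots> = 0"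
      unfolding differential_rep[OF B.chart_at(1) A.chart_at(1) q(1,2), symmetric]
      using C_totally_real by (simp add: C_totally_real_def normal_vectors_def)
    finally show ?thesis .
  qed
  have xU: "?F ?x \<in> chart_image ?d" by (rule I.F_mem[OF x])
  have "dd (\<lambda>y. ?G y (dd ?F ?x Y) (?\<xi> y)) (?F ?x) (dd ?F ?x X)
      - dd (\<lambda>y. ?G y (dd ?F ?x X) (?\<xi> y)) (?F ?x) (dd ?F ?x Y) = 0"
    using pullback_exterior_derivative[where \<theta>="\<lambda>_ _. 0" and \<omega>="\<lambda>y u. ?G y u (?\<xi> y)" and \<psi>="?F"
        and X=X and Y=Y, OF I.open_W x I.F1 I.F2[OF x] pd_form.linear_left[OF I.pd[OF I.F_mem]]
        L.\<eta>1[OF xU] z[symmetric]] by simp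
  then have "2 * ?G (?F ?x) (dd ?F ?x X) (endo_rep A ?d \<phi> (?F ?x) (dd ?F ?x Y)) = 0"
    unfolding L.contact[OF xU] .
  then show ?thesis unfolding Fx J A.rep_at[OF refl] by simp
qed

text \<open>On tangent arguments \<open>R2\<close> drops out by \<open>\<phi>_tangent\<close>,
  \<open>R3\<close> by \<open>\<eta>_tangent\<close>, and the tensors containing h by
  \<open>h_tensor_0\<close>.\<close>

lemma gauss_C_totally_real:
  fixes p :: 'b
  defines "\<sigma> \<equiv> second_fundamental_form B A g \<iota> p" and "gM \<equiv> induced_metric B A g \<iota>"
  assumes "\<And>X Y Z. riemann A g (\<iota> p) X Y Z =
        f1 *\<^sub>R R1 (g (\<iota> p)) X Y Z
        + f2 *\<^sub>R R2 (g (\<iota> p)) (\<phi> (\<iota> p)) X Y Z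
        + (f1 - 1) *\<^sub>R R3 (g (\<iota> p)) (\<xi> (\<iota> p)) (\<eta> (\<iota> p)) X Y Z
        + f4 *\<^sub>R R4 (g (\<iota> p)) (h_tensor A \<phi> \<xi> (\<iota> p)) X Y Z
        + f51 *\<^sub>R R51 (g (\<iota> p)) (h_tensor A \<phi> \<xi> (\<iota> p)) X Y Z
        + f52 *\<^sub>R R52 (g (\<iota> p)) (\<phi> (\<iota> p)) (h_tensor A \<phi> \<xi> (\<iota> p)) X Y Z
        + f6 *\<^sub>R R6 (g (\<iota> p)) (\<xi> (\<iota> p)) (\<eta> (\<iota> p)) (h_tensor A \<phi> \<xi> (\<iota> p)) X Y Z"
  shows "gM p (riemann B gM p X Y Y) X = f1 * (gM p X X * gM p Y Y - (gM p X Y)\<^sup>2)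
      + g (\<iota> p) (\<sigma> Y Y) (\<sigma> X X) - g (\<iota> p) (\<sigma> X Y) (\<sigma> X Y)"
proof -
  let ?J = "differential B A \<iota> p"
  interpret pd_form "g (\<iota> p)" by (rule pd_form_metric)
  have h: "h_tensor A \<phi> \<xi> (\<iota> p) X = 0" for X by (rule h_tensor_0[OF assms(3)])
  have "linear (\<phi> (\<iota> p))"
    using acm by (simp add: almost_contact_metric_def smooth_endo_field_def)
  then have \<phi>0: "\<phi> (\<iota> p) 0 = 0" by (rule linear_0)
  have "g (\<iota> p) (riemann A g (\<iota> p) (?J X) (?J Y) (?J Y)) (?J X) =
      f1 * (gM p X X * gM p Y Y - (gM p X Y)\<^sup>2)"
    unfolding assms(3) R1_def R2_def R3_def R4_def R51_def R52_def R6_def h \<phi>0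
    by (simp add: lin \<eta>_tangent \<phi>_tangent gM_def induced_metric_def power2_eq_square sym[of "?J Y" "?J X"] algebra_simps)
  then show ?thesis
    using second_fundamental_form_props(4)[of p X Y Y X] second_fundamental_form_props(2)[of p X Y]
    unfolding \<sigma>_def gM_def by simp
qed

end

section \<open>Chen's algebraic inequality\<close>

text \<open>Every index outside the blocks forms a group of its own, numbered after the \<open>length ns\<close> blocks.\<close>

primrec group_index :: "nat list \<Rightarrow> nat \<Rightarrow> nat" where
  "group_index [] i = i"
| "group_index (x # ns) i = (if i < x then 0 else Suc (group_index ns (i - x)))"

lemma mem_block_iff: "l < length ns \<Longrightarrow> i \<in> block ns l \<longleftrightarrow> group_index ns i = l"
proof (induction ns arbitrary: l i)
  case (Cons x ns)
  show ?case
  proof (cases l)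
    case 0
    then show ?thesis by (simp add: block_def)
  next
    case (Suc l')
    then have "i \<in> block (x # ns) l \<longleftrightarrow> x \<le> i \<and> i - x \<in> block ns l'"
      by (auto simp: block_def)
    then show ?thesis using Cons Suc by auto
  qed
qed simp

lemma group_index_ge: "sum_list ns \<le> i \<Longrightarrow> group_index ns i = length ns + (i - sum_list ns)"
  by (induction ns arbitrary: i) auto

lemma group_index_less: "i < sum_list ns \<Longrightarrow> group_index ns i < length ns"
proof (induction ns arbitrary: i)
  case (Cons x ns)
  then show ?case by (cases "i < x") auto
qed simp

lemma group_index_ge_iff: "length ns \<le> group_index ns i \<longleftrightarrow> sum_list ns \<le> i"
  using group_index_ge[of ns i] group_index_less[of i ns] by linarith

lemma block_eq: "l < length ns \<Longrightarrow> block ns l = {sum_list (take l ns)..<sum_list (take l ns) + ns ! l}"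
  by (simp add: block_def take_Suc_conv_app_nth)

lemma sum_list_take_le: "sum_list (take l ns) \<le> sum_list (ns :: nat list)"
  by (metis append_take_drop_id le_add1 sum_list_append)

lemma block_subset: "block ns l \<subseteq> {..<sum_list ns}"
  using sum_list_take_le[of "Suc l" ns] by (auto simp: block_def)

lemma sum_block:
  assumes "l < length ns"
  shows "sum h (block ns l) = (\<Sum>i<ns ! l. h (sum_list (take l ns) + i))"
proof -
  have "block ns l = (+) (sum_list (take l ns)) ` {..<ns ! l}"
    unfolding block_eq[OF assms] lessThan_atLeast0 by (simp add: add.commute)
  then show ?thesis by (simp add: sum.reindex)
qed

lemma sum_groups:
  fixes h :: "nat \<Rightarrow> 'a::comm_monoid_add"
  assumes "\<And>i. i < n \<Longrightarrow> \<gamma> i < (N::nat)"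
  shows "(\<Sum>t<N. \<Sum>i<n. if \<gamma> i = t then h i else 0) = (\<Sum>i<n. h i)"
proof -
  have "(\<Sum>t<N. \<Sum>i<n. if \<gamma> i = t then h i else 0) = (\<Sum>i<n. \<Sum>t<N. if \<gamma> i = t then h i else 0)"
    by (rule sum.swap)
  also have "\<dots> = (\<Sum>i<n. h i)" using assms by (intro sum.cong) auto
  finally show ?thesis .
qed

lemma sum_pairs_split:
  fixes k :: "nat \<Rightarrow> nat \<Rightarrow> real"
  assumes "\<And>i. i < n \<Longrightarrow> \<gamma> i < (N::nat)"
  shows "(\<Sum>i<n. \<Sum>j<n. if \<gamma> i = \<gamma> j then 0 else k i j) =
    (\<Sum>i<n. \<Sum>j<n. k i j) - (\<Sum>t<N. \<Sum>i<n. \<Sum>j<n. if \<gamma> i = t \<and> \<gamma> j = t then k i j else 0)"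
proof -
  have "(\<Sum>t<N. \<Sum>i<n. \<Sum>j<n. if \<gamma> i = t \<and> \<gamma> j = t then k i j else 0)
      = (\<Sum>t<N. \<Sum>i<n. if \<gamma> i = t then (\<Sum>j<n. if \<gamma> i = \<gamma> j then k i j else 0) else 0)"
    by (intro sum.cong refl) (auto intro!: sum.cong)
  also have "\<dots> = (\<Sum>i<n. \<Sum>j<n. if \<gamma> i = \<gamma> j then k i j else 0)"
    by (rule sum_groups[OF assms])
  finally have e: "(\<Sum>t<N. \<Sum>i<n. \<Sum>j<n. if \<gamma> i = t \<and> \<gamma> j = t then k i j else 0)
      = (\<Sum>i<n. \<Sum>j<n. if \<gamma> i = \<gamma> j then k i j else 0)" .
  show ?thesis
    unfolding e sum_subtractf[symmetric] by (intro sum.cong refl) simp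
qed

text \<open>The defect of Chen's inequality is written as a sum of squares, from which the equality case is read off.\<close>

lemma chen_identity:
  fixes a :: "nat \<Rightarrow> nat \<Rightarrow> real"
  assumes "N > 0" and \<gamma>: "\<And>i. i < n \<Longrightarrow> \<gamma> i < (N::nat)"
  defines "x \<equiv> \<lambda>t. \<Sum>i<n. if \<gamma> i = t then a i i else 0" and "m \<equiv> (\<Sum>i<n. a i i) / real N"
  shows "(\<Sum>i<n. \<Sum>j<n. if \<gamma> i = \<gamma> j then 0 else a i i * a j j - (a i j)\<^sup>2) =
    (real N - 1) / real N * (\<Sum>i<n. a i i)\<^sup>2
    - ((\<Sum>t<N. (x t - m)\<^sup>2) + (\<Sum>i<n. \<Sum>j<n. if \<gamma> i = \<gamma> j then 0 else (a i j)\<^sup>2))"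
proof -
  let ?s = "\<Sum>i<n. a i i"
  have sx: "(\<Sum>t<N. x t) = ?s" unfolding x_def by (rule sum_groups[OF \<gamma>])
  have x2: "(x t)\<^sup>2 = (\<Sum>i<n. \<Sum>j<n. if \<gamma> i = t \<and> \<gamma> j = t then a i i * a j j else 0)" for t
    unfolding x_def power2_eq_square sum_product by (intro sum.cong refl) auto
  have "(\<Sum>i<n. \<Sum>j<n. if \<gamma> i = \<gamma> j then 0 else a i i * a j j) = ?s\<^sup>2 - (\<Sum>t<N. (x t)\<^sup>2)"
  proof -
    have "?s\<^sup>2 = (\<Sum>i<n. \<Sum>j<n. a i i * a j j)" by (simp add: power2_eq_square sum_product)
    then show ?thesis unfolding x2 by (simp only: sum_pairs_split[OF \<gamma>])
  qed
  \<comment> \<open>The variance of the group traces about their mean \<open>m\<close>: an identity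
    in place of the Cauchy-Schwarz inequality, so that equality can be tracked.\<close>
  moreover have "(\<Sum>t<N. (x t - m)\<^sup>2) = (\<Sum>t<N. (x t)\<^sup>2) - ?s\<^sup>2 / real N"
  proof -
    have "(\<Sum>t<N. (x t - m)\<^sup>2) = (\<Sum>t<N. (x t)\<^sup>2) - 2 * m * (\<Sum>t<N. x t) + real N * m\<^sup>2"
      by (simp add: power2_diff sum.distrib sum_subtractf sum_distrib_left ac_simps)
    then show ?thesis using assms(1) by (simp add: sx m_def power2_eq_square field_simps)
  qed
  moreover have "(\<Sum>i<n. \<Sum>j<n. if \<gamma> i = \<gamma> j then 0 else a i i * a j j - (a i j)\<^sup>2) =
      (\<Sum>i<n. \<Sum>j<n. if \<gamma> i = \<gamma> j then 0 else a i i * a j j) - (\<Sum>i<n. \<Sum>j<n. if \<gamma> i = \<gamma> j then 0 else (a i j)\<^sup>2)"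
    unfolding sum_subtractf[symmetric] by (intro sum.cong refl) auto
  moreover have "(real N - 1) / real N * ?s\<^sup>2 = ?s\<^sup>2 - ?s\<^sup>2 / real N"
    using assms(1) by (simp add: field_simps)
  ultimately show ?thesis by linarith
qed

section \<open>Blocks, groups and the constant b\<close>

locale chen_tuple =
  fixes n :: nat and ns :: "nat list"
  assumes n_pos: "0 < n" and ns: "ns \<in> chen_tuples n"
begin

abbreviation "\<gamma> \<equiv> group_index ns"
abbreviation "k \<equiv> length ns"

text \<open>This is the number N that occurs in \<open>chen_c\<close>; see
  \<open>real_groups\<close>.\<close>

definition "groups = k + (n - sum_list ns)"

lemma sum_ns: "sum_list ns \<le> n" and ns_ge: "l < k \<Longrightarrow> 2 \<le> ns ! l"
  using ns by (auto simp: chen_tuples_def)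

lemma groups_pos: "0 < groups"
  unfolding groups_def using n_pos by (cases "ns = []") auto

lemma real_groups: "real groups = real n + real k - real (sum_list ns)"
  using sum_ns by (simp add: groups_def of_nat_diff)

lemma group_less: "i < n \<Longrightarrow> \<gamma> i < groups"
  using group_index_ge[of ns i] group_index_less[of i ns] by (cases "sum_list ns \<le> i") (auto simp: groups_def)

lemma group_eq_ge: "k \<le> t \<Longrightarrow> \<gamma> i = t \<longleftrightarrow> i = sum_list ns + (t - k)"
  using group_index_ge[of ns i] group_index_ge_iff[of ns i] group_index_ge[of ns "sum_list ns + (t - k)"] by auto

lemma sum_group_block:
  assumes "l < k"
  shows "(\<Sum>i<n. if \<gamma> i = l then h i else 0) = sum h (block ns l)"
proof -
  have "{i \<in> {..<n}. \<gamma> i = l} = block ns l"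
    using mem_block_iff[OF assms] block_subset[of ns l] sum_ns by auto
  then show ?thesis by (simp add: sum.inter_filter[symmetric])
qed

lemma sum_group_single:
  assumes "k \<le> t" "t < groups"
  shows "(\<Sum>i<n. if \<gamma> i = t then h i else 0) = h (sum_list ns + (t - k))"
proof -
  have "sum_list ns + (t - k) < n" using assms sum_ns unfolding groups_def by linarith
  then show ?thesis by (simp add: group_eq_ge[OF assms(1)])
qed

lemma sum_groups_split:
  fixes F :: "nat \<Rightarrow> 'a::comm_monoid_add"
  shows "(\<Sum>t<groups. F t) = (\<Sum>l<k. F l) + (\<Sum>t\<in>{k..<groups}. F t)"
proof -
  have "{..<groups} = {..<k} \<union> {k..<groups}" by (auto simp: groups_def)
  then have "(\<Sum>t<groups. F t) = (\<Sum>t\<in>{..<k} \<union> {k..<groups}. F t)" by (simp only:)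
  also have "\<dots> = (\<Sum>l<k. F l) + (\<Sum>t\<in>{k..<groups}. F t)" by (rule sum.union_disjoint) auto
  finally show ?thesis .
qed

text \<open>An index outside the blocks is a group of its own, with its diagonal entry as trace. The
  scalar block and the trace condition therefore merge into equality of all group traces, whose
  common value must be the total trace divided by the number of groups.\<close>

lemma adapted_block_form_iff:
  assumes sym: "\<And>i j. i < n \<Longrightarrow> j < n \<Longrightarrow> M i j = M j i"
  shows "(\<exists>a. adapted_block_form n ns a M) \<longleftrightarrow>
    (\<forall>i<n. \<forall>j<n. \<gamma> i \<noteq> \<gamma> j \<longrightarrow> M i j = 0) \<and>
    (\<forall>t<groups. (\<Sum>i<n. if \<gamma> i = t then M i i else 0) = (\<Sum>i<n. M i i) / real groups)"
    (is "?L \<longleftrightarrow> ?off \<and> ?tr")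
proof
  assume ?L
  then obtain a where a: "adapted_block_form n ns a M" by blast
  have blk: "(\<nexists>l. l < k \<and> i \<in> block ns l \<and> j \<in> block ns l) \<longleftrightarrow> \<gamma> i \<noteq> \<gamma> j \<or> k \<le> \<gamma> i" for i j
    using mem_block_iff[of _ ns] by (metis not_less)
  have off: "M i j = (if i = j then a else 0)" if "i < n" "j < n" "\<gamma> i \<noteq> \<gamma> j \<or> k \<le> \<gamma> i" for i j
    using a that unfolding adapted_block_form_def blk by blast
  then have ?off by (metis)
  have x: "(\<Sum>i<n. if \<gamma> i = t then M i i else 0) = a" if "t < groups" for t
  proof (cases "t < k")
    case True
    then show ?thesis using a by (simp add: sum_group_block adapted_block_form_def)
  next
    case False
    let ?i = "sum_list ns + (t - k)"
    have "?i < n" using False that sum_ns by (simp add: groups_def)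
    moreover have "\<gamma> ?i = t" using False group_eq_ge by simp
    ultimately have "M ?i ?i = a" using off[of ?i ?i] False by simp
    then show ?thesis using sum_group_single[of t "\<lambda>i. M i i"] False that by simp
  qed
  have "(\<Sum>i<n. M i i) = (\<Sum>t<groups. a)"
    using sum_groups[of n \<gamma> groups "\<lambda>i. M i i"] group_less x by simp
  then have ?tr using x groups_pos by simp
  with \<open>?off\<close> show "?off \<and> ?tr" by blast
next
  assume R: "?off \<and> ?tr"
  let ?a = "(\<Sum>i<n. M i i) / real groups"
  have "adapted_block_form n ns ?a M"
    unfolding adapted_block_form_def
  proof (intro conjI allI impI ballI)
    fix l i j assume "l < k" "i \<in> block ns l" "j \<in> block ns l"
    then show "M i j = M j i" using block_subset[of ns l] sum_ns by (intro sym) auto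
  next
    fix l assume l: "l < k"
    then have "l < groups" by (simp add: groups_def)
    then show "(\<Sum>i\<in>block ns l. M i i) = ?a" using R sum_group_block[OF l, of "\<lambda>i. M i i"] by simp
  next
    fix i j assume i: "i < n" and j: "j < n" and b: "\<nexists>l. l < k \<and> i \<in> block ns l \<and> j \<in> block ns l"
    show "M i j = (if i = j then ?a else 0)"
    proof (cases "i = j")
      case True
      then have g: "k \<le> \<gamma> i" using b mem_block_iff[of "\<gamma> i" ns i] by force
      have "i = sum_list ns + (\<gamma> i - k)" using group_eq_ge[OF g, of i] by simp
      then have "M i i = (\<Sum>j<n. if \<gamma> j = \<gamma> i then M j j else 0)"
        using sum_group_single[OF g group_less[OF i], of "\<lambda>i. M i i"] by simp
      then show ?thesis using R group_less[OF i] True by simp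
    next
      case False
      have "\<gamma> i \<noteq> \<gamma> j"
      proof
        assume e: "\<gamma> i = \<gamma> j"
        then have "k \<le> \<gamma> i" using b mem_block_iff[of "\<gamma> i" ns i] mem_block_iff[of "\<gamma> i" ns j] by force
        then show False using group_eq_ge[of "\<gamma> i" i] group_eq_ge[of "\<gamma> i" j] e False by simp
      qed
      then show ?thesis using R i j False by simp
    qed
  qed
  then show ?L by blast
qed

text \<open>Ordered pairs within a common group are removed from all ordered pairs: a block of size
  s removes s squared, a single index removes 1.\<close>

lemma number_of_pairs:
  "(\<Sum>i<n. \<Sum>j<n. if \<gamma> i = \<gamma> j then 0 else 1) = 2 * chen_b n ns"
proof -
  have sq: "(\<Sum>i<n. \<Sum>j<n. if \<gamma> i = t \<and> \<gamma> j = t then 1 else 0) = (\<Sum>i<n. if \<gamma> i = t then 1 else (0::real))\<^sup>2" for t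
    unfolding power2_eq_square sum_product by (intro sum.cong refl) auto
  have "(\<Sum>i<n. if \<gamma> i = l then 1 else (0::real)) = real (ns ! l)" if "l < k" for l
    using sum_group_block[OF that, of "\<lambda>_. 1::real"] block_eq[OF that] by simp
  then have "(\<Sum>t<groups. (\<Sum>i<n. if \<gamma> i = t then 1 else (0::real))\<^sup>2) =
      (\<Sum>l<k. (real (ns ! l))\<^sup>2) + (\<Sum>t\<in>{k..<groups}. 1)"
    unfolding sum_groups_split using sum_group_single[of _ "\<lambda>_. 1::real"] by simp
  also have "(\<Sum>t\<in>{k..<groups}. 1) = real n - (\<Sum>l<k. real (ns ! l))"
    using real_groups by (simp add: groups_def sum_list_sum_nth lessThan_atLeast0)
  finally have "(\<Sum>i<n. \<Sum>j<n. if \<gamma> i = \<gamma> j then 0 else 1) =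
      real n * real n - ((\<Sum>l<k. (real (ns ! l))\<^sup>2) + (real n - (\<Sum>l<k. real (ns ! l))))"
    using sum_pairs_split[of n \<gamma> groups "\<lambda>_ _. 1", OF group_less] unfolding sq by simp
  moreover have "(\<Sum>x\<leftarrow>ns. real x * (real x - 1)) = (\<Sum>l<k. (real (ns ! l))\<^sup>2) - (\<Sum>l<k. real (ns ! l))"
    by (simp add: sum_list_sum_nth lessThan_atLeast0 sum_subtractf[symmetric] power2_eq_square right_diff_distrib)
  ultimately show ?thesis unfolding chen_b_def by (simp only:) (simp add: field_simps)
qed

end

lemma sum_symmetric_pairs:
  fixes h :: "nat \<Rightarrow> nat \<Rightarrow> real"
  assumes "\<And>i j. h i j = h j i" "\<And>i. h i i = 0"
  shows "(\<Sum>i<m. \<Sum>j<m. h i j) = 2 * (\<Sum>j<m. \<Sum>i<j. h i j)"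
proof (induction m)
  case (Suc m)
  have "(\<Sum>i<Suc m. \<Sum>j<Suc m. h i j) = (\<Sum>i<m. \<Sum>j<m. h i j) + (\<Sum>i<m. h i m) + (\<Sum>j<m. h m j)"
    by (simp add: sum.distrib assms(2))
  also have "(\<Sum>j<m. h m j) = (\<Sum>i<m. h i m)" using assms(1) by simp
  finally show ?case using Suc by simp
qed simp

section \<open>Chen's inequality at a point\<close>

text \<open>Linear algebra at one point: \<open>J\<close> plays the differential of the immersion,
  \<open>f\<close> the value of \<open>f1\<close>, and \<open>K\<close> the sectional curvature,
  prescribed on orthonormal pairs because \<open>\<tau>\<close> evaluates it only there.\<close>

locale chen_point = chen_tuple n ns + G: pd_form G + g: pd_form g
  for n ns and G :: "'d::euclidean_space \<Rightarrow> 'd \<Rightarrow> real" and g :: "'e::euclidean_space \<Rightarrow> 'e \<Rightarrow> real" +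
  fixes J :: "'d \<Rightarrow> 'e" and \<sigma> :: "'d \<Rightarrow> 'd \<Rightarrow> 'e" and f :: real and K :: "'d \<Rightarrow> 'd \<Rightarrow> real"
  assumes dim_d: "DIM('d) = n"
    and isometric: "G u v = g (J u) (J v)"
    and linear_J: "linear J"
    and bilinear_\<sigma>: "bilinear \<sigma>"
    and \<sigma>_sym: "\<sigma> u v = \<sigma> v u"
    and \<sigma>_normal: "g (J w) (\<sigma> u v) = 0"
    and K_gauss: "G u u = 1 \<Longrightarrow> G v v = 1 \<Longrightarrow> G u v = 0 \<Longrightarrow>
      K u v = f + g (\<sigma> v v) (\<sigma> u u) - g (\<sigma> u v) (\<sigma> u v)"
begin

abbreviation "frame E \<equiv> orthonormal_basis G UNIV E"

text \<open>A polynomial extension of \<open>K\<close> from orthonormal pairs to all pairs of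
  vectors, which makes traces and continuity available.\<close>

definition \<kappa> :: "'d \<Rightarrow> 'd \<Rightarrow> real" where
  "\<kappa> u v = f * (G u u * G v v - (G u v)\<^sup>2) + g (\<sigma> v v) (\<sigma> u u) - g (\<sigma> u v) (\<sigma> u v)"

definition \<tau> :: "'d set \<Rightarrow> real" where
  "\<tau> L = (let E = (SOME E. orthonormal_basis G L E) in (\<Sum>j<dim L. \<Sum>i<j. K (E i) (E j)))"

text \<open>For a frame this is \<tau> of the whole space minus the sum of \<tau> over the spans of
  its blocks, by \<open>sum_\<tau>_adapted\<close>. Chen's \<delta> is thus a maximum of
  \<open>\<Delta>\<close> over frames.\<close>

definition \<Delta> :: "(nat \<Rightarrow> 'd) \<Rightarrow> real" where
  "\<Delta> E = (\<Sum>i<n. \<Sum>j<n. if \<gamma> i = \<gamma> j then 0 else \<kappa> (E i) (E j)) / 2"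

lemma \<sigma>_left: "linear (\<lambda>u. \<sigma> u v)" and \<sigma>_right: "linear (\<sigma> u)"
  using bilinear_\<sigma> by (auto simp: bilinear_def)

lemma \<kappa>_sym: "\<kappa> u v = \<kappa> v u"
  unfolding \<kappa>_def using G.sym[of u v] g.sym[of "\<sigma> v v" "\<sigma> u u"] \<sigma>_sym[of u v] by (simp add: mult.commute)

lemma \<kappa>_self: "\<kappa> u u = 0"
  by (simp add: \<kappa>_def power2_eq_square)

text \<open>For fixed \<open>v\<close>, \<open>\<kappa> u v\<close> is the diagonal of a bilinear
  form in \<open>u\<close>, so \<open>trace_independent\<close> applies.\<close>

lemma \<kappa>_trace:
  assumes "orthonormal_basis G L E" "orthonormal_basis G L E'"
  shows "(\<Sum>i<dim L. \<kappa> (E i) v) = (\<Sum>i<dim L. \<kappa> (E' i) v)"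
proof -
  define B where "B u u' = f * (G u u' * G v v - G u v * G u' v) + g (\<sigma> v v) (\<sigma> u u') - g (\<sigma> u v) (\<sigma> u' v)" for u u'
  note l = linear_add[OF \<sigma>_left] linear_add[OF \<sigma>_right] linear_cmul[OF \<sigma>_left] linear_cmul[OF \<sigma>_right]
  have "\<kappa> u v = B u u" for u
    by (simp add: \<kappa>_def B_def power2_eq_square)
  moreover have "linear (B u)" "linear (\<lambda>u. B u u')" for u u'
    unfolding B_def by (rule linearI; simp add: l G.lin g.lin algebra_simps)+
  ultimately show ?thesis
    using G.trace_independent[OF assms, of B] by simp
qed

text \<open>One basis is exchanged at a time, with symmetry of \<kappa> in between. Hence the basis
  picked by \<open>SOME\<close> in \<open>\<tau>\<close> does not matter.\<close>

lemma \<kappa>_double_sum: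
  assumes "orthonormal_basis G L E" "orthonormal_basis G L E'"
  shows "(\<Sum>i<dim L. \<Sum>j<dim L. \<kappa> (E i) (E j)) = (\<Sum>i<dim L. \<Sum>j<dim L. \<kappa> (E' i) (E' j))"
proof -
  have "(\<Sum>i<dim L. \<Sum>j<dim L. \<kappa> (E i) (E j)) = (\<Sum>i<dim L. \<Sum>j<dim L. \<kappa> (E j) (E i))"
    by (simp only: \<kappa>_sym)
  also have "\<dots> = (\<Sum>i<dim L. \<Sum>j<dim L. \<kappa> (E' j) (E i))"
    by (simp only: \<kappa>_trace[OF assms])
  also have "\<dots> = (\<Sum>j<dim L. \<Sum>i<dim L. \<kappa> (E i) (E' j))"
    by (subst sum.swap) (simp only: \<kappa>_sym)
  also have "\<dots> = (\<Sum>j<dim L. \<Sum>i<dim L. \<kappa> (E' i) (E' j))"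
    by (simp only: \<kappa>_trace[OF assms])
  also have "\<dots> = (\<Sum>i<dim L. \<Sum>j<dim L. \<kappa> (E' i) (E' j))" by (rule sum.swap)
  finally show ?thesis .
qed

lemma \<tau>_eq:
  assumes "orthonormal_basis G L E"
  shows "\<tau> L = (\<Sum>i<dim L. \<Sum>j<dim L. \<kappa> (E i) (E j)) / 2"
proof -
  define E' where "E' = (SOME E. orthonormal_basis G L E)"
  have E': "orthonormal_basis G L E'" unfolding E'_def by (rule someI[of "orthonormal_basis G L", OF assms])
  have "\<tau> L = (\<Sum>j<dim L. \<Sum>i<j. K (E' i) (E' j))" by (simp add: \<tau>_def E'_def Let_def)
  also have "\<dots> = (\<Sum>j<dim L. \<Sum>i<j. \<kappa> (E' i) (E' j))"
  proof (intro sum.cong refl)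
    fix j i assume "j \<in> {..<dim L}" "i \<in> {..<j}"
    then have "G (E' i) (E' i) = 1" "G (E' j) (E' j) = 1" "G (E' i) (E' j) = 0"
      using E' by (auto simp: orthonormal_basis_def)
    then show "K (E' i) (E' j) = \<kappa> (E' i) (E' j)" by (simp add: K_gauss \<kappa>_def)
  qed
  also have "\<dots> = (\<Sum>i<dim L. \<Sum>j<dim L. \<kappa> (E' i) (E' j)) / 2"
    using sum_symmetric_pairs[of "\<lambda>i j. \<kappa> (E' i) (E' j)" "dim L"] \<kappa>_sym \<kappa>_self by simp
  finally show ?thesis using \<kappa>_double_sum[OF assms E'] by simp
qed

definition adapted :: "(nat \<Rightarrow> 'd) \<Rightarrow> 'd set list \<Rightarrow> bool" where
  "adapted E Ls \<longleftrightarrow> length Ls = k \<and>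
    (\<forall>l<k. dim (Ls ! l) = ns ! l \<and> orthonormal_basis G (Ls ! l) (\<lambda>i. E (sum_list (take l ns) + i)))"

text \<open>Pairs inside block l sum to twice \<tau> of the l-th subspace, and a single index
  contributes \<open>\<kappa> u u = 0\<close>. What is left of the whole space are the pairs from
  different groups.\<close>

lemma sum_\<tau>_adapted:
  assumes "frame E" "adapted E Ls"
  shows "(\<Sum>L\<leftarrow>Ls. \<tau> L) = \<tau> UNIV - \<Delta> E"
proof -
  let ?S = "\<lambda>t. \<Sum>i<n. \<Sum>j<n. if \<gamma> i = t \<and> \<gamma> j = t then \<kappa> (E i) (E j) else 0"
  have blk: "?S l = 2 * \<tau> (Ls ! l)" if "l < k" for l
  proof -
    have "?S l = (\<Sum>i<n. if \<gamma> i = l then (\<Sum>j<n. if \<gamma> j = l then \<kappa> (E i) (E j) else 0) else 0)"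
      by (intro sum.cong refl) auto
    also have "\<dots> = (\<Sum>i\<in>block ns l. \<Sum>j\<in>block ns l. \<kappa> (E i) (E j))"
      unfolding sum_group_block[OF that] ..
    also have "\<dots> = 2 * \<tau> (Ls ! l)"
      using \<tau>_eq[of "Ls ! l" "\<lambda>i. E (sum_list (take l ns) + i)"] assms(2) that
      by (simp add: sum_block adapted_def)
    finally show ?thesis .
  qed
  have single: "?S t = 0" if "k \<le> t" for t
    using group_eq_ge[OF that] \<kappa>_self by (intro sum.neutral ballI) auto
  have "2 * \<Delta> E = (\<Sum>i<n. \<Sum>j<n. \<kappa> (E i) (E j)) - (\<Sum>t<groups. ?S t)"
    using sum_pairs_split[OF group_less, where k="\<lambda>i j. \<kappa> (E i) (E j)"] by (simp add: \<Delta>_def)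
  also have "(\<Sum>t<groups. ?S t) = (\<Sum>l<k. 2 * \<tau> (Ls ! l))"
    unfolding sum_groups_split by (simp add: blk single)
  also have "(\<Sum>i<n. \<Sum>j<n. \<kappa> (E i) (E j)) = 2 * \<tau> UNIV"
    using \<tau>_eq[OF assms(1)] by (simp add: dim_UNIV dim_d)
  also have "(\<Sum>l<k. 2 * \<tau> (Ls ! l)) = 2 * (\<Sum>L\<leftarrow>Ls. \<tau> L)"
    using assms(2) by (simp add: adapted_def sum_list_sum_nth lessThan_atLeast0 sum_distrib_left)
  finally show ?thesis by simp
qed

lemma frame_orthonormal: "frame E \<Longrightarrow> i < n \<Longrightarrow> j < n \<Longrightarrow> G (E i) (E j) = (if i = j then 1 else 0)"
  by (simp add: orthonormal_basis_def dim_UNIV dim_d)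

lemma frame_iff: "frame E \<longleftrightarrow> (\<forall>i<n. \<forall>j<n. G (E i) (E j) = (if i = j then 1 else 0))"
proof
  assume "\<forall>i<n. \<forall>j<n. G (E i) (E j) = (if i = j then 1 else 0)"
  then show "frame E"
    by (intro G.orthonormal_family_basis subspace_UNIV) (auto simp: orthonormal_family_def dim_UNIV dim_d)
qed (simp add: frame_orthonormal)

lemma adapted_frame_exists:
  assumes "orthogonal_subspaces G ns Ls"
  shows "\<exists>E. frame E \<and> adapted E Ls"
proof -
  have Ls: "length Ls = k" "\<And>l. l < k \<Longrightarrow> subspace (Ls ! l)" "\<And>l. l < k \<Longrightarrow> dim (Ls ! l) = ns ! l"
    "\<And>i j u v. i < k \<Longrightarrow> j < k \<Longrightarrow> i \<noteq> j \<Longrightarrow> u \<in> Ls ! i \<Longrightarrow> v \<in> Ls ! j \<Longrightarrow> G u v = 0"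
    using assms by (auto simp: orthogonal_subspaces_def)
  have "\<forall>l<k. \<exists>E. orthonormal_basis G (Ls ! l) E"
    using G.orthonormal_basis_exists Ls(2) by blast
  then obtain B where B: "\<And>l. l < k \<Longrightarrow> orthonormal_basis G (Ls ! l) (B l)" by metis
  let ?off = "\<lambda>l. sum_list (take l ns)"
  \<comment> \<open>Concatenation of the bases: position \<open>i\<close> lies in block
    \<open>\<gamma> i\<close>, and subtracting the offset of that block gives its index
    there.\<close>
  define F where "F i = B (\<gamma> i) (i - ?off (\<gamma> i))" for i
  have idx: "?off (\<gamma> i) \<le> i" "i - ?off (\<gamma> i) < dim (Ls ! \<gamma> i)" "\<gamma> i < k" if "i < sum_list ns" for i
    using mem_block_iff[of "\<gamma> i" ns i] group_index_less[OF that] block_eq[of "\<gamma> i" ns] Ls(3)[of "\<gamma> i"] by auto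
  have fam: "orthonormal_family G F (sum_list ns)"
    unfolding orthonormal_family_def
  proof (intro allI impI)
    fix i j assume i: "i < sum_list ns" and j: "j < sum_list ns"
    show "G (F i) (F j) = (if i = j then 1 else 0)"
    proof (cases "\<gamma> i = \<gamma> j")
      case True
      then have "G (F i) (F j) = (if i - ?off (\<gamma> i) = j - ?off (\<gamma> i) then 1 else 0)"
        using B[OF idx(3)[OF i]] idx[OF i] idx[OF j] by (simp add: F_def orthonormal_basis_def)
      then show ?thesis using idx(1)[OF i] idx(1)[OF j] True by auto
    next
      case False
      have "F i \<in> Ls ! \<gamma> i" "F j \<in> Ls ! \<gamma> j"
        unfolding F_def using G.orthonormal_basis_mem[OF B] idx i j by auto
      then have "G (F i) (F j) = 0" using Ls(4) idx(3) i j False by blast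
      then show ?thesis using False by auto
    qed
  qed
  obtain E where E: "\<forall>i<sum_list ns. E i = F i" "orthonormal_family G E (dim (UNIV :: 'd set))"
    using G.orthonormal_extend[OF subspace_UNIV fam] sum_ns by (auto simp: dim_UNIV dim_d)
  have "frame E" by (rule G.orthonormal_family_basis[OF subspace_UNIV E(2)]) simp
  moreover have "adapted E Ls"
    unfolding adapted_def
  proof (intro conjI allI impI Ls(1) Ls(3))
    fix l assume l: "l < k"
    have e: "E (?off l + i) = B l i" if "i < ns ! l" for i
    proof -
      have "?off l + i \<in> block ns l" using block_eq[OF l] that by simp
      then have "\<gamma> (?off l + i) = l" "?off l + i < sum_list ns"
        using mem_block_iff[OF l] block_subset[of ns l] by auto
      then show ?thesis using E(1) by (simp add: F_def)
    qed
    then have "(\<lambda>i. E (?off l + i)) ` {..<ns ! l} = B l ` {..<ns ! l}" by (intro image_cong) auto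
    then show "orthonormal_basis G (Ls ! l) (\<lambda>i. E (?off l + i))"
      using B[OF l] e Ls(3)[OF l] by (simp add: orthonormal_basis_def)
  qed
  ultimately show ?thesis by blast
qed

lemma adapted_subspaces_exist:
  assumes "frame E"
  shows "\<exists>Ls. orthogonal_subspaces G ns Ls \<and> adapted E Ls"
proof -
  let ?off = "\<lambda>l. sum_list (take l ns)"
  define V where "V l = span ((\<lambda>i. E (?off l + i)) ` {..<ns ! l})" for l
  have less: "?off l + i < n \<and> \<gamma> (?off l + i) = l" if "l < k" "i < ns ! l" for l i
  proof -
    have "?off l + i \<in> block ns l" using block_eq[OF that(1)] that(2) by simp
    then show ?thesis
      using mem_block_iff[OF that(1)] block_subset[of ns l] sum_ns by auto
  qed
  have fam: "orthonormal_family G (\<lambda>i. E (?off l + i)) (ns ! l)" if "l < k" for l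
    unfolding orthonormal_family_def using frame_orthonormal[OF assms] less[OF that] by simp
  note V = G.orthonormal_basis_span[OF fam, folded V_def]
  have orth: "G u v = 0" if lm: "l < k" "m < k" "l \<noteq> m" and u: "u \<in> V l" and v: "v \<in> V m" for l m u v
  proof -
    have 0: "G (E (?off l + i)) (E (?off m + j)) = 0" if "i < ns ! l" "j < ns ! m" for i j
      using frame_orthonormal[OF assms] less[OF lm(1) that(1)] less[OF lm(2) that(2)] lm(3) by auto
    have "u = (\<Sum>i<ns ! l. G u (E (?off l + i)) *\<^sub>R E (?off l + i))"
      using G.orthonormal_expansion[OF V(2)[OF lm(1)] u] V(1)[OF lm(1)] by simp
    moreover have "v = (\<Sum>j<ns ! m. G v (E (?off m + j)) *\<^sub>R E (?off m + j))"
      using G.orthonormal_expansion[OF V(2)[OF lm(2)] v] V(1)[OF lm(2)] by simp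
    ultimately have "G u v = G (\<Sum>i<ns ! l. G u (E (?off l + i)) *\<^sub>R E (?off l + i))
        (\<Sum>j<ns ! m. G v (E (?off m + j)) *\<^sub>R E (?off m + j))" by simp
    also have "\<dots> = 0" unfolding G.lin using 0 by simp
    finally show ?thesis .
  qed
  have "orthogonal_subspaces G ns (map V [0..<k])"
    unfolding orthogonal_subspaces_def using V(1) orth by (auto simp: V_def)
  moreover have "adapted E (map V [0..<k])"
    unfolding adapted_def using V by simp
  ultimately show ?thesis by blast
qed

section \<open>Compactness of frames and the infimum\<close>

lemma \<Delta>_cong: "(\<And>i. i < n \<Longrightarrow> E i = E' i) \<Longrightarrow> \<Delta> E = \<Delta> E'"
  unfolding \<Delta>_def by (intro arg_cong2[where f="(/)"] sum.cong refl) auto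

lemma \<Delta>_attains_max: "\<exists>E. frame E \<and> (\<forall>E'. frame E' \<longrightarrow> \<Delta> E' \<le> \<Delta> E)"
proof -
  \<comment> \<open>A frame is a function on all of \<open>nat\<close> whose values beyond
    \<open>n\<close> are arbitrary. Fixing them as 0 puts the normalized frames into a product of
    compact sets, to which Tychonoff's theorem applies.\<close>
  define S where "S i = (if i < n then {v. G v v \<le> 1} else {0})" for i :: nat
  have cont_G: "continuous_on UNIV (\<lambda>E :: nat \<Rightarrow> 'd. G (E i) (E j))" for i j
    by (intro bilinear_continuous_on_compose[OF _ _ G.bil] continuous_on_product_coordinates)
  have cont_\<sigma>: "continuous_on UNIV (\<lambda>E :: nat \<Rightarrow> 'd. \<sigma> (E i) (E j))" for i j
    by (intro bilinear_continuous_on_compose[OF _ _ bilinear_\<sigma>] continuous_on_product_coordinates)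
  have cont_\<kappa>: "continuous_on UNIV (\<lambda>E :: nat \<Rightarrow> 'd. \<kappa> (E i) (E j))" for i j
    unfolding \<kappa>_def
    by (intro continuous_intros cont_G bilinear_continuous_on_compose[OF cont_\<sigma> cont_\<sigma> g.bil])
  have cont_\<Delta>: "continuous_on UNIV \<Delta>"
  proof -
    have "continuous_on UNIV (\<lambda>E. (\<Sum>i<n. \<Sum>j<n. if \<gamma> i = \<gamma> j then 0 else \<kappa> (E i) (E j)) / 2)"
    proof (intro continuous_on_divide continuous_on_sum continuous_on_const)
      show "continuous_on UNIV (\<lambda>E. if \<gamma> i = \<gamma> j then 0 else \<kappa> (E i) (E j))" for i j
        using cont_\<kappa>[of i j] by (cases "\<gamma> i = \<gamma> j") auto
    qed simp
    then show ?thesis unfolding \<Delta>_def[abs_def] .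
  qed
  have compact_S: "compact (S i)" for i
  proof (cases "i < n")
    case True
    obtain E where E: "frame E" using G.orthonormal_basis_exists[OF subspace_UNIV] by blast
    have "norm v \<le> (\<Sum>i<n. norm (E i))" if "G v v \<le> 1" for v
    proof -
      have c: "\<bar>G v (E i)\<bar> \<le> 1" if "i < n" for i
      \<comment> \<open>Compactness of the ball of \<open>G\<close> is to be measured in the norm of
        the type: by Parseval each coefficient is at most 1, so the norms of one fixed basis bound
        every vector of the ball.\<close>
      proof -
        have "(G v (E i))\<^sup>2 \<le> (\<Sum>i<n. (G v (E i))\<^sup>2)"
          using that by (intro member_le_sum) auto
        also have "\<dots> = G v v" using G.parseval[OF E, of v v] by (simp add: dim_UNIV dim_d power2_eq_square)
        also have "\<dots> \<le> 1" by fact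
        finally show ?thesis by (simp add: abs_square_le_1)
      qed
      have "norm v = norm (\<Sum>i<n. G v (E i) *\<^sub>R E i)"
        using G.orthonormal_expansion[OF E, of v] by (simp add: dim_UNIV dim_d)
      also have "\<dots> \<le> (\<Sum>i<n. norm (G v (E i) *\<^sub>R E i))" by (rule norm_sum)
      also have "\<dots> \<le> (\<Sum>i<n. norm (E i))"
        using c by (intro sum_mono) (simp add: mult_left_le_one_le)
      finally show ?thesis .
    qed
    then have "bounded {v. G v v \<le> 1}" unfolding bounded_iff by blast
    moreover have "closed {v. G v v \<le> 1}"
      by (intro closed_Collect_le bilinear_continuous_on_compose[OF _ _ G.bil] continuous_intros)
    ultimately show ?thesis using True by (simp add: S_def compact_eq_bounded_closed)
  qed (simp add: S_def)
  define P where "P = {E. (\<forall>i. E i \<in> S i)}"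
  have "compact P"
  proof -
    have "compactin (product_topology (\<lambda>_. euclidean) UNIV) (PiE UNIV S)"
      unfolding compactin_PiE using compact_S by simp
    moreover have "PiE UNIV S = P" by (auto simp: P_def PiE_UNIV_domain Pi_def)
    ultimately show ?thesis by (simp add: euclidean_product_topology)
  qed
  have P_frames: "closed {E :: nat \<Rightarrow> 'd. frame E}"
    unfolding frame_iff
    by (intro closed_Collect_all closed_Collect_imp open_Collect_const closed_Collect_eq cont_G continuous_on_const)
  have K: "compact (P \<inter> {E. frame E})" using \<open>compact P\<close> P_frames by (rule compact_Int_closed)
  \<comment> \<open>Truncation costs nothing, as \<open>frame\<close> and \<open>\<Delta>\<close>
    see only the first \<open>n\<close> vectors.\<close>
  have restrict: "(\<lambda>i. if i < n then E i else 0) \<in> P \<inter> {E. frame E}" if "frame E" for E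
    using frame_orthonormal[OF that] by (auto simp: P_def S_def frame_iff)
  obtain E where "frame E" using G.orthonormal_basis_exists[OF subspace_UNIV] by blast
  then have ne: "P \<inter> {E. frame E} \<noteq> {}" using restrict by blast
  obtain E0 where E0: "E0 \<in> P \<inter> {E. frame E}" "\<And>E. E \<in> P \<inter> {E. frame E} \<Longrightarrow> \<Delta> E \<le> \<Delta> E0"
    using continuous_attains_sup[OF K ne continuous_on_subset[OF cont_\<Delta> subset_UNIV]] by blast
  have "\<Delta> E \<le> \<Delta> E0" if "frame E" for E
    using E0(2)[OF restrict[OF that]] \<Delta>_cong[of E "\<lambda>i. if i < n then E i else 0"] by simp
  then show ?thesis using E0(1) by blast
qed

text \<open>Admissible subspaces and blocks of frames correspond in both directions, so the infimum
  is a minimum, taken at a frame that maximizes \<open>\<Delta>\<close>.\<close>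

lemma delta_eq:
  assumes "frame E0" "\<And>E. frame E \<Longrightarrow> \<Delta> E \<le> \<Delta> E0"
  shows "\<tau> UNIV - Inf {(\<Sum>L\<leftarrow>Ls. \<tau> L) | Ls. orthogonal_subspaces G ns Ls} = \<Delta> E0"
proof -
  have "Inf {(\<Sum>L\<leftarrow>Ls. \<tau> L) | Ls. orthogonal_subspaces G ns Ls} = \<tau> UNIV - \<Delta> E0"
  proof (rule cInf_eq_minimum)
    obtain Ls where "orthogonal_subspaces G ns Ls" "adapted E0 Ls"
      using adapted_subspaces_exist[OF assms(1)] by blast
    then show "\<tau> UNIV - \<Delta> E0 \<in> {(\<Sum>L\<leftarrow>Ls. \<tau> L) | Ls. orthogonal_subspaces G ns Ls}"
      using sum_\<tau>_adapted[OF assms(1)] by force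
    fix x assume "x \<in> {(\<Sum>L\<leftarrow>Ls. \<tau> L) | Ls. orthogonal_subspaces G ns Ls}"
    then obtain Ls where Ls: "orthogonal_subspaces G ns Ls" "x = (\<Sum>L\<leftarrow>Ls. \<tau> L)" by blast
    obtain E where E: "frame E" "adapted E Ls" using adapted_frame_exists[OF Ls(1)] by blast
    show "\<tau> UNIV - \<Delta> E0 \<le> x"
      using sum_\<tau>_adapted[OF E] assms(2)[OF E(1)] Ls(2) by simp
  qed
  then show ?thesis by simp
qed

section \<open>Ambient frames and the defect\<close>

definition normal_frame :: "(nat \<Rightarrow> 'd) \<Rightarrow> (nat \<Rightarrow> 'e) \<Rightarrow> bool" where
  "normal_frame E e \<longleftrightarrow> orthonormal_basis g UNIV e \<and> (\<forall>i<n. e i = J (E i))"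

lemma orthonormal_image:
  assumes "frame E"
  shows "orthonormal_family g (\<lambda>i. J (E i)) n"
  unfolding orthonormal_family_def using frame_orthonormal[OF assms] by (simp add: isometric)

lemma n_le: "n \<le> DIM('e)"
proof -
  obtain E where "frame E" using G.orthonormal_basis_exists[OF subspace_UNIV] by blast
  note fam = orthonormal_image[OF this]
  have "n = card ((\<lambda>i. J (E i)) ` {..<n})"
    using card_image[OF g.orthonormal_family_independent(1)[OF fam]] by simp
  also have "\<dots> \<le> DIM('e)"
    using independent_bound[OF g.orthonormal_family_independent(2)[OF fam]] by simp
  finally show ?thesis .
qed

lemma normal_frame_exists:
  assumes "frame E"
  shows "\<exists>e. normal_frame E e"
proof -
  note fam = orthonormal_image[OF assms]
  have "n \<le> dim (UNIV :: 'e set)" using n_le by (simp add: dim_UNIV)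
  then obtain e where e: "\<forall>i<n. e i = J (E i)" "orthonormal_family g e (dim (UNIV :: 'e set))"
    using g.orthonormal_extend[OF subspace_UNIV fam] by auto
  then show ?thesis
    unfolding normal_frame_def using g.orthonormal_family_basis[OF subspace_UNIV e(2)] by blast
qed

lemma normal_frame_normal:
  assumes "frame E" "normal_frame E e" "n \<le> r" "r < DIM('e)"
  shows "g (J u) (e r) = 0"
proof -
  have "u = (\<Sum>i<n. G u (E i) *\<^sub>R E i)"
    using G.orthonormal_expansion[OF assms(1), of u] by (simp add: dim_UNIV dim_d)
  then have "J u = (\<Sum>i<n. G u (E i) *\<^sub>R J (E i))"
    using linear_sum[OF linear_J, of "\<lambda>i. G u (E i) *\<^sub>R E i" "{..<n}"] linear_cmul[OF linear_J] by simp
  moreover have "g (J (E i)) (e r) = 0" if "i < n" for i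
  proof -
    have o: "orthonormal_basis g UNIV e" and je: "e i = J (E i)"
      using assms(2) that by (auto simp: normal_frame_def)
    have "g (e i) (e r) = 0"
      using o assms(3,4) that by (simp add: orthonormal_basis_def dim_UNIV)
    then show ?thesis by (simp add: je)
  qed
  ultimately show ?thesis by (simp add: g.lin)
qed

lemma normal_parseval:
  assumes "normal_frame E e" "\<And>w. g (J w) u = 0"
  shows "g u v = (\<Sum>r\<in>{n..<DIM('e)}. g u (e r) * g v (e r))"
proof -
  have "g u v = (\<Sum>r<DIM('e). g u (e r) * g v (e r))"
    using g.parseval[of UNIV e u v] assms(1) by (simp add: normal_frame_def dim_UNIV)
  also have "\<dots> = (\<Sum>r\<in>{n..<DIM('e)}. g u (e r) * g v (e r))"
  proof (rule sum.mono_neutral_right)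
    show "\<forall>i\<in>{..<DIM('e)} - {n..<DIM('e)}. g u (e i) * g v (e i) = 0"
      using assms g.sym[of u] by (auto simp: normal_frame_def)
  qed auto
  finally show ?thesis .
qed

text \<open>The sum of squares subtracted in \<open>chen_identity\<close>, for the groups of
  \<open>ns\<close>.\<close>

definition defect :: "(nat \<Rightarrow> nat \<Rightarrow> real) \<Rightarrow> real" where
  "defect a = (\<Sum>t<groups. ((\<Sum>i<n. if \<gamma> i = t then a i i else 0) - (\<Sum>i<n. a i i) / real groups)\<^sup>2)
    + (\<Sum>i<n. \<Sum>j<n. if \<gamma> i = \<gamma> j then 0 else (a i j)\<^sup>2)"

lemma defect_nonneg: "0 \<le> defect a"
  unfolding defect_def by (intro add_nonneg_nonneg sum_nonneg) auto

lemma defect_eq_0_iff: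
  assumes "\<And>i j. a i j = a j i"
  shows "defect a = 0 \<longleftrightarrow> (\<exists>c. adapted_block_form n ns c a)"
proof -
  have "defect a = 0 \<longleftrightarrow>
      (\<Sum>t<groups. ((\<Sum>i<n. if \<gamma> i = t then a i i else 0) - (\<Sum>i<n. a i i) / real groups)\<^sup>2) = 0 \<and>
      (\<Sum>i<n. \<Sum>j<n. if \<gamma> i = \<gamma> j then 0 else (a i j)\<^sup>2) = 0"
    unfolding defect_def by (intro add_nonneg_eq_0_iff sum_nonneg) auto
  also have "\<dots> \<longleftrightarrow> (\<exists>c. adapted_block_form n ns c a)"
    unfolding adapted_block_form_iff[OF assms]
    by (auto simp: sum_nonneg_eq_0_iff sum_nonneg)
  finally show ?thesis .
qed

text \<open>Expanding \<sigma> in the normal vectors \<open>e r\<close> splits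
  \<open>\<Delta>\<close> into one instance of \<open>chen_identity\<close> per normal direction.
  The constant \<open>f\<close> is counted once for each unordered pair of indices from different
  groups, hence the factor \<open>chen_b\<close>.\<close>

lemma \<Delta>_eq:
  assumes E: "frame E" and e: "normal_frame E e" and E1: "frame E1"
  defines "H \<equiv> (1 / real n) *\<^sub>R (\<Sum>i<n. \<sigma> (E1 i) (E1 i))"
  shows "\<Delta> E = chen_c n ns * g H H + chen_b n ns * f
    - (\<Sum>r\<in>{n..<DIM('e)}. defect (\<lambda>i j. g (\<sigma> (E i) (E j)) (e r))) / 2"
proof -
  let ?R = "{n..<DIM('e)}"
  define a where "a r i j = g (\<sigma> (E i) (E j)) (e r)" for r i j
  have \<sigma>\<sigma>: "g (\<sigma> u v) w = (\<Sum>r\<in>?R. g (\<sigma> u v) (e r) * g w (e r))" for u v w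
    by (rule normal_parseval[OF e \<sigma>_normal])
  have \<kappa>: "\<kappa> (E i) (E j) = f + (\<Sum>r\<in>?R. a r i i * a r j j - (a r i j)\<^sup>2)" if "i < n" "j < n" "\<gamma> i \<noteq> \<gamma> j" for i j
  proof -
    have "i \<noteq> j" using that by auto
    then show ?thesis
      using that frame_orthonormal[OF E]
      by (simp add: \<kappa>_def \<sigma>\<sigma>[of "E j" "E j" "\<sigma> (E i) (E i)"] \<sigma>\<sigma>[of "E i" "E j" "\<sigma> (E i) (E j)"]
        a_def sum_subtractf power2_eq_square mult.commute)
  qed
  have "2 * \<Delta> E = (\<Sum>i<n. \<Sum>j<n. f * (if \<gamma> i = \<gamma> j then 0 else 1)
      + (\<Sum>r\<in>?R. if \<gamma> i = \<gamma> j then 0 else a r i i * a r j j - (a r i j)\<^sup>2))"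
    unfolding \<Delta>_def using \<kappa> by (auto intro!: sum.cong)
  also have "\<dots> = f * (2 * chen_b n ns)
      + (\<Sum>r\<in>?R. \<Sum>i<n. \<Sum>j<n. if \<gamma> i = \<gamma> j then 0 else a r i i * a r j j - (a r i j)\<^sup>2)"
  proof -
    have "(\<Sum>i<n. \<Sum>j<n. \<Sum>r\<in>?R. h i j r) = (\<Sum>r\<in>?R. \<Sum>i<n. \<Sum>j<n. h i j r)" for h :: "nat \<Rightarrow> nat \<Rightarrow> nat \<Rightarrow> real"
      by (simp only: sum.swap[of _ ?R])
    then show ?thesis by (simp only: sum.distrib number_of_pairs flip: sum_distrib_left)
  qed
  also have "(\<Sum>r\<in>?R. \<Sum>i<n. \<Sum>j<n. if \<gamma> i = \<gamma> j then 0 else a r i i * a r j j - (a r i j)\<^sup>2) =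
      (\<Sum>r\<in>?R. (real groups - 1) / real groups * (\<Sum>i<n. a r i i)\<^sup>2 - defect (a r))"
    unfolding defect_def by (rule sum.cong[OF refl], rule chen_identity[OF groups_pos group_less])
  also have "\<dots> = (real groups - 1) / real groups * (\<Sum>r\<in>?R. (\<Sum>i<n. a r i i)\<^sup>2) - (\<Sum>r\<in>?R. defect (a r))"
    by (simp only: sum_subtractf sum_distrib_left)
  also have "(\<Sum>r\<in>?R. (\<Sum>i<n. a r i i)\<^sup>2) = (real n)\<^sup>2 * g H H"
  proof -
    \<comment> \<open>\<open>E1\<close> is the frame chosen in the mean curvature vector; the trace
      of \<sigma> is the same for the frame under study.\<close>
    have tr: "(\<Sum>i<n. \<sigma> (E1 i) (E1 i)) = (\<Sum>i<n. \<sigma> (E i) (E i))"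
      using G.trace_independent[OF E1 E, of \<sigma>] \<sigma>_left \<sigma>_right by (simp add: dim_UNIV dim_d)
    let ?s = "\<Sum>i<n. \<sigma> (E i) (E i)"
    have "g ?s ?s = (\<Sum>r\<in>?R. g ?s (e r) * g ?s (e r))"
      by (rule normal_parseval[OF e]) (simp add: g.lin \<sigma>_normal)
    also have "\<dots> = (\<Sum>r\<in>?R. (\<Sum>i<n. a r i i)\<^sup>2)"
      by (simp add: g.lin a_def power2_eq_square)
    finally show ?thesis
      unfolding H_def tr using n_pos by (simp add: g.scale_left g.scale_right power2_eq_square)
  qed
  \<comment> \<open>The factor \<open>(real n)\<^sup>2\<close> comes from the normalization of
    \<open>H\<close>; together with (N - 1)/N it is twice \<open>chen_c\<close>.\<close>
  also have "(real groups - 1) / real groups * ((real n)\<^sup>2 * g H H) = 2 * chen_c n ns * g H H"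
  proof -
    have "real n + real k - 1 - real (sum_list ns) = real groups - 1" by (simp add: real_groups)
    then show ?thesis
      unfolding chen_c_def real_groups[symmetric] using groups_pos by (simp add: field_simps)
  qed
  finally show ?thesis unfolding a_def by (simp add: field_simps)
qed

text \<open>Equality passes between \<delta> and a single frame in both directions: a maximizing
  frame exists, so equality gives it zero defect; conversely a frame with zero defect reaches the
  bound that limits the maximum.\<close>

theorem chen_inequality:
  fixes E1 :: "nat \<Rightarrow> 'd"
  assumes E1: "frame E1"
  defines "H \<equiv> (1 / real n) *\<^sub>R (\<Sum>i<n. \<sigma> (E1 i) (E1 i))"
    and "\<delta> \<equiv> \<tau> UNIV - Inf {(\<Sum>L\<leftarrow>Ls. \<tau> L) | Ls. orthogonal_subspaces G ns Ls}"
  shows "\<delta> \<le> chen_c n ns * g H H + chen_b n ns * f"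
    and "\<delta> = chen_c n ns * g H H + chen_b n ns * f \<longleftrightarrow>
      (\<exists>e E. frame E \<and> normal_frame E e \<and>
        (\<forall>r\<in>{n..<DIM('e)}. \<exists>c. adapted_block_form n ns c (\<lambda>i j. g (\<sigma> (E i) (E j)) (e r))))"
proof -
  let ?\<beta> = "chen_c n ns * g H H + chen_b n ns * f"
  obtain E0 where E0: "frame E0" "\<And>E. frame E \<Longrightarrow> \<Delta> E \<le> \<Delta> E0"
    using \<Delta>_attains_max by blast
  have \<delta>: "\<delta> = \<Delta> E0" unfolding \<delta>_def by (rule delta_eq[OF E0])
  have eq: "\<Delta> E = ?\<beta> - (\<Sum>r\<in>{n..<DIM('e)}. defect (\<lambda>i j. g (\<sigma> (E i) (E j)) (e r))) / 2"
    if "frame E" "normal_frame E e" for E e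
    unfolding H_def by (rule \<Delta>_eq[OF that E1])
  have le: "\<Delta> E \<le> ?\<beta>" if E: "frame E" for E
  proof -
    obtain e where e: "normal_frame E e" using normal_frame_exists[OF E] by blast
    have "0 \<le> (\<Sum>r\<in>{n..<DIM('e)}. defect (\<lambda>i j. g (\<sigma> (E i) (E j)) (e r)))"
      by (intro sum_nonneg defect_nonneg)
    then show ?thesis unfolding eq[OF E e] by simp
  qed
  have iff: "\<Delta> E = ?\<beta> \<longleftrightarrow>
      (\<forall>r\<in>{n..<DIM('e)}. \<exists>c. adapted_block_form n ns c (\<lambda>i j. g (\<sigma> (E i) (E j)) (e r)))"
    if "frame E" "normal_frame E e" for E e
  proof -
    have "\<Delta> E = ?\<beta> \<longleftrightarrow> (\<Sum>r\<in>{n..<DIM('e)}. defect (\<lambda>i j. g (\<sigma> (E i) (E j)) (e r))) = 0"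
      using eq[OF that] by auto
    also have "\<dots> \<longleftrightarrow> (\<forall>r\<in>{n..<DIM('e)}. defect (\<lambda>i j. g (\<sigma> (E i) (E j)) (e r)) = 0)"
      by (intro sum_nonneg_eq_0_iff defect_nonneg) simp
    also have "\<dots> \<longleftrightarrow> (\<forall>r\<in>{n..<DIM('e)}. \<exists>c. adapted_block_form n ns c (\<lambda>i j. g (\<sigma> (E i) (E j)) (e r)))"
    proof (rule ball_cong[OF refl])
      show "defect (\<lambda>i j. g (\<sigma> (E i) (E j)) (e r)) = 0 \<longleftrightarrow>
          (\<exists>c. adapted_block_form n ns c (\<lambda>i j. g (\<sigma> (E i) (E j)) (e r)))" for r
        by (rule defect_eq_0_iff) (simp only: \<sigma>_sym)
    qed
    finally show ?thesis .
  qed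
  show "\<delta> \<le> ?\<beta>" unfolding \<delta> by (rule le[OF E0(1)])
  show "\<delta> = ?\<beta> \<longleftrightarrow> (\<exists>e E. frame E \<and> normal_frame E e \<and>
        (\<forall>r\<in>{n..<DIM('e)}. \<exists>c. adapted_block_form n ns c (\<lambda>i j. g (\<sigma> (E i) (E j)) (e r))))"
  proof
    assume "\<delta> = ?\<beta>"
    moreover obtain e where "normal_frame E0 e" using normal_frame_exists[OF E0(1)] by blast
    ultimately show "\<exists>e E. frame E \<and> normal_frame E e \<and>
        (\<forall>r\<in>{n..<DIM('e)}. \<exists>c. adapted_block_form n ns c (\<lambda>i j. g (\<sigma> (E i) (E j)) (e r)))"
      using iff[OF E0(1)] E0(1) unfolding \<delta> by blast
  next
    assume "\<exists>e E. frame E \<and> normal_frame E e \<and>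
        (\<forall>r\<in>{n..<DIM('e)}. \<exists>c. adapted_block_form n ns c (\<lambda>i j. g (\<sigma> (E i) (E j)) (e r)))"
    then obtain e E where E: "frame E" "normal_frame E e"
        "\<forall>r\<in>{n..<DIM('e)}. \<exists>c. adapted_block_form n ns c (\<lambda>i j. g (\<sigma> (E i) (E j)) (e r))"
      by blast
    then have "\<Delta> E = ?\<beta>" using iff by blast
    then show "\<delta> = ?\<beta>" using E0(2)[OF E(1)] le[OF E0(1)] unfolding \<delta> by simp
  qed
qed

end

section \<open>Shape operators and the global statement\<close>

context riemannian_immersion
begin

lemma shape_operator_eq:
  "induced_metric B A g \<iota> p v (shape_operator B A g \<iota> p N u) = g (\<iota> p) (second_fundamental_form B A g \<iota> p v u) N"
proof -
  interpret M: pd_form "induced_metric B A g \<iota> p" by (rule pd_form_induced)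
  interpret N: pd_form "g (\<iota> p)" by (rule pd_form_metric)
  let ?\<sigma> = "second_fundamental_form B A g \<iota> p"
  have l: "linear (?\<sigma> u)" using second_fundamental_form_props(1) by (simp add: bilinear_def)
  have "linear (\<lambda>v. g (\<iota> p) (?\<sigma> u v) N)"
    by (rule linearI) (simp_all add: linear_add[OF l] linear_cmul[OF l] N.lin)
  from theI'[OF M.riesz[OF this]]
  have "induced_metric B A g \<iota> p (shape_operator B A g \<iota> p N u) v = g (\<iota> p) (?\<sigma> u v) N"
    unfolding shape_operator_def by blast
  then show ?thesis using M.sym second_fundamental_form_props(2) by metis
qed

end

theorem theorem6p3:
  fixes A :: "('a::{t2_space, second_countable_topology}, 'e::euclidean_space) chart set"
    and B :: "('b::{t2_space, second_countable_topology}, 'd::euclidean_space) chart set"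
    and \<phi> :: "'a \<Rightarrow> 'e \<Rightarrow> 'e" and \<xi> :: "'a \<Rightarrow> 'e" and \<eta> :: "'a \<Rightarrow> 'e \<Rightarrow> real"
    and g :: "'a \<Rightarrow> 'e \<Rightarrow> 'e \<Rightarrow> real"
    and f1 f2 f3 f4 f51 f52 f6 :: "'a \<Rightarrow> real"
    and \<iota> :: "'b \<Rightarrow> 'a"
    and n m :: nat
  assumes "n \<ge> 3"
    and "DIM('d) = n" and "DIM('e) = 2 * m + 1"
    and "gen_contact_space_form_divided_R5 A \<phi> \<xi> \<eta> g f1 f2 f3 f4 f51 f52 f6"
    and "\<forall>q. f3 q = f1 q - 1"
    and "smooth_atlas B" and "smooth_immersion B A \<iota>"
    and "C_totally_real B A \<xi> g \<iota>"
  shows "\<forall>ns\<in>chen_tuples n. \<forall>p.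
    (let gM = induced_metric B A g \<iota>; H = mean_curvature B A g \<iota> p;
         bound = chen_c n ns * g (\<iota> p) H H + chen_b n ns * f1 (\<iota> p)
     in chen_delta B gM ns p \<le> bound \<and>
        (chen_delta B gM ns p = bound \<longleftrightarrow>
          (\<exists>e E. orthonormal_basis (g (\<iota> p)) UNIV e \<and>
             orthonormal_basis (gM p) UNIV E \<and>
             (\<forall>i<n. e i = differential B A \<iota> p (E i)) \<and>
             (\<forall>r\<in>{n..<2 * m + 1}. e r \<in> normal_vectors B A g \<iota> p) \<and>
             (\<forall>r\<in>{n..<2 * m + 1}. \<exists>a. adapted_block_form n ns a
                (\<lambda>i j. gM p (E i) (shape_operator B A g \<iota> p (e r) (E j)))))))"
proof (intro ballI allI)
  fix ns p assume ns: "ns \<in> chen_tuples n"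
  let ?gM = "induced_metric B A g \<iota>" and ?J = "differential B A \<iota> p"
    and ?\<sigma> = "second_fundamental_form B A g \<iota> p"
  have contact: "contact_metric A \<phi> \<xi> \<eta> g"
    and R: "riemann A g q X Y Z =
        f1 q *\<^sub>R R1 (g q) X Y Z
        + f2 q *\<^sub>R R2 (g q) (\<phi> q) X Y Z
        + (f1 q - 1) *\<^sub>R R3 (g q) (\<xi> q) (\<eta> q) X Y Z
        + f4 q *\<^sub>R R4 (g q) (h_tensor A \<phi> \<xi> q) X Y Z
        + f51 q *\<^sub>R R51 (g q) (h_tensor A \<phi> \<xi> q) X Y Z
        + f52 q *\<^sub>R R52 (g q) (\<phi> q) (h_tensor A \<phi> \<xi> q) X Y Z
        + f6 q *\<^sub>R R6 (g q) (\<xi> q) (\<eta> q) (h_tensor A \<phi> \<xi> q) X Y Z" for q X Y Z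
    using assms(4,5) unfolding gen_contact_space_form_divided_R5_def gen_space_form_divided_R5_def
    by simp_all
  have A: "smooth_atlas A" "riemannian_metric A g"
    using contact by (simp_all add: contact_metric_def almost_contact_metric_def)
  interpret C_totally_real_submanifold A B \<phi> \<xi> \<eta> g \<iota>
    by unfold_locales (fact A assms contact)+
  note sff = second_fundamental_form_props(1-3)[of p]
  \<comment> \<open>For an orthonormal pair the denominator of the sectional curvature and the
    factor of \<open>f1\<close> are both 1.\<close>
  have K: "sectional_curvature B ?gM p u v = f1 (\<iota> p) + g (\<iota> p) (?\<sigma> v v) (?\<sigma> u u) - g (\<iota> p) (?\<sigma> u v) (?\<sigma> u v)"
    if "?gM p u u = 1" "?gM p v v = 1" "?gM p u v = 0" for u v
    using gauss_C_totally_real[OF R, of p u v] that by (simp add: sectional_curvature_def)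
  interpret C: chen_point n ns "?gM p" "g (\<iota> p)" ?J ?\<sigma> "f1 (\<iota> p)" "sectional_curvature B ?gM p"
  proof (intro chen_point.intro chen_tuple.intro chen_point_axioms.intro pd_form_induced pd_form_metric
      linear_differential sff ns K)
    show "0 < n" using assms(1) by simp
    show "DIM('d) = n" by fact
    show "?gM p u v = g (\<iota> p) (?J u) (?J v)" for u v by (rule induced_metric_def)
  qed
  define E1 where "E1 = (SOME E. orthonormal_basis (?gM p) UNIV E)"
  have E1: "C.frame E1"
    unfolding E1_def using someI_ex[OF C.G.orthonormal_basis_exists[OF subspace_UNIV]] .
  have H: "mean_curvature B A g \<iota> p = (1 / real n) *\<^sub>R (\<Sum>i<n. ?\<sigma> (E1 i) (E1 i))"
    by (simp add: mean_curvature_def E1_def Let_def assms(2))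
  have tau: "tau B ?gM p = C.\<tau>"
    by (intro ext) (simp add: tau_def C.\<tau>_def)
  have \<delta>: "chen_delta B ?gM ns p =
      C.\<tau> UNIV - Inf {(\<Sum>L\<leftarrow>Ls. C.\<tau> L) | Ls. orthogonal_subspaces (?gM p) ns Ls}"
    unfolding chen_delta_def tau ..
  have ex: "(\<exists>e E. C.frame E \<and> C.normal_frame E e \<and>
        (\<forall>r\<in>{n..<DIM('e)}. \<exists>c. adapted_block_form n ns c (\<lambda>i j. g (\<iota> p) (?\<sigma> (E i) (E j)) (e r)))) \<longleftrightarrow>
      (\<exists>e E. orthonormal_basis (g (\<iota> p)) UNIV e \<and>
             orthonormal_basis (?gM p) UNIV E \<and>
             (\<forall>i<n. e i = ?J (E i)) \<and>
             (\<forall>r\<in>{n..<2 * m + 1}. e r \<in> normal_vectors B A g \<iota> p) \<and>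
             (\<forall>r\<in>{n..<2 * m + 1}. \<exists>a. adapted_block_form n ns a
                (\<lambda>i j. ?gM p (E i) (shape_operator B A g \<iota> p (e r) (E j)))))"
  proof (intro ex_cong1)
    fix e E
    \<comment> \<open>Normality of the \<open>e r\<close> follows from orthogonality to the tangent
      part of the frame, so the condition on normal vectors can be added to the equivalence.\<close>
    have "C.frame E \<Longrightarrow> C.normal_frame E e \<Longrightarrow> \<forall>r\<in>{n..<2 * m + 1}. e r \<in> normal_vectors B A g \<iota> p"
      using C.normal_frame_normal by (simp add: normal_vectors_def assms(3))
    then show "(C.frame E \<and> C.normal_frame E e \<and>
        (\<forall>r\<in>{n..<DIM('e)}. \<exists>c. adapted_block_form n ns c (\<lambda>i j. g (\<iota> p) (?\<sigma> (E i) (E j)) (e r)))) \<longleftrightarrow>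
      orthonormal_basis (g (\<iota> p)) UNIV e \<and> C.frame E \<and> (\<forall>i<n. e i = ?J (E i)) \<and>
      (\<forall>r\<in>{n..<2 * m + 1}. e r \<in> normal_vectors B A g \<iota> p) \<and>
      (\<forall>r\<in>{n..<2 * m + 1}. \<exists>a. adapted_block_form n ns a
         (\<lambda>i j. ?gM p (E i) (shape_operator B A g \<iota> p (e r) (E j))))"
      unfolding shape_operator_eq C.normal_frame_def assms(3) by argo
  qed
  show "let gM = ?gM; H = mean_curvature B A g \<iota> p;
         bound = chen_c n ns * g (\<iota> p) H H + chen_b n ns * f1 (\<iota> p)
     in chen_delta B gM ns p \<le> bound \<and>
        (chen_delta B gM ns p = bound \<longleftrightarrow>
          (\<exists>e E. orthonormal_basis (g (\<iota> p)) UNIV e \<and>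
             orthonormal_basis (gM p) UNIV E \<and>
             (\<forall>i<n. e i = differential B A \<iota> p (E i)) \<and>
             (\<forall>r\<in>{n..<2 * m + 1}. e r \<in> normal_vectors B A g \<iota> p) \<and>
             (\<forall>r\<in>{n..<2 * m + 1}. \<exists>a. adapted_block_form n ns a
                (\<lambda>i j. gM p (E i) (shape_operator B A g \<iota> p (e r) (E j))))))"
    unfolding Let_def H \<delta> ex[symmetric] by (intro conjI C.chen_inequality[OF E1])
qed

end
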